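(* Let $n\ge 2$ and fix a nonempty set $Q\subseteq\{1,\dots,n-1\}$. Let $\lambda$ be an $n$-partition such that $Q(\lambda)\subseteq Q$ and let $\pi$ be a $Q$-chain. Then the (residue classes of the) monomials of the $\pi$-Demazure tableaux of shape $\lambda$ form a basis of the complex vector space $\Gamma_\lambda(\pi)=\Gamma_\lambda/Z_\lambda(\pi)$; that is, the family of residue classes, indexed by the $\pi$-Demazure tableaux of shape $\lambda$, is linearly independent and spans $\Gamma_\lambda(\pi)$.
   Context: Shapes and tabloids. Write $[n]=\{1,\dots,n\}$. An $n$-partition is $\lambda=(\lambda_1\ge\lambda_2\ge\dots\ge\lambda_n\ge 0)$ (integers), with $\lambda_{n+1}:=0$. Its shape, also denoted $\lambda$, is a left-justified array of boxes with $\lambda_r$ boxes in row $r$ (rows numbered from top to bottom); its column lengths are $n\ge\zeta_1\ge\dots\ge\zeta_{\lambda_1}$, and $(r,c)\in\lambda$ denotes the location in row $r$ and column $c$. $Q(\lambda)$ is the set of distinct column lengths of $\lambda$ that are less than $n$. A tabloid of shape $\lambda$ is a filling $T$ of the shape with values $T(r,c)\in[n]$ that strictly increase down each column; a tableau is a tabloid whose values weakly increase from left to right along each row. For tabloids of the same shape, $T\preceq U$ means $T(r,c)\le U(r,c)$ for all $(r,c)$. For $P\subseteq[n]$, $Y(P)$ denotes the single column of length $|P|$ filled with the elements of $P$ in increasing order from top to bottom. $Q$-chains. Write $Q=\{q_1<\dots<q_k\}$ and $q_{k+1}:=n$. A $Q$-chain is a sequence $\pi=(P_1\subset P_2\subset\dots\subset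 P_k)$ of subsets of $[n]$ with $|P_j|=q_j$. If $Q(\lambda)\subseteq Q$, the $\lambda$-key $Y_\lambda(\pi)$ is the tableau of shape $\lambda$ whose columns of length $n$ are all $Y([n])$ and whose columns of length $q_j$ are all $Y(P_j)$ ($1\le j\le k$). Scanning tableau. The earliest weakly increasing subsequence (EWIS) of a sequence $(b_1,b_2,\dots)$ is $(b_{i_1},b_{i_2},\dots)$ where $i_1=1$ and for $j>1$, $i_j$ is the smallest index larger than $i_{j-1}$ with $b_{i_j}\ge b_{i_{j-1}}$ (stop when none exists). Let $T$ be a tableau of shape $\lambda$. Its scanning tableau $S(T)$ is the filling of $\lambda$ obtained as follows. To fill column $c$, consider only columns $c,c+1,\dots,\lambda_1$ of $T$, with all locations unmarked. Form the sequence, from left to right, of the bottom-most unmarked values of the columns that still have unmarked locations, find its EWIS, and mark the locations in $T$ of the members of the EWIS; place the last member of the EWIS in the lowest unfilled location of column $c$ of $S(T)$. Repeat, treating marked locations as no longer part of $T$, until column $c$ of $S(T)$ is filled from the bottom row $\zeta_c$ up to row $1$. Do this for every $c=1,\dots,\lambda_1$ (erasing all marks before starting each column). A tableau $T$ of shape $\lambda$ is $\pi$-Demazure if $S(T)\preceq Y_\lambda(\pi)$. Monomials. Let $\mathbb{C}[x_{ij}]$ be the polynomial ring in the $n^2$ entries of an $n\times n$ matrix $(x_{ij})$. For $r_1,\dots,r_q\in[n]$, the $q$-initial minor with rows $r_1,\dots,r_q$ is the determinant of the $q\times q$ matrix whose $i$-th row consists of the first $q$ entries of row $r_i$ of $(x_{ij})$.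 The monomial of a tabloid $T$ of shape $\lambda$ is the product over $1\le c\le\lambda_1$ of the $\zeta_c$-initial minors with rows $T(1,c),\dots,T(\zeta_c,c)$. $\Gamma_\lambda\subseteq\mathbb{C}[x_{ij}]$ is the linear span of the monomials of all tabloids of shape $\lambda$; $Z_\lambda(\pi)\subseteq\Gamma_\lambda$ is the linear span of the monomials of the tabloids $T$ of shape $\lambda$ with $T\not\preceq Y_\lambda(\pi)$; and $\Gamma_\lambda(\pi):=\Gamma_\lambda/Z_\lambda(\pi)$. *)

theory Defs
  imports
    "Jordan_Normal_Form.VS_Connect"
    "HOL-Library.Poly_Mapping"
    "HOL-Algebra.AbelCoset"
begin

section \<open>Shapes, tabloids, tableaux\<close>

text \<open>An \<open>n\<close>-partition is a function on row numbers, rows being numbered from 1; it vanishes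
  outside \<open>{1..n}\<close>.\<close>

definition n_partition :: "nat \<Rightarrow> (nat \<Rightarrow> nat) \<Rightarrow> bool" where
  "n_partition n lam \<longleftrightarrow>
     (\<forall>r\<in>{1..n}. \<forall>s\<in>{1..n}. r \<le> s \<longrightarrow> lam s \<le> lam r) \<and> (\<forall>r. r \<notin> {1..n} \<longrightarrow> lam r = 0)"

definition shape :: "(nat \<Rightarrow> nat) \<Rightarrow> (nat \<times> nat) set" where
  "shape lam = {(r, c). 1 \<le> r \<and> 1 \<le> c \<and> c \<le> lam r}"

definition col_len :: "(nat \<Rightarrow> nat) \<Rightarrow> nat \<Rightarrow> nat" where
  "col_len lam c = card {r. (r, c) \<in> shape lam}"

definition short_col_lens :: "nat \<Rightarrow> (nat \<Rightarrow> nat) \<Rightarrow> nat set" where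
  "short_col_lens n lam = {col_len lam c | c. c \<in> {1..lam 1} \<and> col_len lam c < n}"

text \<open>Fillings are total functions \<open>T r c\<close>.  They are required to be 0 off the shape, so that
  distinct functions are distinct tabloids.\<close>

definition tabloids :: "nat \<Rightarrow> (nat \<Rightarrow> nat) \<Rightarrow> (nat \<Rightarrow> nat \<Rightarrow> nat) set" where
  "tabloids n lam = {T.
     (\<forall>r c. (r, c) \<in> shape lam \<longrightarrow> T r c \<in> {1..n}) \<and>
     (\<forall>r c. (r, c) \<notin> shape lam \<longrightarrow> T r c = 0) \<and>
     (\<forall>r s c. (r, c) \<in> shape lam \<and> (s, c) \<in> shape lam \<and> r < s \<longrightarrow> T r c < T s c)}"

definition tableaux :: "nat \<Rightarrow> (nat \<Rightarrow> nat) \<Rightarrow> (nat \<Rightarrow> nat \<Rightarrow> nat) set" where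
  "tableaux n lam = {T \<in> tabloids n lam.
     \<forall>r c d. (r, c) \<in> shape lam \<and> (r, d) \<in> shape lam \<and> c \<le> d \<longrightarrow> T r c \<le> T r d}"

definition filling_le :: "(nat \<Rightarrow> nat) \<Rightarrow> (nat \<Rightarrow> nat \<Rightarrow> nat) \<Rightarrow> (nat \<Rightarrow> nat \<Rightarrow> nat) \<Rightarrow> bool" where
  "filling_le lam T U \<longleftrightarrow> (\<forall>(r, c)\<in>shape lam. T r c \<le> U r c)"


section \<open>Chains and keys\<close>

text \<open>Lists are indexed from 0, so \<open>P ! j\<close> and \<open>sorted_list_of_set Q ! j\<close> are the
  mathematical \<open>P\<close> and \<open>q\<close> with subscript \<open>j + 1\<close>.\<close>

definition Q_chain :: "nat \<Rightarrow> nat set \<Rightarrow> nat set list \<Rightarrow> bool" where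
  "Q_chain n Q P \<longleftrightarrow> length P = card Q \<and>
     (\<forall>j<card Q. P ! j \<subseteq> {1..n} \<and> card (P ! j) = sorted_list_of_set Q ! j) \<and>
     sorted_wrt (\<subset>) P"

definition key_column :: "nat set \<Rightarrow> nat \<Rightarrow> nat" where
  "key_column A r = sorted_list_of_set A ! (r - 1)"

definition lam_key :: "nat \<Rightarrow> nat set \<Rightarrow> (nat \<Rightarrow> nat) \<Rightarrow> nat set list \<Rightarrow> nat \<Rightarrow> nat \<Rightarrow> nat" where
  "lam_key n Q lam P r c =
     (if (r, c) \<notin> shape lam then 0
      else if col_len lam c = n then key_column {1..n} r
      else key_column (P ! (THE j. j < card Q \<and> sorted_list_of_set Q ! j = col_len lam c)) r)"


section \<open>The scanning tableau\<close>

text \<open>The earliest weakly increasing subsequence, for a sequence of objects compared through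
  their values under \<open>f\<close>.\<close>

function ewis :: "('a \<Rightarrow> nat) \<Rightarrow> 'a list \<Rightarrow> 'a list" where
  "ewis f [] = []"
| "ewis f (x # xs) = x # ewis f (dropWhile (\<lambda>y. \<not> f y \<ge> f x) xs)"
  by pat_completeness auto
termination
  by (relation "measure (\<lambda>(f, xs). length xs)") (auto simp: less_Suc_eq_le length_dropWhile_le)

text \<open>\<open>M\<close> is the set of marked locations \<open>(r, d)\<close>.\<close>

definition unmarked_rows :: "(nat \<Rightarrow> nat) \<Rightarrow> (nat \<times> nat) set \<Rightarrow> nat \<Rightarrow> nat set" where
  "unmarked_rows lam M d = {r. (r, d) \<in> shape lam \<and> (r, d) \<notin> M}"

definition bottom_locs :: "(nat \<Rightarrow> nat) \<Rightarrow> nat \<Rightarrow> (nat \<times> nat) set \<Rightarrow> (nat \<times> nat) list" where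
  "bottom_locs lam c M =
     map (\<lambda>d. (Max (unmarked_rows lam M d), d))
       (filter (\<lambda>d. unmarked_rows lam M d \<noteq> {}) [c..<Suc (lam 1)])"

definition scan_path ::
    "(nat \<Rightarrow> nat) \<Rightarrow> (nat \<Rightarrow> nat \<Rightarrow> nat) \<Rightarrow> nat \<Rightarrow> (nat \<times> nat) set \<Rightarrow> (nat \<times> nat) list" where
  "scan_path lam T c M = ewis (\<lambda>(r, d). T r d) (bottom_locs lam c M)"

text \<open>The locations marked after \<open>k\<close> rounds of the scan that starts at column \<open>c\<close>.\<close>

primrec marks ::
    "(nat \<Rightarrow> nat) \<Rightarrow> (nat \<Rightarrow> nat \<Rightarrow> nat) \<Rightarrow> nat \<Rightarrow> nat \<Rightarrow> (nat \<times> nat) set" where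
  "marks lam T c 0 = {}"
| "marks lam T c (Suc k) = marks lam T c k \<union> set (scan_path lam T c (marks lam T c k))"

text \<open>Column \<open>c\<close> is filled from the bottom up: row \<open>r\<close> receives the last member of the
  subsequence found after \<open>col_len lam c - r\<close> earlier rounds.\<close>

definition scanning_tableau :: "(nat \<Rightarrow> nat) \<Rightarrow> (nat \<Rightarrow> nat \<Rightarrow> nat) \<Rightarrow> nat \<Rightarrow> nat \<Rightarrow> nat" where
  "scanning_tableau lam T r c =
     (if (r, c) \<in> shape lam
      then (case last (scan_path lam T c (marks lam T c (col_len lam c - r))) of (s, d) \<Rightarrow> T s d)
      else 0)"

definition demazure_tableaux ::
    "nat \<Rightarrow> nat set \<Rightarrow> (nat \<Rightarrow> nat) \<Rightarrow> nat set list \<Rightarrow> (nat \<Rightarrow> nat \<Rightarrow> nat) set" where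
  "demazure_tableaux n Q lam P =
     {T \<in> tableaux n lam. filling_le lam (scanning_tableau lam T) (lam_key n Q lam P)}"


section \<open>The polynomial ring and tabloid monomials\<close>

text \<open>An exponent vector has type \<open>(nat \<times> nat) \<Rightarrow>\<^sub>0 nat\<close>; the indeterminate \<open>x i j\<close> is indexed by
  the pair \<open>(i, j)\<close>.\<close>

type_synonym cpoly = "((nat \<times> nat) \<Rightarrow>\<^sub>0 nat) \<Rightarrow>\<^sub>0 complex"

definition indet :: "nat \<Rightarrow> nat \<Rightarrow> cpoly" where
  "indet i j = Poly_Mapping.single (Poly_Mapping.single (i, j) 1) 1"

text \<open>The polynomials in the indeterminates \<open>x i j\<close> with \<open>1 \<le> i, j \<le> n\<close>, as a complex vector
  space.\<close>

definition poly_space :: "nat \<Rightarrow> (complex, cpoly) module" where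
  "poly_space n =
     \<lparr>carrier = {p. \<forall>m\<in>Poly_Mapping.keys p. Poly_Mapping.keys m \<subseteq> {1..n} \<times> {1..n}},
      mult = (*), one = 1, zero = 0, add = (+),
      smult = (\<lambda>a p. Poly_Mapping.map ((*) a) p)\<rparr>"

lemma map_scale_eq: "Poly_Mapping.map ((*) (a::complex)) p = Poly_Mapping.single 0 a * (p::cpoly)"
proof -
  have "Poly_Mapping.map ((*) a) p = (\<Sum>m\<in>Poly_Mapping.keys p. Poly_Mapping.single m (a * poly_mapping.lookup p m))"
    by (rule poly_mapping_eqI)
      (auto simp: lookup_sum lookup_single when_def Poly_Mapping.map.rep_eq in_keys_iff sum.delta)
  also have "\<dots> = Poly_Mapping.single 0 a * (\<Sum>m\<in>Poly_Mapping.keys p. Poly_Mapping.single m (poly_mapping.lookup p m))"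
    by (simp add: sum_distrib_left mult_single)
  also have "(\<Sum>m\<in>Poly_Mapping.keys p. Poly_Mapping.single m (poly_mapping.lookup p m)) = p"
    by (rule poly_mapping_eqI)
      (auto simp: lookup_sum lookup_single when_def in_keys_iff sum.delta)
  finally show ?thesis .
qed

lemma poly_space_simps:
  "p \<in> carrier (poly_space n) \<longleftrightarrow> (\<forall>m\<in>Poly_Mapping.keys p. Poly_Mapping.keys m \<subseteq> {1..n} \<times> {1..n})"
  "add (poly_space n) = (+)" "zero (poly_space n) = 0"
  "module.smult (poly_space n) = (\<lambda>a p. Poly_Mapping.single 0 a * p)"
  by (simp_all add: poly_space_def map_scale_eq)

lemma poly_space_mult_closed:
  assumes "p \<in> carrier (poly_space n)" "q \<in> carrier (poly_space n)"
  shows "p * q \<in> carrier (poly_space n)"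
  unfolding poly_space_simps
proof
  fix m assume "m \<in> Poly_Mapping.keys (p * q)"
  then obtain a b where m: "m = a + b" "a \<in> Poly_Mapping.keys p" "b \<in> Poly_Mapping.keys q"
    using keys_mult[of p q] by blast
  with assms have "Poly_Mapping.keys a \<subseteq> {1..n} \<times> {1..n}" "Poly_Mapping.keys b \<subseteq> {1..n} \<times> {1..n}"
    unfolding poly_space_simps by blast+
  with Poly_Mapping.keys_add[of a b] show "Poly_Mapping.keys m \<subseteq> {1..n} \<times> {1..n}" unfolding m by blast
qed

lemma poly_space_add_closed:
  "p \<in> carrier (poly_space n) \<Longrightarrow> q \<in> carrier (poly_space n) \<Longrightarrow> p + q \<in> carrier (poly_space n)"
  unfolding poly_space_simps using Poly_Mapping.keys_add[of p q] by blast

lemma poly_space_const: "Poly_Mapping.single 0 a \<in> carrier (poly_space n)"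
  unfolding poly_space_simps by simp

lemma vectorspace_poly_space: "vectorspace (class_ring :: complex ring) (poly_space n)"
proof -
  have "Module.module (class_ring :: complex ring) (poly_space n)"
  proof (rule module_criteria, goal_cases)
    case 4 show ?case
      by (intro ballI, rule_tac x = "- v" in bexI)
        (simp_all add: poly_space_simps)
  qed (auto simp: poly_space_simps(2-4) algebra_simps mult_single single_add class_cring.cring_axioms
        class_ring_simps Module.module_def intro: poly_space_add_closed poly_space_mult_closed poly_space_const class_cring.is_cring,
       simp_all add: poly_space_simps)
  then show ?thesis
    by (simp add: vectorspace_def class_field)
qed


definition initial_minor :: "nat \<Rightarrow> (nat \<Rightarrow> nat) \<Rightarrow> cpoly" where
  "initial_minor q rs = det (mat q q (\<lambda>(i, j). indet (rs (Suc i)) (Suc j)))"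

definition tabloid_monomial :: "(nat \<Rightarrow> nat) \<Rightarrow> (nat \<Rightarrow> nat \<Rightarrow> nat) \<Rightarrow> cpoly" where
  "tabloid_monomial lam T = (\<Prod>c\<in>{1..lam 1}. initial_minor (col_len lam c) (\<lambda>r. T r c))"


section \<open>Quotient vector spaces and bases given as families\<close>

text \<open>The product components of a module record play no role and are left undefined, as in
  \<^const>\<open>module_vec\<close>.\<close>

definition quot_space :: "('a, 'b, 'm) module_scheme \<Rightarrow> 'b set \<Rightarrow> ('a, 'b set) module" where
  "quot_space V W =
     \<lparr>carrier = a_rcosets\<^bsub>V\<^esub> W, mult = undefined, one = undefined, zero = W, add = set_add V,
      smult = (\<lambda>a A. \<Union>x\<in>A. W +>\<^bsub>V\<^esub> (a \<odot>\<^bsub>V\<^esub> x))\<rparr>"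

lemma vectorspace_quot_space:
  assumes "subspace K W V"
  shows "vectorspace K (quot_space V W)"
proof -
  interpret vectorspace K V using assms by (simp add: subspace_def)
  interpret W: submodule K W V using assms by (simp add: subspace_def)
  have inv: "\<ominus>\<^bsub>V\<^esub> x \<in> W" if "x \<in> W" for x
  proof -
    have "\<ominus>\<^bsub>K\<^esub> \<one>\<^bsub>K\<^esub> \<in> carrier K" by simp
    from W.smult_closed[OF this that] smult_minus_1[of x] that W.subset show ?thesis by (metis subsetD)
  qed
  have ne: "W \<noteq> {}" using W.zero_closed by blast
  have "additive_subgroup W V"
    by (rule additive_subgroup.intro, rule group.subgroupI[OF M.a_group])
      (use W.subset inv ne in \<open>auto simp: a_inv_def\<close>)
  then interpret A: abelian_subgroup W V
    by (rule abelian_subgroupI3) (rule M.abelian_group_axioms)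
  let ?Q = "quot_space V W"
  have car: "carrier ?Q = {W +>\<^bsub>V\<^esub> x | x. x \<in> carrier V}"
    by (auto simp: quot_space_def A_RCOSETS_def RCOSETS_def a_r_coset_def)
  have smult: "a \<odot>\<^bsub>?Q\<^esub> (W +>\<^bsub>V\<^esub> x) = W +>\<^bsub>V\<^esub> (a \<odot>\<^bsub>V\<^esub> x)"
    if "a \<in> carrier K" "x \<in> carrier V" for a x
  proof -
    have eq: "W +>\<^bsub>V\<^esub> (a \<odot>\<^bsub>V\<^esub> y) = W +>\<^bsub>V\<^esub> (a \<odot>\<^bsub>V\<^esub> x)" if y: "y \<in> W +>\<^bsub>V\<^esub> x" for y
    proof -
      obtain w where w: "w \<in> W" "y = w \<oplus>\<^bsub>V\<^esub> x"
        using y by (auto simp: a_r_coset_def r_coset_def)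
      have "w \<in> carrier V" "a \<odot>\<^bsub>V\<^esub> w \<in> W" using w W.subset \<open>a \<in> carrier K\<close> by auto
      then have "a \<odot>\<^bsub>V\<^esub> y \<in> W +>\<^bsub>V\<^esub> (a \<odot>\<^bsub>V\<^esub> x)"
        using w \<open>a \<in> carrier K\<close> \<open>x \<in> carrier V\<close>
        by (auto simp: a_r_coset_def r_coset_def smult_r_distr)
      then show ?thesis
        using A.a_repr_independence'[of "a \<odot>\<^bsub>V\<^esub> y" "a \<odot>\<^bsub>V\<^esub> x"] \<open>a \<in> carrier K\<close> \<open>x \<in> carrier V\<close> by simp
    qed
    have "(\<Union>y\<in>W +>\<^bsub>V\<^esub> x. W +>\<^bsub>V\<^esub> (a \<odot>\<^bsub>V\<^esub> y)) = W +>\<^bsub>V\<^esub> (a \<odot>\<^bsub>V\<^esub> x)"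
      by (rule UN_constant_eq[OF A.a_rcos_self[OF that(2)]]) (intro ballI, rule eq)
    then show ?thesis by (simp add: quot_space_def)
  qed
  have add: "(W +>\<^bsub>V\<^esub> x) \<oplus>\<^bsub>?Q\<^esub> (W +>\<^bsub>V\<^esub> y) = W +>\<^bsub>V\<^esub> (x \<oplus>\<^bsub>V\<^esub> y)"
    if "x \<in> carrier V" "y \<in> carrier V" for x y
    using A.a_rcos_sum[OF that] by (simp add: quot_space_def)
  have zero: "\<zero>\<^bsub>?Q\<^esub> = W +>\<^bsub>V\<^esub> \<zero>\<^bsub>V\<^esub>"
    using M.a_coset_join2[OF M.zero_closed A.a_subgroup W.zero_closed] by (simp add: quot_space_def)
  have "Module.module K ?Q"
  proof (rule module_criteria, goal_cases)
    case 1 show ?case by (rule R.is_cring)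
  next
    case 4
    show ?case
    proof
      fix v assume "v \<in> carrier ?Q"
      then obtain x where x: "x \<in> carrier V" "v = W +>\<^bsub>V\<^esub> x" by (auto simp: car)
      then show "\<exists>w\<in>carrier ?Q. v \<oplus>\<^bsub>?Q\<^esub> w = \<zero>\<^bsub>?Q\<^esub>"
        by (intro bexI[of _ "W +>\<^bsub>V\<^esub> (\<ominus>\<^bsub>V\<^esub> x)"]) (auto simp: add zero car M.r_neg)
    qed
  next
    case 2 show ?case using car zero M.zero_closed by blast
  next
    case 3 show ?case using add M.a_closed by (fastforce simp: car)
  next
    case 5 show ?case using smult smult_closed by (fastforce simp: car)
  next
    case 6 show ?case using M.a_comm by (auto simp: car add)
  qed (auto simp: car add zero smult smult_assoc1 smult_l_distr smult_r_distr M.a_assoc)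
  then show ?thesis by (simp add: vectorspace_def field_axioms)
qed


definition lin_indpt_family ::
    "('a, 'k) ring_scheme \<Rightarrow> ('a, 'b, 'm) module_scheme \<Rightarrow> ('i \<Rightarrow> 'b) \<Rightarrow> 'i set \<Rightarrow> bool" where
  "lin_indpt_family K V v I \<longleftrightarrow>
     v \<in> I \<rightarrow> carrier V \<and>
     (\<forall>J a. finite J \<and> J \<subseteq> I \<and> a \<in> J \<rightarrow> carrier K \<and> (\<Oplus>\<^bsub>V\<^esub>i\<in>J. a i \<odot>\<^bsub>V\<^esub> v i) = \<zero>\<^bsub>V\<^esub>
       \<longrightarrow> (\<forall>i\<in>J. a i = \<zero>\<^bsub>K\<^esub>))"

definition basis_family ::
    "('a, 'k) ring_scheme \<Rightarrow> ('a, 'b, 'm) module_scheme \<Rightarrow> ('i \<Rightarrow> 'b) \<Rightarrow> 'i set \<Rightarrow> bool" where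
  "basis_family K V v I \<longleftrightarrow>
     lin_indpt_family K V v I \<and> LinearCombinations.module.span K V (v ` I) = carrier V"


section \<open>The spaces attached to a shape and a chain\<close>

definition Gamma_space :: "nat \<Rightarrow> (nat \<Rightarrow> nat) \<Rightarrow> (complex, cpoly) module" where
  "Gamma_space n lam = (poly_space n)
     \<lparr>carrier := LinearCombinations.module.span class_ring (poly_space n)
                   (tabloid_monomial lam ` tabloids n lam)\<rparr>"

definition Z_space :: "nat \<Rightarrow> nat set \<Rightarrow> (nat \<Rightarrow> nat) \<Rightarrow> nat set list \<Rightarrow> cpoly set" where
  "Z_space n Q lam P = LinearCombinations.module.span class_ring (poly_space n)
     (tabloid_monomial lam ` {T \<in> tabloids n lam. \<not> filling_le lam T (lam_key n Q lam P)})"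

definition Gamma_quot ::
    "nat \<Rightarrow> nat set \<Rightarrow> (nat \<Rightarrow> nat) \<Rightarrow> nat set list \<Rightarrow> (complex, cpoly set) module" where
  "Gamma_quot n Q lam P = quot_space (Gamma_space n lam) (Z_space n Q lam P)"

definition residue_class ::
    "nat \<Rightarrow> nat set \<Rightarrow> (nat \<Rightarrow> nat) \<Rightarrow> nat set list \<Rightarrow> cpoly \<Rightarrow> cpoly set" where
  "residue_class n Q lam P p = Z_space n Q lam P +>\<^bsub>Gamma_space n lam\<^esub> p"

end

theory Submission
  imports Defs
begin

text \<open>
  A tableau is handled as the list of the sets of entries of its columns, and columns are compared
  through counting functions.  If \<open>Y\<close> follows \<open>B\<close> in a tableau, let \<open>lift B Y\<close> be the least set of
  size \<open>card B\<close> above \<open>B\<close> that contains \<open>Y\<close>; scanning from a column amounts to lifting it successively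
  through the columns to its right, and the columns of the scanning tableau form a chain.

  For linear independence, let \<open>X\<^sub>v\<close> be the matrices whose column \<open>j\<close> vanishes below row \<open>v j\<close>, for a
  permutation \<open>v\<close>.  Given a relation that holds on all \<open>X\<^sub>v\<close> with \<open>v\<close> in a Bruhat ideal, pick a minimal
  last column \<open>C\<close>; on the \<open>X\<^sub>v\<close> whose flag passes through \<open>C\<close> only the tableaux with last column \<open>C\<close>
  survive, the minor of \<open>C\<close> can be cancelled, and a shorter relation is left.

  For spanning, let \<open>T\<close> be a tableau that is not Demazure, and let \<open>B\<close> be its first column whose
  right key \<open>K\<close> exceeds the given key.  Moving \<open>B\<close> past the columns to its right turns \<open>T\<close> into a tabloid
  with \<open>K\<close> among its columns, hence with monomial in \<open>Z\<close>.  By the same independence argument, now with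
  \<open>K\<close> as last column, these monomials together with the Demazure monomials are independent.  There are
  as many of them as tableaux, and by classical straightening the tableaux span \<open>\<Gamma>\<close>, so they form a basis.
\<close>


section \<open>Comparing and lifting columns\<close>

text \<open>Rewriting a tableau modulo \<open>Z\<close> gives no grip on right keys, so spanning is
  obtained by counting: each tableau that is not Demazure gets one substitute monomial, and it
  remains to prove that all chosen monomials are independent. The order of the failures decides
  this. On the ideal of those \<open>v\<close> whose flags obey the key at the columns before
  \<open>e\<close>, a substitute with an earlier failure vanishes, because one of its factors is the
  minor of a right key that violates the bound; starting from the latest failure, only one value of
  \<open>e\<close> is seen at a time. Ideals replace single permutations because the flags through a
  prescribed column form a union of Schubert varieties. Each \<open>X\<^sub>v\<close> is a linear
  space, so its irreducibility reduces to polynomials in one variable: factors are cancelled along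
  lines, and relations descend in Bruhat order by letting a parameter tend to 0. Bracket matching
  makes the exchange of two columns reversible and keeps the right keys of the columns left behind
  under control.\<close>

definition cnt :: "nat set \<Rightarrow> nat \<Rightarrow> nat" where
  "cnt A z = card {a \<in> A. a \<le> z}"

text \<open>For finite sets of equal size this is entrywise comparison of sorted columns; if
  \<open>A\<close> is larger, its first \<open>card B\<close> rows are compared, as for a column
  \<open>A\<close> to the left of \<open>B\<close>. Counting turns unions and differences of columns
  into arithmetic.\<close>

definition col_le :: "nat set \<Rightarrow> nat set \<Rightarrow> bool" (infix "\<preceq>" 50) where
  "A \<preceq> B \<longleftrightarrow> (\<forall>z. cnt B z \<le> cnt A z)"

text \<open>\<open>M\<close> is the part of \<open>B\<close> used when the elements \<open>y\<close> of \<open>Y\<close>, in decreasing order, are each matched with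
  the largest unused element of \<open>B\<close> that is at most \<open>y\<close> (bracket matching).\<close>

definition pairing :: "nat set \<Rightarrow> nat set \<Rightarrow> nat set \<Rightarrow> bool" where
  "pairing B Y M \<longleftrightarrow> M \<subseteq> B \<and> card M = card Y \<and> M \<preceq> Y \<and> (\<forall>n\<in>B - M. n \<notin> Y \<and> cnt M n \<le> cnt Y n)"

section \<open>Counting functions of finite sets\<close>

lemma col_le_refl: "A \<preceq> A" by (simp add: col_le_def)

lemma col_le_trans: "A \<preceq> B \<Longrightarrow> B \<preceq> C \<Longrightarrow> A \<preceq> C"
  unfolding col_le_def by (meson order_trans)

lemma transp_col_le: "transp (\<preceq>)" by (auto intro: transpI col_le_trans)

lemma cnt_empty[simp]: "cnt {} z = 0" by (simp add: cnt_def)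


lemma cnt_le_card: "finite A \<Longrightarrow> cnt A z \<le> card A"
  unfolding cnt_def by (rule card_mono) auto

lemma cnt_subset: "finite A \<Longrightarrow> B \<subseteq> A \<Longrightarrow> cnt B z \<le> cnt A z"
  unfolding cnt_def by (rule card_mono) auto

lemma col_le_superset: "finite A \<Longrightarrow> B \<subseteq> A \<Longrightarrow> A \<preceq> B"
  by (simp add: col_le_def cnt_subset)

lemma cnt_Un: "finite A \<Longrightarrow> finite B \<Longrightarrow> A \<inter> B = {} \<Longrightarrow> cnt (A \<union> B) z = cnt A z + cnt B z"
proof -
  assume a: "finite A" "finite B" "A \<inter> B = {}"
  have "{x \<in> A \<union> B. x \<le> z} = {x\<in>A. x \<le> z} \<union> {x\<in>B. x\<le>z}" by auto
  then show ?thesis unfolding cnt_def using a by (simp, subst card_Un_disjoint) auto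
qed

lemma cnt_Diff: "finite A \<Longrightarrow> B \<subseteq> A \<Longrightarrow> cnt (A - B) z + cnt B z = cnt A z"
  using cnt_Un[of "A - B" B z] finite_subset[of B A] by (simp add: Un_absorb2 Int_commute)

lemma cnt_eq_card: "finite A \<Longrightarrow> (\<And>a. a \<in> A \<Longrightarrow> a \<le> z) \<Longrightarrow> cnt A z = card A"
  unfolding cnt_def by (rule arg_cong[where f = card]) auto

lemma cnt_large: "finite A \<Longrightarrow> \<exists>z0. \<forall>z\<ge>z0. cnt A z = card A"
  by (rule exI[of _ "Max (insert 0 A)"]) (auto intro!: cnt_eq_card)

lemma cnt_Suc: "finite A \<Longrightarrow> cnt A (Suc z) = cnt A z + (if Suc z \<in> A then 1 else 0)"
proof -
  assume a: "finite A"
  have "{a \<in> A. a \<le> Suc z} = {a \<in> A. a \<le> z} \<union> (if Suc z \<in> A then {Suc z} else {})"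
    by (auto simp: le_Suc_eq)
  then show ?thesis unfolding cnt_def using a by simp
qed

lemma cnt_pred: "finite A \<Longrightarrow> z < n \<Longrightarrow> n \<notin> A \<Longrightarrow> cnt A (n - 1) = cnt A n"
  using cnt_Suc[of A "n - 1"] by simp

lemma cnt_interval: "finite A \<Longrightarrow> z \<le> w \<Longrightarrow> cnt A w = cnt A z + card {a\<in>A. z < a \<and> a \<le> w}"
proof -
  assume a: "finite A" "z \<le> w"
  have "{a \<in> A. a \<le> w} = {a \<in> A. a \<le> z} \<union> {a\<in>A. z < a \<and> a \<le> w}" using a by auto
  then show ?thesis unfolding cnt_def using a by (simp, subst card_Un_disjoint) auto
qed

text \<open>\<open>cnt B - cnt A\<close> counts \<open>B - A\<close> and is therefore increasing;
  the inequality is arranged to avoid subtraction.\<close>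

lemma cnt_interval_subset:
  assumes "finite B" "A \<subseteq> B" "z \<le> w"
  shows "cnt A w + cnt B z \<le> cnt B w + cnt A z"
proof -
  have "finite A" using assms finite_subset by auto
  moreover have "card {a\<in>A. z < a \<and> a \<le> w} \<le> card {a\<in>B. z < a \<and> a \<le> w}"
    using assms by (intro card_mono) auto
  ultimately show ?thesis using cnt_interval[of A z w] cnt_interval[of B z w] assms by linarith
qed

lemma col_le_card: "finite A \<Longrightarrow> finite B \<Longrightarrow> A \<preceq> B \<Longrightarrow> card B \<le> card A"
  using cnt_large[of A] cnt_large[of B] unfolding col_le_def by (metis le_max_iff_disj order_refl max.cobounded1 max.cobounded2)

lemma cnt_eq_imp_eq:
  assumes "finite A" "finite B" "0 \<notin> A" "0 \<notin> B" "\<And>z. cnt A z = cnt B z" shows "A = B"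
proof -
  have "x \<in> A \<longleftrightarrow> x \<in> B" for x
  proof (cases x)
    case 0 then show ?thesis using assms by simp
  next
    case (Suc y)
    then show ?thesis using cnt_Suc[OF assms(1), of y] cnt_Suc[OF assms(2), of y] assms(5)[of y] assms(5)[of "Suc y"]
      by (auto split: if_splits)
  qed
  then show ?thesis by blast
qed


text \<open>Above \<open>z\<close> the set \<open>B\<close> is exhausted by \<open>M\<close> up to some \<open>t\<close> at which \<open>M\<close> and \<open>Y\<close> balance.\<close>

lemma pairing_balance:
  assumes B: "finite B" and Y: "finite Y" and p: "pairing B Y M"
  obtains t where "z \<le> t" "cnt M t = cnt Y t" "cnt B t + cnt M z = cnt B z + cnt M t"
proof -
  have M: "finite M" "M \<subseteq> B" using p B finite_subset by (auto simp: pairing_def)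
  let ?N = "{n \<in> B - M. z < n}"
  have bal: "cnt B t + cnt M z = cnt B z + cnt M t"
    if "z \<le> t" "\<And>n. n \<in> ?N \<Longrightarrow> t < n" for t
  proof -
    have "{a\<in>B. z < a \<and> a \<le> t} = {a\<in>M. z < a \<and> a \<le> t}" using M that by fastforce
    then show ?thesis using cnt_interval[OF B that(1)] cnt_interval[OF M(1) that(1)] by simp
  qed
  show thesis
  proof (cases "?N = {}")
    case True
    define t where "t = Max (insert z (B \<union> Y))"
    have t: "z \<le> t" "\<And>a. a \<in> B \<union> Y \<Longrightarrow> a \<le> t" using B Y by (auto simp: t_def)
    have "cnt M t = card M" "cnt Y t = card Y" using t M B Y by (auto intro!: cnt_eq_card)
    then show ?thesis using that[of t] bal[of t] t True p by (auto simp: pairing_def)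
  next
    case False
    define n where "n = Min ?N"
    have n: "n \<in> ?N" using False B unfolding n_def by (intro Min_in) auto
    have le: "n \<le> x" if "x \<in> ?N" for x unfolding n_def using that B by (intro Min_le) auto
    have nY: "n \<notin> Y" "cnt M n \<le> cnt Y n" "cnt Y n \<le> cnt M n"
      using p n by (auto simp: pairing_def col_le_def)
    have "cnt M (n - 1) = cnt Y (n - 1)"
      using nY n cnt_pred[of M z n] cnt_pred[of Y z n] M Y by auto
    moreover have "n - 1 < x" if "x \<in> ?N" for x using le[OF that] n by auto
    ultimately show ?thesis using that[of "n - 1"] bal[of "n - 1"] n by fastforce
  qed
qed

section \<open>Bracket matching: monotonicity and the greedy construction\<close>

text \<open>Fewer candidates force lower choices. Up to the balance point \<open>t\<close> the set
  \<open>L\<close> has at least as many elements as \<open>M\<close>, while in \<open>(z, t]\<close>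
  it has at most as many, because there \<open>M\<close> exhausts \<open>B\<close>.\<close>

lemma pairing_mono:
  assumes "finite B" "finite Y" "E \<subseteq> B" "pairing B Y M" "pairing E Y L"
  shows "L \<preceq> M"
  unfolding col_le_def
proof
  fix z
  obtain t where t: "z \<le> t" "cnt M t = cnt Y t" "cnt B t + cnt M z = cnt B z + cnt M t"
    using pairing_balance[OF assms(1,2,4)] .
  have E: "finite E" "L \<subseteq> E" using assms finite_subset by (auto simp: pairing_def)
  have L: "finite L" "L \<subseteq> E" using E finite_subset by auto
  have "cnt Y t \<le> cnt L t" using assms(5) by (simp add: pairing_def col_le_def)
  moreover have "cnt E t + cnt B z \<le> cnt B t + cnt E z"
    using cnt_interval_subset assms t by metis
  moreover have "cnt L t + cnt E z \<le> cnt E t + cnt L z"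
    using cnt_interval_subset[OF E(1) L(2) t(1)] .
  ultimately show "cnt M z \<le> cnt L z" using t by linarith
qed

text \<open>If \<open>n\<close> were unmatched in \<open>E\<close> but used in \<open>B\<close>,
  then \<open>n \<notin> Y\<close> would put \<open>cnt M n\<close> strictly above
  \<open>cnt Y n\<close>, whereas \<open>pairing_mono\<close> and the balance at \<open>n\<close> in
  \<open>E\<close> keep it at most \<open>cnt Y n\<close>.\<close>

lemma pairing_unmatched_subset:
  assumes "finite B" "finite Y" "0 \<notin> Y" "0 \<notin> B" "E \<subseteq> B" "pairing B Y M" "pairing E Y L"
  shows "E - L \<subseteq> B - M"
proof
  fix n assume n: "n \<in> E - L"
  have E: "finite E" "L \<subseteq> E" using assms finite_subset by (auto simp: pairing_def)
  have fin: "finite L" "finite M" using E assms finite_subset by (auto simp: pairing_def)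
  have n0: "n > 0" using n assms by (cases n) auto
  have nY: "n \<notin> Y" "cnt L n \<le> cnt Y n" using assms(7) n by (auto simp: pairing_def)
  have "n \<notin> M"
  proof
    assume nM: "n \<in> M"
    have "cnt M (n - 1) \<ge> cnt Y (n - 1)" using assms(6) by (simp add: pairing_def col_le_def)
    moreover have "cnt Y (n - 1) = cnt Y n" using nY n0 assms cnt_pred by blast
    moreover have "cnt M n = Suc (cnt M (n - 1))" using cnt_Suc[OF fin(2), of "n - 1"] nM n0 by simp
    moreover have "cnt M n \<le> cnt L n" using pairing_mono[OF assms(1,2,5-7)] by (simp add: col_le_def)
    ultimately show False using nY by linarith
  qed
  then show "n \<in> B - M" using n assms by auto
qed


text \<open>The lists are in decreasing order.\<close>

fun greedy_matched :: "nat list \<Rightarrow> nat list \<Rightarrow> nat list" where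
  "greedy_matched (x # xs) (y # ys) =
     (if x \<le> y then x # greedy_matched xs ys else greedy_matched xs (y # ys))"
| "greedy_matched _ _ = []"

lemma cnt_insert: "finite A \<Longrightarrow> x \<notin> A \<Longrightarrow> cnt (insert x A) z = cnt A z + (if x \<le> z then 1 else 0)"
proof -
  assume a: "finite A" "x \<notin> A"
  have "{b \<in> insert x A. b \<le> z} = {b \<in> A. b \<le> z} \<union> (if x \<le> z then {x} else {})" by auto
  then show ?thesis unfolding cnt_def using a by simp
qed

lemma greedy_matched_subset: "set (greedy_matched xs ys) \<subseteq> set xs"
  by (induction xs ys rule: greedy_matched.induct) auto

text \<open>Only the maxima matter: either the largest \<open>x\<close> can serve the largest
  \<open>y\<close> and both are removed, or \<open>x\<close> exceeds all of \<open>Y\<close> and is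
  dropped. The comparison survives for what remains.\<close>

lemma pairing_greedy_matched:
  assumes "sorted_wrt (>) xs" "sorted_wrt (>) ys" "set xs \<preceq> set ys"
  shows "pairing (set xs) (set ys) (set (greedy_matched xs ys))"
  using assms
proof (induction xs ys rule: greedy_matched.induct)
  case (1 x xs y ys)
  let ?X = "set xs" and ?Y = "set ys"
  from 1 have x: "x \<notin> ?X" "y \<notin> ?Y" "\<And>a. a \<in> ?X \<Longrightarrow> a < x" "\<And>a. a \<in> ?Y \<Longrightarrow> a < y" by auto
  have cX: "cnt (insert x ?X) z = cnt ?X z + (if x \<le> z then 1 else 0)" for z using x by (simp add: cnt_insert)
  have cY: "cnt (insert y ?Y) z = cnt ?Y z + (if y \<le> z then 1 else 0)" for z using x by (simp add: cnt_insert)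
  have h: "cnt ?Y z + (if y \<le> z then 1 else 0) \<le> cnt ?X z + (if x \<le> z then 1 else 0)" for z
    using 1(5) by (simp add: col_le_def cX cY)
  have fullX: "cnt ?X z = card ?X" if "x \<le> Suc z" for z using x(3) that by (intro cnt_eq_card) force+
  have fullY: "cnt ?Y z = card ?Y" if "y \<le> Suc z" for z using x(4) that by (intro cnt_eq_card) force+
  have leY: "cnt ?Y z \<le> card ?Y" for z by (simp add: cnt_le_card)
  show ?case
  proof (cases "x \<le> y")
    case True
    let ?M = "set (greedy_matched xs ys)"
    have "?X \<preceq> ?Y" unfolding col_le_def
    proof
      fix z show "cnt ?Y z \<le> cnt ?X z"
        using h[of z] h[of y] fullX[of z] fullX[of y] fullY[of y] leY[of z] True by (auto split: if_splits)
    qed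
    then have IH: "pairing ?X ?Y ?M" using 1 True by auto
    have M: "x \<notin> ?M" "finite ?M" using greedy_matched_subset x by auto
    have "n \<notin> insert y ?Y \<and> cnt (insert x ?M) n \<le> cnt (insert y ?Y) n" if "n \<in> insert x ?X - insert x ?M" for n
    proof -
      have n: "n < x" "n \<in> ?X - ?M" using that x by auto
      from n True have "\<not> x \<le> n" "n \<noteq> y" by auto
      moreover have "n \<notin> ?Y" "cnt ?M n \<le> cnt ?Y n" using IH n by (auto simp: pairing_def)
      ultimately show ?thesis using M(2) x(1,2) M(1) by (simp add: cnt_insert)
    qed
    moreover have "cnt (insert y ?Y) z \<le> cnt (insert x ?M) z" for z
      using IH M True by (auto simp: cY cnt_insert pairing_def col_le_def le_SucI)
    ultimately show ?thesis using True IH M x by (auto simp: pairing_def col_le_def)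
  next
    case False
    let ?M = "set (greedy_matched xs (y # ys))"
    have "?X \<preceq> insert y ?Y" unfolding col_le_def
    proof
      fix z show "cnt (insert y ?Y) z \<le> cnt ?X z"
        using h[of z] h[of "x - 1"] fullX[of z] fullX[of "x - 1"] fullY[of "x - 1"] fullY[of z] leY[of z] False
        by (cases "z < x") (auto simp: cY split: if_splits)
    qed
    then have IH: "pairing ?X (insert y ?Y) ?M" using 1 False by auto
    have M: "?M \<subseteq> ?X" by (rule greedy_matched_subset)
    have "x \<notin> insert y ?Y" using False x(4)[of x] by auto
    moreover have "cnt ?M x \<le> cnt (insert y ?Y) x"
    proof -
      have "cnt ?M x \<le> card ?M" by (simp add: cnt_le_card)
      also have "\<dots> = card (insert y ?Y)" using IH by (simp add: pairing_def)
      also have "\<dots> = cnt (insert y ?Y) x" using False x(4) by (intro cnt_eq_card[symmetric]) force+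
      finally show ?thesis .
    qed
    ultimately show ?thesis using False IH M x(1) by (auto simp: pairing_def)
  qed
next
  case ("2_1" ys)
  then have "card (set ys) \<le> 0" using col_le_card[of "{}" "set ys"] by auto
  then show ?case by (simp add: pairing_def col_le_def)
next
  case ("2_2" xs)
  then show ?case by (simp add: pairing_def col_le_def)
qed

section \<open>The lift of a column through its right neighbour\<close>

definition matched :: "nat set \<Rightarrow> nat set \<Rightarrow> nat set" where
  "matched B Y = set (greedy_matched (rev (sorted_list_of_set B)) (rev (sorted_list_of_set Y)))"

definition lift :: "nat set \<Rightarrow> nat set \<Rightarrow> nat set" where
  "lift B Y = Y \<union> (B - matched B Y)"

lemma sorted_desc: "sorted_wrt (>) (rev (sorted_list_of_set (A :: nat set)))"
  by (simp add: sorted_wrt_rev)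

lemma pairing_matched:
  assumes "finite B" "finite Y" "B \<preceq> Y"
  shows "pairing B Y (matched B Y)"
  unfolding matched_def using pairing_greedy_matched[OF sorted_desc sorted_desc, of B Y] assms by simp

context
  fixes B Y :: "nat set"
  assumes B: "finite B" "0 \<notin> B" and Y: "finite Y" "0 \<notin> Y" and le: "B \<preceq> Y"
begin

lemma matched_subset: "matched B Y \<subseteq> B" and card_matched: "card (matched B Y) = card Y"
  and matched_le: "matched B Y \<preceq> Y" and unmatched_disjoint: "(B - matched B Y) \<inter> Y = {}"
  and finite_matched: "finite (matched B Y)"
  using pairing_matched[OF B(1) Y(1) le] B Y finite_subset by (auto simp: pairing_def lift_def)

lemma cnt_lift: "cnt (lift B Y) z + cnt (matched B Y) z = cnt Y z + cnt B z"
  unfolding lift_def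
  using cnt_Diff[OF B(1) matched_subset, of z] cnt_Un[of Y "B - matched B Y" z] unmatched_disjoint B Y
  by (simp add: Int_commute)

lemma card_lift: "card (lift B Y) = card B"
  unfolding lift_def
  using card_Un_disjoint[of Y "B - matched B Y"] unmatched_disjoint B Y card_matched matched_subset
    card_Diff_subset[of "matched B Y" B] finite_matched card_mono[OF B(1) matched_subset] by fastforce

lemma lift_ge: "B \<preceq> lift B Y"
  unfolding col_le_def using cnt_lift matched_le unfolding col_le_def
  by (metis add.commute add_le_cancel_left add_le_mono le_refl)

text \<open>Between \<open>z\<close> and the balance point \<open>t\<close> all of \<open>B\<close>
  is matched, and at \<open>t\<close> the counts of \<open>Y\<close> and of its partners agree. The
  bound \<open>B \<preceq> F\<close> at \<open>t\<close> is therefore carried back to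
  \<open>z\<close> by means of \<open>Y \<subseteq> F\<close>.\<close>

lemma lift_minimal:
  assumes F: "finite F" "Y \<subseteq> F" "B \<preceq> F"
  shows "lift B Y \<preceq> F"
  unfolding col_le_def
proof
  fix z
  obtain t where t: "z \<le> t" "cnt (matched B Y) t = cnt Y t"
     "cnt B t + cnt (matched B Y) z = cnt B z + cnt (matched B Y) t"
    using pairing_balance[OF B(1) Y(1) pairing_matched[OF B(1) Y(1) le]] .
  have "cnt Y t + cnt F z \<le> cnt F t + cnt Y z" using cnt_interval_subset[OF F(1,2) t(1)] .
  moreover have "cnt F t \<le> cnt B t" using F by (simp add: col_le_def)
  ultimately show "cnt F z \<le> cnt (lift B Y) z" using cnt_lift[of z] t by linarith
qed

text \<open>\<open>matched B Y\<close> is the highest part of \<open>B\<close> below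
  \<open>Y\<close>, dually to \<open>lift_minimal\<close> and with the same balance point.\<close>

lemma matched_bounds_above_subset:
  assumes "Z \<subseteq> B" "Z \<preceq> Y"
  shows "Z \<preceq> matched B Y"
  unfolding col_le_def
proof
  fix z
  obtain t where t: "z \<le> t" "cnt (matched B Y) t = cnt Y t"
     "cnt B t + cnt (matched B Y) z = cnt B z + cnt (matched B Y) t"
    using pairing_balance[OF B(1) Y(1) pairing_matched[OF B(1) Y(1) le]] .
  have "cnt Z t + cnt B z \<le> cnt B t + cnt Z z" using cnt_interval_subset[OF B(1) assms(1) t(1)] .
  moreover have "cnt Y t \<le> cnt Z t" using assms by (simp add: col_le_def)
  ultimately show "cnt (matched B Y) z \<le> cnt Z z" using t by linarith
qed

end

text \<open>Elements unmatched in the smaller column stay unmatched in the larger one. This is the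
  source of the nestedness of right keys.\<close>

lemma lift_subset_mono:
  assumes "finite B" "0 \<notin> B" "finite Y" "0 \<notin> Y" "E \<preceq> Y" "E \<subseteq> B"
  shows "lift E Y \<subseteq> lift B Y"
proof -
  have "B \<preceq> Y" using col_le_trans[OF col_le_superset[OF assms(1,6)] assms(5)] .
  then show ?thesis
    using pairing_unmatched_subset[OF assms(1,3,4,2,6) pairing_matched pairing_matched] assms finite_subset[OF assms(6)]
    by (auto simp: lift_def)
qed

text \<open>Exchanging two columns can be undone. At the lowest disagreement \<open>x\<close> of the
  unmatched parts, exactly one of the two columns \<open>Y1\<close>, \<open>Y2\<close> contains
  \<open>x\<close> and below \<open>x\<close> they coincide; the count of the common matched part at
  \<open>x\<close> cannot suit both.\<close>

lemma matched_lift_inj: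
  assumes "finite B1" "0 \<notin> B1" "finite Y1" "0 \<notin> Y1" "B1 \<preceq> Y1"
    and "finite B2" "0 \<notin> B2" "finite Y2" "0 \<notin> Y2" "B2 \<preceq> Y2"
    and eq: "matched B1 Y1 = matched B2 Y2" "lift B1 Y1 = lift B2 Y2"
  shows "B1 = B2 \<and> Y1 = Y2"
proof -
  let ?M = "matched B1 Y1"
  let ?N1 = "B1 - ?M" and ?N2 = "B2 - ?M"
  have p1: "pairing B1 Y1 ?M" and p2: "pairing B2 Y2 ?M" using pairing_matched assms by metis+
  have fM: "finite ?M" using finite_matched[OF assms(1-5)] .
  \<comment> \<open>Stated for arbitrary pairs, so that it applies whichever side owns the lowest
    disagreement.\<close>
  have key: False
    if B: "finite B1" "0 \<notin> B1" "finite Y1" "finite Y2" "pairing B1 Y1 M" "pairing B2 Y2 M"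
      and U: "Y1 \<union> (B1 - M) = Y2 \<union> (B2 - M)"
      and x: "x \<in> B1 - M" "x \<notin> B2 - M" and below: "\<And>a. a < x \<Longrightarrow> a \<in> B1 - M \<longleftrightarrow> a \<in> B2 - M"
    for B1 B2 Y1 Y2 M x
  proof -
    have x0: "0 < x" using x B by (cases x) auto
    have xY: "x \<in> Y2" "x \<notin> Y1" "cnt M x \<le> cnt Y1 x" using U x B(5) by (auto simp: pairing_def)
    have "a \<in> Y1 \<longleftrightarrow> a \<in> Y2" if "a < x" for a
    proof -
      have "a \<in> Y1 \<Longrightarrow> a \<notin> B1 - M" "a \<in> Y2 \<Longrightarrow> a \<notin> B2 - M" using B(5,6) by (auto simp: pairing_def)
      then show ?thesis using below[OF that] U by blast
    qed
    then have "{a\<in>Y1. a \<le> x - 1} = {a\<in>Y2. a \<le> x - 1}" using x0 by auto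
    then have "cnt Y1 (x - 1) = cnt Y2 (x - 1)" by (simp add: cnt_def)
    moreover have "cnt Y2 x = Suc (cnt Y2 (x - 1))" using cnt_Suc[OF B(4), of "x - 1"] x0 xY by simp
    moreover have "cnt Y1 x = cnt Y1 (x - 1)" using cnt_pred[OF B(3) x0 xY(2)] by simp
    moreover have "cnt Y2 x \<le> cnt M x" using B(6) by (simp add: pairing_def col_le_def)
    ultimately show False using xY by linarith
  qed
  have U: "Y1 \<union> ?N1 = Y2 \<union> ?N2" using eq by (simp add: lift_def)
  have N: "?N1 = ?N2"
  proof (rule ccontr)
    assume "?N1 \<noteq> ?N2"
    then have ex: "\<exists>x. (x \<in> ?N1) \<noteq> (x \<in> ?N2)" by blast
    define x where "x = (LEAST x. (x \<in> ?N1) \<noteq> (x \<in> ?N2))"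
    have x: "(x \<in> ?N1) \<noteq> (x \<in> ?N2)" unfolding x_def by (rule LeastI_ex[OF ex])
    have below: "(a \<in> ?N1) \<longleftrightarrow> (a \<in> ?N2)" if "a < x" for a
      using not_less_Least[of a "\<lambda>x. (x \<in> ?N1) \<noteq> (x \<in> ?N2)"] that unfolding x_def by blast
    from x consider "x \<in> ?N1" "x \<notin> ?N2" | "x \<in> ?N2" "x \<notin> ?N1" by blast
    then show False
    proof cases
      case 1 then show ?thesis using key[OF assms(1,2,3,8) p1 p2 U _ _ below] by blast
    next
      case 2 then show ?thesis using key[OF assms(6,7,8,3) p2 p1 U[symmetric]] below by blast
    qed
  qed
  have "B1 = ?M \<union> ?N1" "B2 = ?M \<union> ?N2" using p1 p2 by (auto simp: pairing_def)
  moreover have "Y1 = (Y1 \<union> ?N1) - ?N1" "Y2 = (Y2 \<union> ?N2) - ?N2" using p1 p2 by (auto simp: pairing_def)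
  ultimately show ?thesis using N U by metis
qed


section \<open>Right keys of tableaux\<close>

text \<open>Column lengths weakly decrease automatically, by \<open>col_le_card\<close>; the shape
  itself is recorded through \<open>map card\<close>.\<close>

definition tab :: "nat \<Rightarrow> nat set list \<Rightarrow> bool" where
  "tab n Cs \<longleftrightarrow> (\<forall>C\<in>set Cs. C \<subseteq> {1..n}) \<and> sorted_wrt (\<preceq>) Cs"

fun right_keys :: "nat set list \<Rightarrow> nat set list" where
  "right_keys [] = []"
| "right_keys (C # Cs) = foldl lift C Cs # right_keys Cs"

definition key_bounded :: "(nat \<Rightarrow> nat set) \<Rightarrow> nat set list \<Rightarrow> bool" where
  "key_bounded w Cs \<longleftrightarrow> (\<forall>S\<in>set (right_keys Cs). S \<preceq> w (card S))"

text \<open>Exchanging \<open>B\<close> with the next column \<open>Y\<close> replaces the pair \<open>B, Y\<close> by \<open>matched B Y, lift B Y\<close>; \<open>moved B Ys\<close>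
  collects the short columns left behind when \<open>B\<close> travels through \<open>Ys\<close>.\<close>

fun moved :: "nat set \<Rightarrow> nat set list \<Rightarrow> nat set list" where
  "moved B [] = []"
| "moved B (Y # Ys) = matched B Y # moved (lift B Y) Ys"

lemma tab_Cons: "tab n (C # Cs) \<longleftrightarrow> C \<subseteq> {1..n} \<and> (\<forall>D\<in>set Cs. C \<preceq> D) \<and> tab n Cs"
  by (auto simp: tab_def)

lemma tab_append: "tab n (Cs @ Ds) \<longleftrightarrow> tab n Cs \<and> tab n Ds \<and> (\<forall>C\<in>set Cs. \<forall>D\<in>set Ds. C \<preceq> D)"
  by (auto simp: tab_def sorted_wrt_append)

lemma tab_Nil[simp]: "tab n []" by (simp add: tab_def)

lemma col_finite: "C \<subseteq> {1..n} \<Longrightarrow> finite (C :: nat set)" by (rule finite_subset) auto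

lemma col_zero: "C \<subseteq> {1..n} \<Longrightarrow> 0 \<notin> (C :: nat set)" by auto

lemmas colD = col_finite col_zero

lemma lift_cols: "B \<subseteq> {1..n} \<Longrightarrow> Y \<subseteq> {1..n} \<Longrightarrow> lift B Y \<subseteq> {1..n}"
  by (auto simp: lift_def)

text \<open>A superset is lower in \<open>\<preceq>\<close>. Since the lift contains
  \<open>Y\<close>, it may stand before everything that followed \<open>Y\<close>.\<close>

lemma tab_lift:
  assumes "tab n (B # Y # Cs)"
  shows "tab n (lift B Y # Cs)"
proof -
  have "lift B Y \<subseteq> {1..n}" "B \<preceq> Y" using assms lift_cols by (auto simp: tab_Cons)
  moreover have "lift B Y \<preceq> Y"
    by (rule col_le_superset) (use calculation colD in \<open>auto simp: lift_def\<close>)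
  ultimately show ?thesis using assms by (auto simp: tab_Cons intro: col_le_trans)
qed

lemma foldl_lift:
  assumes "tab n (B # Cs)"
  shows "foldl lift B Cs \<subseteq> {1..n} \<and> card (foldl lift B Cs) = card B \<and> B \<preceq> foldl lift B Cs"
  using assms
proof (induction Cs arbitrary: B)
  case Nil
  then show ?case by (simp add: tab_Cons col_le_refl)
next
  case (Cons Y Cs)
  have B: "finite B" "0 \<notin> B" "finite Y" "0 \<notin> Y" "B \<preceq> Y" using Cons.prems colD by (auto simp: tab_Cons)
  show ?case using Cons.IH[OF tab_lift[OF Cons.prems]] card_lift[OF B] lift_ge[OF B] col_le_trans by auto
qed

lemma foldl_lift_subset_mono:
  assumes "tab n (E # Cs)" "E \<subseteq> B" "B \<subseteq> {1..n}"
  shows "foldl lift E Cs \<subseteq> foldl lift B Cs"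
  using assms
proof (induction Cs arbitrary: B E)
  case (Cons Y Cs)
  have B: "finite B" "0 \<notin> B" "finite Y" "0 \<notin> Y" "E \<preceq> Y" "Y \<subseteq> {1..n}" using Cons.prems colD by (auto simp: tab_Cons)
  show ?case using Cons.IH[OF tab_lift[OF Cons.prems(1)] lift_subset_mono[OF B(1-5) Cons.prems(2)] lift_cols[OF Cons.prems(3) B(6)]] by simp
qed simp

text \<open>After one step the lifted column contains its neighbour, and further lifts preserve
  inclusion.\<close>

lemma right_keys_nested:
  assumes "tab n (B # Cs)" "S \<in> set (right_keys Cs)"
  shows "S \<subseteq> foldl lift B Cs"
  using assms
proof (induction Cs arbitrary: B)
  case (Cons Y Cs)
  have "foldl lift Y Cs \<subseteq> foldl lift (lift B Y) Cs"
    using Cons.prems lift_cols by (intro foldl_lift_subset_mono[of n]) (auto simp: tab_Cons lift_def)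
  then show ?case using Cons.IH[OF tab_lift[OF Cons.prems(1)]] Cons.prems by auto
qed simp

lemma right_keys_chain: "tab n Cs \<Longrightarrow> sorted_wrt (\<supseteq>) (right_keys Cs)"
proof (induction Cs)
  case (Cons C Cs)
  then show ?case using right_keys_nested[OF Cons.prems] by (auto simp: tab_Cons)
qed simp

lemma right_keys_card: "tab n Cs \<Longrightarrow> map card (right_keys Cs) = map card Cs"
proof (induction Cs)
  case (Cons C Cs)
  then show ?case using foldl_lift[OF Cons.prems] by (auto simp: tab_Cons)
qed simp

lemma right_keys_cols: "tab n Cs \<Longrightarrow> S \<in> set (right_keys Cs) \<Longrightarrow> S \<subseteq> {1..n}"
proof (induction Cs)
  case (Cons C Cs)
  then show ?case using foldl_lift[OF Cons.prems(1)] by (auto simp: tab_Cons)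
qed simp

lemma right_keys_snoc: "right_keys (Cs @ [C]) = map (\<lambda>S. lift S C) (right_keys Cs) @ [C]"
  by (induction Cs) auto


text \<open>An appended column can only raise right keys, so a bound on the keys survives the
  removal of the last column.\<close>

lemma right_keys_ge: "tab n (Cs @ [C]) \<Longrightarrow> S \<in> set (right_keys Cs) \<Longrightarrow> S \<preceq> lift S C \<and> card (lift S C) = card S"
proof (induction Cs)
  case (Cons D Cs)
  then have t: "tab n (Cs @ [C])" "tab n (D # Cs)" "C \<subseteq> {1..n}" "tab n ((D # Cs) @ [C])" by (auto simp: tab_Cons tab_append)
  show ?case
  proof (cases "S = foldl lift D Cs")
    case True
    have S: "S \<subseteq> {1..n}" using foldl_lift[OF t(2)] True by auto
    have "tab n (S # [C])" using t(4) unfolding True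
    proof (induction Cs arbitrary: D)
      case (Cons Y Cs)
      have "tab n (D # Y # Cs @ [C])" using Cons.prems by simp
      from tab_lift[OF this] show ?case using Cons.IH by simp
    qed simp
    then have "finite S" "0 \<notin> S" "finite C" "0 \<notin> C" "S \<preceq> C"
      using colD[of S n] colD[of C n] by (auto simp: tab_Cons)
    then show ?thesis using lift_ge card_lift by blast
  next
    case False
    then show ?thesis using Cons t by auto
  qed
qed simp

section \<open>Moving a column past the columns to its right\<close>

text \<open>The witness \<open>Z\<close> is renewed on the way: for the later pieces,
  \<open>Y\<close> itself is a part of \<open>lift B Y\<close> that lies below all remaining
  columns.\<close>

lemma moved_ge:
  assumes "tab n (B # Ys)" "Z \<subseteq> B" "\<forall>Y\<in>set Ys. Z \<preceq> Y" "M \<in> set (moved B Ys)"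
  shows "Z \<preceq> M"
  using assms
proof (induction Ys arbitrary: B Z)
  case (Cons Y Ys)
  have B: "finite B" "0 \<notin> B" "finite Y" "0 \<notin> Y" "B \<preceq> Y" using Cons.prems colD by (auto simp: tab_Cons)
  from Cons.prems(4) consider "M = matched B Y" | "M \<in> set (moved (lift B Y) Ys)" by auto
  then show ?case
  proof cases
    case 1 then show ?thesis using matched_bounds_above_subset[OF B Cons.prems(2)] Cons.prems(3) by simp
  next
    case 2
    then have "Y \<preceq> M"
      using Cons.IH[OF tab_lift[OF Cons.prems(1)], of Y] Cons.prems by (auto simp: tab_Cons lift_def)
    then show ?thesis using Cons.prems(3) col_le_trans by auto
  qed
qed simp

lemma tab_moved: "tab n (B # Ys) \<Longrightarrow> tab n (moved B Ys) \<and> map card (moved B Ys) = map card Ys"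
proof (induction Ys arbitrary: B)
  case (Cons Y Ys)
  have B: "finite B" "0 \<notin> B" "finite Y" "0 \<notin> Y" "B \<preceq> Y" "B \<subseteq> {1..n}" using Cons.prems colD by (auto simp: tab_Cons)
  have "matched B Y \<preceq> M" if "M \<in> set (moved (lift B Y) Ys)" for M
  proof -
    have "Y \<preceq> M"
      using moved_ge[OF tab_lift[OF Cons.prems], of Y] that Cons.prems by (auto simp: tab_Cons lift_def)
    then show ?thesis using matched_le[OF B(1-5)] col_le_trans by auto
  qed
  then show ?case
    using Cons.IH[OF tab_lift[OF Cons.prems]] matched_subset[OF B(1-5)] card_matched[OF B(1-5)] B
    by (auto simp: tab_Cons)
qed simp

lemma tab_append_moved:
  assumes "tab n (Ps @ B # Ys)"
  shows "tab n (Ps @ moved B Ys)"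
proof -
  have t: "tab n (B # Ys)" using assms by (simp add: tab_append)
  have "B \<preceq> M" if "M \<in> set (moved B Ys)" for M
    using moved_ge[OF t subset_refl _ that] t by (auto simp: tab_Cons)
  then show ?thesis using assms tab_moved[OF t] by (auto simp: tab_append tab_Cons intro: col_le_trans)
qed

text \<open>Exchanges are undone from the right end: once the tails and the lifted columns agree,
  \<open>matched_lift_inj\<close> recovers the first pair.\<close>

lemma moved_inj:
  assumes "tab n (B1 # Ys1)" "tab n (B2 # Ys2)" "moved B1 Ys1 = moved B2 Ys2"
    "foldl lift B1 Ys1 = foldl lift B2 Ys2"
  shows "B1 = B2 \<and> Ys1 = Ys2"
  using assms
proof (induction Ys1 arbitrary: B1 B2 Ys2)
  case Nil
  then show ?case by (cases Ys2) auto
next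
  case (Cons Y1 Zs1)
  then obtain Y2 Zs2 where Ys2: "Ys2 = Y2 # Zs2" by (cases Ys2) auto
  have e: "lift B1 Y1 = lift B2 Y2 \<and> Zs1 = Zs2"
    using Cons.IH[OF tab_lift tab_lift] Cons.prems unfolding Ys2 by auto
  have B: "finite B1" "0 \<notin> B1" "finite Y1" "0 \<notin> Y1" "B1 \<preceq> Y1"
      "finite B2" "0 \<notin> B2" "finite Y2" "0 \<notin> Y2" "B2 \<preceq> Y2"
    using Cons.prems colD unfolding Ys2 by (auto simp: tab_Cons)
  show ?case using matched_lift_inj[OF B] Cons.prems e unfolding Ys2 by auto
qed

text \<open>For a column that stands to the left of the moving one. In the original tableau its lift
  \<open>E\<close> contains the moving column, hence also the piece left behind, so \<open>E\<close>
  is a competitor in \<open>lift_minimal\<close> for the lift of \<open>E'\<close>.\<close>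

lemma moved_key_le_superset:
  assumes "tab n (B # Ys)" "tab n (E # Ys)" "tab n (E' # moved B Ys)" "E' \<preceq> E" "B \<subseteq> E"
  shows "foldl lift E' (moved B Ys) \<preceq> foldl lift E Ys"
  using assms
proof (induction Ys arbitrary: B E E')
  case (Cons Y Ys)
  let ?M = "matched B Y"
  have B: "finite B" "0 \<notin> B" "finite Y" "0 \<notin> Y" "B \<preceq> Y" "B \<subseteq> {1..n}" using Cons.prems colD by (auto simp: tab_Cons)
  have E: "finite E" "0 \<notin> E" "E \<preceq> Y" using Cons.prems colD by (auto simp: tab_Cons)
  have E': "finite E'" "0 \<notin> E'" "E' \<preceq> ?M" using Cons.prems colD by (auto simp: tab_Cons)
  have M: "finite ?M" "0 \<notin> ?M" "?M \<subseteq> B" using matched_subset[OF B(1-5)] B finite_matched[OF B(1-5)] by auto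
  have "lift E' ?M \<preceq> E" using lift_minimal[OF E'(1,2) M(1,2) E'(3) E(1)] M Cons.prems by auto
  then have "lift E' ?M \<preceq> lift E Y" using lift_ge[OF E(1,2) B(3,4) E(3)] col_le_trans by auto
  moreover have "lift B Y \<subseteq> lift E Y" using lift_subset_mono[OF E(1,2) B(3,4,5)] Cons.prems by auto
  ultimately show ?case using Cons.IH[of "lift B Y" "lift E Y" "lift E' ?M"] Cons.prems tab_lift by auto
qed simp

text \<open>For a column that the moving one has passed: its lift stays inside the moving
  column.\<close>

lemma moved_key_le_subset:
  assumes "tab n (B # Ys)" "tab n (E # Ys)" "tab n (E' # moved B Ys)" "E' \<preceq> E" "E \<subseteq> B"
  shows "foldl lift E' (moved B Ys) \<preceq> foldl lift E Ys"
  using assms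
proof (induction Ys arbitrary: B E E')
  case (Cons Y Ys)
  let ?M = "matched B Y" and ?L = "matched E Y"
  have B: "finite B" "0 \<notin> B" "finite Y" "0 \<notin> Y" "B \<preceq> Y" "B \<subseteq> {1..n}" using Cons.prems colD by (auto simp: tab_Cons)
  have E: "finite E" "0 \<notin> E" "E \<preceq> Y" using Cons.prems colD by (auto simp: tab_Cons)
  have E': "finite E'" "0 \<notin> E'" "E' \<preceq> ?M" using Cons.prems colD by (auto simp: tab_Cons)
  have M: "finite ?M" "0 \<notin> ?M" "?M \<subseteq> B" using matched_subset[OF B(1-5)] B finite_matched[OF B(1-5)] by auto
  have L: "finite ?L" "?L \<subseteq> E" using matched_subset[OF E(1,2) B(3,4) E(3)] finite_matched[OF E(1,2) B(3,4) E(3)] by auto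
  have p: "pairing B Y ?M" "pairing E Y ?L" using pairing_matched B E by auto
  have sub: "E - ?L \<subseteq> B - ?M" using pairing_unmatched_subset[OF B(1,3,4,2) Cons.prems(5) p] .
  have LM: "?L \<preceq> ?M" using pairing_mono[OF B(1,3) Cons.prems(5) p] .
  \<comment> \<open>\<open>F\<close> is \<open>E\<close> with its matched part raised to that of
    \<open>B\<close>. It contains \<open>?M\<close> and lies above \<open>E\<close>, and replacing
    \<open>?M\<close> by \<open>Y\<close> turns it into \<open>lift E Y\<close>; so it separates the
    two lifts.\<close>
  define F where "F = (E - ?L) \<union> ?M"
  have F: "finite F" unfolding F_def using E M by auto
  have cF: "cnt F z = cnt (E - ?L) z + cnt ?M z" for z
    unfolding F_def by (rule cnt_Un) (use E M sub in auto)
  have cE: "cnt E z = cnt (E - ?L) z + cnt ?L z" for z using cnt_Diff[OF E(1) L(2)] by simp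
  have cL: "cnt (lift E Y) z = cnt (E - ?L) z + cnt Y z" for z
    using cnt_lift[OF E(1,2) B(3,4) E(3), of z] cE[of z] by simp
  have "E \<preceq> F" using LM by (simp add: col_le_def cF cE)
  then have "lift E' ?M \<preceq> F"
    using lift_minimal[OF E'(1,2) M(1,2) E'(3) F] col_le_trans Cons.prems(4) by (auto simp: F_def)
  moreover have "F \<preceq> lift E Y" using matched_le[OF B(1-5)] by (simp add: col_le_def cF cL)
  ultimately have "lift E' ?M \<preceq> lift E Y" using col_le_trans by auto
  moreover have "lift E Y \<subseteq> lift B Y" using lift_subset_mono[OF B(1-4) E(3)] Cons.prems by auto
  ultimately show ?case using Cons.IH[of "lift B Y" "lift E Y" "lift E' ?M"] Cons.prems tab_lift by auto
qed simp

text \<open>The piece \<open>matched B Y\<close> lies below \<open>Y\<close>, and \<open>Y\<close>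
  is part of \<open>lift B Y\<close>; so the subset case compares the key of the piece with that of
  \<open>Y\<close>.\<close>

lemma right_keys_moved:
  assumes "tab n (B # Ys)" "S' \<in> set (right_keys (moved B Ys))"
  shows "\<exists>S\<in>set (right_keys Ys). card S' = card S \<and> S' \<preceq> S"
  using assms
proof (induction Ys arbitrary: B)
  case (Cons Y Ys)
  have B: "finite B" "0 \<notin> B" "finite Y" "0 \<notin> Y" "B \<preceq> Y" "B \<subseteq> {1..n}" using Cons.prems colD by (auto simp: tab_Cons)
  have t: "tab n (matched B Y # moved (lift B Y) Ys)" using tab_moved[OF Cons.prems(1)] by simp
  have tY: "tab n (Y # Ys)" using Cons.prems by (simp add: tab_Cons)
  from Cons.prems(2) consider "S' = foldl lift (matched B Y) (moved (lift B Y) Ys)"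
    | "S' \<in> set (right_keys (moved (lift B Y) Ys))" by auto
  then show ?case
  proof cases
    case 1
    have "S' \<preceq> foldl lift Y Ys" unfolding 1
      using moved_key_le_subset[OF tab_lift[OF Cons.prems(1)] tY t matched_le[OF B(1-5)]] by (auto simp: lift_def)
    moreover have "card S' = card (foldl lift Y Ys)"
      using 1 foldl_lift[OF t] foldl_lift[OF tY] card_matched[OF B(1-5)] by simp
    ultimately show ?thesis by auto
  next
    case 2
    then show ?thesis using Cons.IH[OF tab_lift[OF Cons.prems(1)]] by auto
  qed
qed simp

lemma tab_foldl: "tab n (E # Cs @ Ds) \<Longrightarrow> tab n (foldl lift E Cs # Ds)"
proof (induction Cs arbitrary: E)
  case (Cons Y Cs)
  then have "tab n (E # Y # Cs @ Ds)" by simp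
  from tab_lift[OF this] show ?case using Cons.IH by simp
qed simp

text \<open>A column before \<open>B\<close> is lifted through \<open>B\<close> in the old tableau,
  which makes it contain \<open>B\<close>; this is the superset case. Hence every flag that bounds
  the old right keys bounds those of the columns left behind.\<close>

lemma right_keys_append_moved:
  assumes "tab n (Ps @ B # Ys)" "S' \<in> set (right_keys (Ps @ moved B Ys))"
  shows "\<exists>S\<in>set (right_keys (Ps @ B # Ys)). card S' = card S \<and> S' \<preceq> S"
  using assms
proof (induction Ps)
  case Nil
  then show ?case using right_keys_moved[of n B Ys S'] by auto
next
  case (Cons P Ps)
  from Cons.prems(2) consider "S' = foldl lift P (Ps @ moved B Ys)" | "S' \<in> set (right_keys (Ps @ moved B Ys))"
    by auto
  then show ?case
  proof cases
    case 1
    let ?E = "foldl lift P Ps"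
    have t: "tab n (P # Ps @ B # Ys)" using Cons.prems by simp
    have t': "tab n (P # Ps @ moved B Ys)" using tab_append_moved[of n "P # Ps"] Cons.prems by simp
    have tE: "tab n (?E # B # Ys)" using tab_foldl[OF t] .
    have tE': "tab n (?E # moved B Ys)" using tab_foldl[OF t'] .
    have tB: "tab n (B # Ys)" using tE by (simp add: tab_Cons)
    have E: "finite ?E" "0 \<notin> ?E" "finite B" "0 \<notin> B" "?E \<preceq> B" using tE colD by (auto simp: tab_Cons)
    have "S' \<preceq> foldl lift P (Ps @ B # Ys)"
      using 1 moved_key_le_superset[OF tB tab_lift[OF tE] tE' lift_ge[OF E]] by (auto simp: lift_def)
    moreover have "card S' = card (foldl lift P (Ps @ B # Ys))"
      using 1 foldl_lift[OF t] foldl_lift[OF t'] by simp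
    ultimately show ?thesis by auto
  next
    case 2
    then show ?thesis using Cons by (auto simp: tab_Cons)
  qed
qed

lemma key_bounded_moved:
  assumes "tab n (Ps @ B # Ys)" "key_bounded w (Ps @ B # Ys)"
  shows "key_bounded w (Ps @ moved B Ys)"
  unfolding key_bounded_def
proof
  fix S' assume "S' \<in> set (right_keys (Ps @ moved B Ys))"
  from right_keys_append_moved[OF assms(1) this] obtain S where S: "S\<in>set (right_keys (Ps @ B # Ys))"
    "card S' = card S" "S' \<preceq> S" by blast
  then show "S' \<preceq> w (card S')" using assms(2) col_le_trans by (auto simp: key_bounded_def)
qed

lemma key_bounded_butlast:
  assumes "tab n (Cs @ [C])" "key_bounded w (Cs @ [C])"
  shows "key_bounded w Cs"
  unfolding key_bounded_def
proof
  fix S assume S: "S \<in> set (right_keys Cs)"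
  then have "lift S C \<preceq> w (card (lift S C))" using assms(2) by (auto simp: key_bounded_def right_keys_snoc)
  then show "S \<preceq> w (card S)" using right_keys_ge[OF assms(1) S] col_le_trans by auto
qed


section \<open>Flags and Bruhat order\<close>

text \<open>Listing each new block in increasing order is what makes the resulting permutation
  Bruhat-minimal among those passing above the chain.\<close>

fun refine :: "nat set \<Rightarrow> nat set list \<Rightarrow> nat list" where
  "refine A [] = []"
| "refine A (S # Ss) = sorted_list_of_set (S - A) @ refine S Ss"

lemma refine_set:
  assumes "sorted_wrt (\<subseteq>) (A # Ss)" "finite (last (A # Ss))"
  shows "distinct (refine A Ss) \<and> set (refine A Ss) = last (A # Ss) - A"
  using assms
proof (induction Ss arbitrary: A)
  case (Cons S Ss)
  have "S \<subseteq> last (S # Ss)" using Cons.prems(1) by (cases "Ss = []") auto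
  then have "finite S" "S \<subseteq> last (S # Ss)" using Cons.prems finite_subset by auto
  then show ?case using Cons by auto
qed simp

lemma refine_take:
  assumes "sorted_wrt (\<subseteq>) (A # Ss)" "\<forall>S\<in>set Ss. finite S" "finite A" "S \<in> set Ss"
  shows "A \<union> set (take (card S - card A) (refine A Ss)) = S"
  using assms
proof (induction Ss arbitrary: A)
  case (Cons R Ss)
  have R: "finite R" "A \<subseteq> R" "card (R - A) = card R - card A" "card A \<le> card R"
    using Cons.prems by (auto simp: card_Diff_subset card_mono)
  show ?case
  proof (cases "S = R")
    case True
    then show ?thesis using R by auto
  next
    case False
    then have S: "S \<in> set Ss" "R \<subseteq> S" "finite S" using Cons.prems by auto
    then have "card R \<le> card S" by (simp add: card_mono)
    then have "take (card S - card A) (refine A (R # Ss))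
        = sorted_list_of_set (R - A) @ take (card S - card R) (refine R Ss)"
      using R by simp
    then show ?thesis using Cons.IH[of R] Cons.prems S R by auto
  qed
qed simp

lemma cnt_chain:
  assumes "finite B" "A \<subseteq> B"
  shows "cnt B z \<le> cnt A z + (card B - card A)"
proof -
  have "cnt B z = cnt (B - A) z + cnt A z" using cnt_Diff[OF assms] by simp
  moreover have "cnt (B - A) z \<le> card (B - A)" using assms by (simp add: cnt_le_card)
  moreover have "card (B - A) = card B - card A" using assms card_Diff_subset finite_subset by metis
  ultimately show ?thesis by simp
qed

text \<open>Compare counts at \<open>z\<close>. If all \<open>k\<close> new elements are at most
  \<open>z\<close>, the left side gains the full \<open>k\<close>, and \<open>W2\<close> gains at
  most \<open>k\<close> over \<open>W1\<close>. Otherwise every element of \<open>S\<close> up to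
  \<open>z\<close> is already present, and \<open>S \<preceq> W3\<close> applies.\<close>

lemma refine_le_block:
  assumes S: "finite S" "A \<subseteq> S"
    and W: "finite W3" "W1 \<subseteq> W2" "W2 \<subseteq> W3" "A \<preceq> W1" "S \<preceq> W3" "card W1 = card A" "card W2 = card A + k"
    and k: "k \<le> card (S - A)"
  shows "A \<union> set (take k (sorted_list_of_set (S - A))) \<preceq> W2"
  unfolding col_le_def
proof
  fix z
  let ?xs = "sorted_list_of_set (S - A)" let ?X = "set (take k ?xs)"
  have xs: "set ?xs = S - A" "distinct ?xs" "sorted ?xs" "length ?xs = card (S - A)" using S by auto
  have fA: "finite A" using S finite_subset by auto
  have X: "?X \<subseteq> S - A" "card ?X = k" using xs k set_take_subset[of k ?xs] by (auto simp: distinct_card)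
  have fX: "finite ?X" by simp
  have fW: "finite W2" using W finite_subset by auto
  show "cnt W2 z \<le> cnt (A \<union> ?X) z"
  proof (cases "\<forall>x\<in>?X. x \<le> z")
    case True
    have "cnt (A \<union> ?X) z = cnt A z + cnt ?X z" by (rule cnt_Un) (use fA X in auto)
    moreover have "cnt ?X z = k" using True X by (simp add: cnt_eq_card)
    moreover have "cnt W2 z \<le> cnt W1 z + k" using cnt_chain[OF fW W(2), of z] W by simp
    ultimately show ?thesis using W(4) unfolding col_le_def by (metis add_le_mono1 order_trans)
  next
    case False
    then obtain x where x: "x \<in> ?X" "z < x" by auto
    have "a \<in> ?X" if a: "a \<in> S - A" "a \<le> z" for a
    proof -
      obtain i where i: "i < length ?xs" "?xs ! i = a" using a xs by (metis in_set_conv_nth)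
      obtain j where j: "j < k" "j < length ?xs" "?xs ! j = x" using x by (auto simp: in_set_conv_nth)
      have "i < j" using sorted_nth_mono[OF xs(3), of j i] i j a x by (cases "i < j") auto
      then show ?thesis using i j by (auto simp: in_set_conv_nth intro!: exI[of _ i])
    qed
    then have "{a \<in> A \<union> ?X. a \<le> z} = {a\<in>S. a \<le> z}" using X S by auto
    then have "cnt (A \<union> ?X) z = cnt S z" by (simp add: cnt_def)
    moreover have "cnt W3 z \<le> cnt S z" using W by (simp add: col_le_def)
    ultimately show ?thesis using cnt_subset[OF W(1) W(3), of z] by simp
  qed
qed

lemma refine_le:
  assumes "sorted_wrt (\<subseteq>) (A # Ss)" "\<forall>S\<in>set Ss. finite S" "finite A"
    and W: "\<And>p q. p \<le> q \<Longrightarrow> q \<le> n \<Longrightarrow> W p \<subseteq> W q" "\<And>p. p \<le> n \<Longrightarrow> finite (W p) \<and> card (W p) = p"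
    and "\<forall>S\<in>set (A # Ss). card S \<le> n \<and> S \<preceq> W (card S)"
    and "card A \<le> p" "p \<le> card (last (A # Ss))"
  shows "A \<union> set (take (p - card A) (refine A Ss)) \<preceq> W p"
  using assms(1-3,6-8)
proof (induction Ss arbitrary: A)
  case Nil
  then show ?case by simp
next
  case (Cons S Ss)
  have S: "finite S" "A \<subseteq> S" "card (S - A) = card S - card A" "card A \<le> card S"
    using Cons.prems by (auto simp: card_Diff_subset card_mono)
  show ?case
  proof (cases "p \<le> card S")
    case True
    have "card S \<le> n" using Cons.prems by simp
    then have "A \<union> set (take (p - card A) (sorted_list_of_set (S - A))) \<preceq> W p"
      using Cons.prems True S W(1)[of "card A" p] W(1)[of p "card S"] W(2)[of p] W(2)[of "card A"] W(2)[of "card S"]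
      by (intro refine_le_block[where ?W1.0 = "W (card A)" and ?W3.0 = "W (card S)"]) auto
    then show ?thesis using S True by simp
  next
    case False
    have "take (p - card A) (refine A (S # Ss))
        = sorted_list_of_set (S - A) @ take (p - card S) (refine S Ss)"
      using S False by simp
    moreover have "S \<union> set (take (p - card S) (refine S Ss)) \<preceq> W p"
      using Cons.IH[of S] Cons.prems False S by auto
    moreover have "A \<union> (set (sorted_list_of_set (S - A)) \<union> X) = S \<union> X" for X using S by auto
    ultimately show ?thesis by simp
  qed
qed

section \<open>Bruhat order by comparison of flags\<close>

text \<open>The tableau criterion is taken as the definition, so that only flags are
  compared.\<close>

definition bruhat_le :: "nat \<Rightarrow> (nat \<Rightarrow> nat) \<Rightarrow> (nat \<Rightarrow> nat) \<Rightarrow> bool" where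
  "bruhat_le n u v \<longleftrightarrow> (\<forall>p\<le>n. u ` {1..p} \<preceq> v ` {1..p})"

lemma permutes_image_card: "u permutes {1..n} \<Longrightarrow> card (u ` {1..p::nat}) = p"
  by (simp add: card_image permutes_inj_on)


lemma chain_minimal_permutation:
  assumes "sorted_wrt (\<supseteq>) Ss" "\<forall>S\<in>set Ss. S \<subseteq> {1..n}"
  obtains v where "v permutes {1..n}" "\<forall>S\<in>set Ss. v ` {1..card S} = S"
    "\<And>u. u permutes {1..n} \<Longrightarrow> \<forall>S\<in>set Ss. S \<preceq> u ` {1..card S} \<Longrightarrow> bruhat_le n v u"
proof -
  \<comment> \<open>The chain is reversed because right keys decrease; the added
    \<open>{1..n}\<close> makes the word list every value.\<close>
  define Rs where "Rs = rev Ss @ [{1..n}]"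
  have sR: "sorted_wrt (\<subseteq>) ({} # Rs)" using assms by (auto simp: Rs_def sorted_wrt_append sorted_wrt_rev)
  have fR: "\<forall>S\<in>set Rs. finite S" using assms by (auto simp: Rs_def intro: finite_subset)
  have lR: "last ({} # Rs) = {1..n}" by (simp add: Rs_def)
  define xs where "xs = refine {} Rs"
  have xs: "distinct xs" "set xs = {1..n}" using refine_set[OF sR] lR by (auto simp: xs_def)
  then have len: "length xs = n" using distinct_card by fastforce
  define v where "v = (\<lambda>j. if j \<in> {1..n} then xs ! (j - 1) else j)"
  have vim: "v ` {1..p} = set (take p xs)" if "p \<le> n" for p
  proof -
    have "v ` {1..p} = (\<lambda>j. xs ! j) ` {0..<p}"
    proof -
      have "{0..<p} = (\<lambda>j. j - 1) ` {1..p}"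
        by (auto simp: image_iff intro!: bexI[of _ "Suc _"])
      then show ?thesis using that by (auto simp: v_def image_image)
    qed
    then show ?thesis using that len nth_image[of p xs] by (simp add: atLeast0LessThan)
  qed
  have "bij_betw v {1..n} {1..n}"
    unfolding bij_betw_def using vim[of n] xs len by (simp add: eq_card_imp_inj_on)
  then have vp: "v permutes {1..n}" by (rule bij_imp_permutes) (auto simp: v_def)
  have "v ` {1..card S} = S" if "S \<in> set Ss" for S
  proof -
    have "card S \<le> n" using assms that card_mono[of "{1..n}" S] by fastforce
    then show ?thesis using vim refine_take[OF sR fR] that by (simp add: xs_def Rs_def)
  qed
  moreover have "bruhat_le n v u" if u: "u permutes {1..n}" "\<forall>S\<in>set Ss. S \<preceq> u ` {1..card S}" for u
    unfolding bruhat_le_def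
  proof (intro allI impI)
    fix p assume p: "p \<le> n"
    have cards: "card S \<le> n" if "S \<in> set Ss" for S using assms that card_mono[of "{1..n}" S] by fastforce
    have un: "u ` {1..n} = {1..n}" using u(1) by (rule permutes_image)
    have "{} \<union> set (take (p - card ({} :: nat set)) (refine {} Rs)) \<preceq> u ` {1..p}"
    proof (rule refine_le[OF sR fR, where n = n])
      show "\<forall>S\<in>set ({} # Rs). card S \<le> n \<and> S \<preceq> u ` {1..card S}"
      proof
        fix S assume "S \<in> set ({} # Rs)"
        then consider "S = {}" | "S \<in> set Ss" | "S = {1..n}" by (auto simp: Rs_def)
        then show "card S \<le> n \<and> S \<preceq> u ` {1..card S}"
        proof cases
          case 3
          then have "u ` {1..card S} = S" using un by simp
          then show ?thesis using 3 col_le_refl[of S] by simp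
        qed (use u cards col_le_refl[of "{}"] in auto)
      qed
      show "u ` {1..a} \<subseteq> u ` {1..b}" if "a \<le> b" "b \<le> n" for a b using that by (intro image_mono) auto
      show "finite (u ` {1..a}) \<and> card (u ` {1..a}) = a" if "a \<le> n" for a
        using permutes_image_card[OF u(1)] by simp
      show "p \<le> card (last ({} # Rs))" using p lR by simp
    qed auto
    then have "set (take p xs) \<preceq> u ` {1..p}" unfolding xs_def by simp
    then show "v ` {1..p} \<preceq> u ` {1..p}" unfolding vim[OF p] .
  qed
  ultimately show thesis using that[OF vp] by blast
qed

lemma cnt_swap:
  assumes "finite D" "a \<notin> D" "b \<notin> D"
  shows "cnt (insert b D) z + (if a \<le> z then 1 else 0) = cnt (insert a D) z + (if b \<le> z then 1 else 0)"
  using assms by (simp add: cnt_insert)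

text \<open>The standard chain argument behind the tableau criterion for Bruhat order.\<close>

lemma bruhat_step:
  assumes u: "u permutes {1..n}" and v: "v permutes {1..n}" and le: "bruhat_le n u v" and ne: "u \<noteq> v"
  obtains i j where "1 \<le> i" "i < j" "j \<le> n" "u i < u j" "bruhat_le n (u \<circ> transpose i j) v"
proof -
  have "\<exists>p. u p \<noteq> v p" using ne by auto
  define i where "i = (LEAST p. u p \<noteq> v p)"
  have i: "u i \<noteq> v i" unfolding i_def by (rule LeastI_ex) fact
  have below: "u p = v p" if "p < i" for p using not_less_Least[of p "\<lambda>p. u p \<noteq> v p"] that unfolding i_def by auto
  have iin: "i \<in> {1..n}" using i u v by (metis permutes_not_in)
  define D where "D = u ` {1..<i}"
  have D: "D = v ` {1..<i}" "finite D" unfolding D_def using below by auto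
  have injs: "inj u" "inj v" using u v permutes_inj by auto
  have "u i \<notin> u ` {1..<i}" "v i \<notin> v ` {1..<i}" using injs by (auto simp: inj_image_mem_iff)
  then have notD: "u i \<notin> D" "v i \<notin> D" unfolding D_def[symmetric] D(1)[symmetric] .
  have "{1..i} = insert i {1..<i}" using iin by auto
  then have im: "u ` {1..i} = insert (u i) D" "v ` {1..i} = insert (v i) D" using D D_def by auto
  have uv: "u i < v i"
  proof -
    have "cnt (insert (v i) D) (v i) \<le> cnt (insert (u i) D) (v i)"
      using le iin im unfolding bruhat_le_def col_le_def by (metis atLeastAtMost_iff)
    then show ?thesis using D(2) notD i by (auto simp: cnt_insert split: if_splits)
  qed
  let ?P = "\<lambda>j. i < j \<and> u i < u j \<and> u j \<le> v i"
  obtain j0 where j0: "u j0 = v i" using u by (metis permutes_surj surjD)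
  have "j0 \<noteq> i" using j0 i by auto
  moreover have "\<not> j0 < i" using below[of j0] j0 injs by (metis inj_eq nat_neq_iff)
  ultimately have ex: "?P j0" using j0 uv by auto
  \<comment> \<open>The first later position with value in \<open>(u i, v i]\<close>; the position
    \<open>j0\<close> of the value \<open>v i\<close> shows that there is one.\<close>
  define j where "j = (LEAST j. ?P j)"
  have j: "?P j" unfolding j_def by (rule LeastI[of ?P, OF ex])
  have minj: "\<not> ?P a" if "a < j" for a using not_less_Least[of a ?P] that unfolding j_def by auto
  have jn: "j \<le> n"
  proof (rule ccontr)
    assume "\<not> j \<le> n"
    then have "u j = j" using u by (auto simp: permutes_def)
    moreover have "v i \<le> n" using iin v permutes_in_image[of v "{1..n}" i] by auto
    ultimately show False using j \<open>\<not> j \<le> n\<close> by auto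
  qed
  define u' where "u' = u \<circ> transpose i j"
  have "bruhat_le n u' v" unfolding bruhat_le_def
  proof (intro allI impI)
    fix p assume p: "p \<le> n"
    have uvp: "cnt (v ` {1..p}) z \<le> cnt (u ` {1..p}) z" for z
      using le p by (simp add: bruhat_le_def col_le_def)
    show "u' ` {1..p} \<preceq> v ` {1..p}"
    proof (cases "i \<le> p \<and> p < j")
      case False
      then have "transpose i j ` {1..p} = {1..p}"
        using iin j by (auto simp: transpose_def image_iff)
      then have "u' ` {1..p} = u ` {1..p}" unfolding u'_def by (metis image_comp)
      then show ?thesis using le p by (simp add: bruhat_le_def)
    next
      case True
      define R where "R = {1..p} - {i}"
      have R: "{1..p} = insert i R" "i \<notin> R" "j \<notin> R" "finite R" unfolding R_def using True iin by auto
      have "transpose i j ` {1..p} = insert j R" unfolding R(1) using R(2,3) by (auto simp: transpose_def image_iff)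
      then have u'p: "u' ` {1..p} = insert (u j) (u ` R)" unfolding u'_def by (metis image_comp image_insert)
      have up: "u ` {1..p} = insert (u i) (u ` R)" using R(1) by auto
      have nR: "u i \<notin> u ` R" "u j \<notin> u ` R" using R injs by (auto simp: inj_image_mem_iff)
      show ?thesis unfolding col_le_def
      proof
        fix z
        have sw: "cnt (u' ` {1..p}) z + (if u i \<le> z then 1 else 0) = cnt (u ` {1..p}) z + (if u j \<le> z then 1 else 0)"
          unfolding u'p up using cnt_swap[of "u ` R" "u i" "u j" z] R nR by simp
        show "cnt (v ` {1..p}) z \<le> cnt (u' ` {1..p}) z"
        proof (cases "u i \<le> z \<and> z < u j")
          case False
          then show ?thesis using sw uvp[of z] j by (auto split: if_splits)
        next
          case z: True
          \<comment> \<open>Here the exchange loses one element up to \<open>z\<close>, so slack is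
            needed. By minimality of \<open>j\<close>, the values of \<open>u\<close> in
            \<open>(z, v i]\<close> come from positions before \<open>i\<close>, which
            \<open>v\<close> shares, and \<open>v\<close> has the value \<open>v i\<close> in
            addition. Comparing the counts at \<open>v i\<close> gives the slack at
            \<open>z\<close>.\<close>
          let ?I = "\<lambda>A. {a\<in>A. z < a \<and> a \<le> v i}"
          have zv: "z \<le> v i" using z j by auto
          have "?I (u ` {1..p}) \<subseteq> ?I D"
          proof
            fix a assume a: "a \<in> ?I (u ` {1..p})"
            then obtain b where b: "b \<in> {1..p}" "a = u b" by auto
            have "\<not> i < b" using minj[of b] a b True z by auto
            moreover have "b \<noteq> i" using a b z by auto
            ultimately show "a \<in> ?I D" using a b by (auto simp: D_def)
          qed
          then have 1: "card (?I (u ` {1..p})) \<le> card (?I D)" using D by (intro card_mono) auto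
          have "insert (v i) (?I D) \<subseteq> ?I (v ` {1..p})" using D(1) True iin z j by auto
          then have "card (insert (v i) (?I D)) \<le> card (?I (v ` {1..p}))" by (intro card_mono) auto
          then have 2: "Suc (card (?I D)) \<le> card (?I (v ` {1..p}))" using notD D by simp
          have "cnt (u ` {1..p}) (v i) = cnt (u ` {1..p}) z + card (?I (u ` {1..p}))"
            "cnt (v ` {1..p}) (v i) = cnt (v ` {1..p}) z + card (?I (v ` {1..p}))"
            using zv by (auto intro!: cnt_interval)
          then show ?thesis using sw uvp[of "v i"] 1 2 z by auto
        qed
      qed
    qed
  qed
  then show thesis using that[of i j] iin j jn by (auto simp: u'_def)
qed

text \<open>Climbing from \<open>u\<close> to \<open>v\<close> ends, because by the rearrangement
  inequality each exchange lowers the sum of all \<open>p * u p\<close>.\<close>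

lemma bruhat_induct:
  assumes u: "u permutes {1..n}" and v: "v permutes {1..n}" and le: "bruhat_le n u v" and v0: "Pr v"
    and step: "\<And>u i j. u permutes {1..n} \<Longrightarrow> 1 \<le> i \<Longrightarrow> i < j \<Longrightarrow> j \<le> n \<Longrightarrow> u i < u j \<Longrightarrow>
      Pr (u \<circ> transpose i j) \<Longrightarrow> Pr u"
  shows "Pr u"
  using u le
proof (induction "\<Sum>p\<in>{1..n}. p * u p" arbitrary: u rule: less_induct)
  case less
  show ?case
  proof (cases "u = v")
    case False
    obtain i j where ij: "1 \<le> i" "i < j" "j \<le> n" "u i < u j" "bruhat_le n (u \<circ> transpose i j) v"
      using bruhat_step[OF less.prems(1) v less.prems(2) False] .
    define R where "R = {1..n} - {i, j}"
    have R: "{1..n} = insert i (insert j R)" "i \<notin> insert j R" "j \<notin> R" "finite R" unfolding R_def using ij by auto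
    have perm: "(u \<circ> transpose i j) permutes {1..n}"
      using ij by (intro permutes_compose permutes_swap_id less.prems) auto
    have "(\<Sum>p\<in>R. p * (u \<circ> transpose i j) p) = (\<Sum>p\<in>R. p * u p)"
      using R by (intro sum.cong) (auto simp: transpose_def)
    moreover have "i * u j + j * u i < i * u i + j * u j"
    proof -
      obtain a b where "j = i + a" "u j = u i + b" "0 < a" "0 < b" using ij
        by (metis less_imp_add_positive)
      then show ?thesis by (simp add: algebra_simps)
    qed
    ultimately have "(\<Sum>p\<in>{1..n}. p * (u \<circ> transpose i j) p) < (\<Sum>p\<in>{1..n}. p * u p)"
      unfolding R(1) using R by simp
    then have "Pr (u \<circ> transpose i j)" using less.hyps perm ij by auto
    then show ?thesis using step less.prems ij by auto
  qed (use v0 in simp)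
qed


section \<open>Initial minors on Schubert varieties\<close>

type_synonym cmat = "nat \<Rightarrow> nat \<Rightarrow> complex"

definition col_minor :: "nat set \<Rightarrow> cmat \<Rightarrow> complex" where
  "col_minor C A = det (mat (card C) (card C) (\<lambda>(i, j). A (sorted_list_of_set C ! i) (Suc j)))"

definition col_product :: "nat set list \<Rightarrow> cmat \<Rightarrow> complex" where
  "col_product Cs A = (\<Prod>C\<leftarrow>Cs. col_minor C A)"

text \<open>Polynomiality enters through restrictions to lines, which suffices for cancelling
  factors and for limits.\<close>

definition line_poly :: "(cmat \<Rightarrow> complex) \<Rightarrow> bool" where
  "line_poly F \<longleftrightarrow> (\<forall>A D. \<exists>p. \<forall>t. F (\<lambda>i j. A i j + t * D i j) = poly p t)"

text \<open>For \<open>i < j\<close> this is right multiplication by an upper unitriangular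
  matrix.\<close>

definition shear :: "nat \<Rightarrow> nat \<Rightarrow> complex \<Rightarrow> cmat \<Rightarrow> cmat" where
  "shear i j s A = (\<lambda>r c. if c = j then A r j + s * A r i else A r c)"

definition shear_invariant :: "(cmat \<Rightarrow> complex) \<Rightarrow> bool" where
  "shear_invariant F \<longleftrightarrow> (\<forall>A i j s. 1 \<le> i \<and> i < j \<longrightarrow> F (shear i j s A) = F A)"

definition supported :: "nat \<Rightarrow> (nat \<Rightarrow> nat) \<Rightarrow> cmat \<Rightarrow> bool" where
  "supported n v A \<longleftrightarrow> (\<forall>i. \<forall>j\<in>{1..n}. v j < i \<longrightarrow> A i j = 0)"

definition vanishes :: "nat \<Rightarrow> (nat \<Rightarrow> nat) \<Rightarrow> (cmat \<Rightarrow> complex) \<Rightarrow> bool" where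
  "vanishes n v F \<longleftrightarrow> (\<forall>A. supported n v A \<longrightarrow> F A = 0)"

lemma line_poly_const: "line_poly (\<lambda>A. c)"
  unfolding line_poly_def by (auto intro!: exI[of _ "[:c:]"])

lemma line_poly_entry: "line_poly (\<lambda>A. A i j)"
  unfolding line_poly_def
proof (intro allI)
  fix A D :: cmat
  show "\<exists>p. \<forall>t. A i j + t * D i j = poly p t" by (rule exI[of _ "[:A i j, D i j:]"]) auto
qed

lemma line_poly_add:
  assumes "line_poly F" "line_poly G" shows "line_poly (\<lambda>A. F A + G A)"
  unfolding line_poly_def
proof (intro allI)
  fix A D
  obtain p q where "\<forall>t. F (\<lambda>i j. A i j + t * D i j) = poly p t" "\<forall>t. G (\<lambda>i j. A i j + t * D i j) = poly q t"
    using assms unfolding line_poly_def by metis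
  then show "\<exists>p. \<forall>t. F (\<lambda>i j. A i j + t * D i j) + G (\<lambda>i j. A i j + t * D i j) = poly p t"
    by (intro exI[of _ "p + q"]) simp
qed

lemma line_poly_mult:
  assumes "line_poly F" "line_poly G" shows "line_poly (\<lambda>A. F A * G A)"
  unfolding line_poly_def
proof (intro allI)
  fix A D
  obtain p q where "\<forall>t. F (\<lambda>i j. A i j + t * D i j) = poly p t" "\<forall>t. G (\<lambda>i j. A i j + t * D i j) = poly q t"
    using assms unfolding line_poly_def by metis
  then show "\<exists>p. \<forall>t. F (\<lambda>i j. A i j + t * D i j) * G (\<lambda>i j. A i j + t * D i j) = poly p t"
    by (intro exI[of _ "p * q"]) simp
qed

lemma line_poly_sum: "(\<And>x. x \<in> X \<Longrightarrow> line_poly (F x)) \<Longrightarrow> line_poly (\<lambda>A. \<Sum>x\<in>X. F x A)"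
  by (induction X rule: infinite_finite_induct) (auto intro: line_poly_const line_poly_add)

lemma line_poly_prod: "(\<And>x. x \<in> X \<Longrightarrow> line_poly (F x)) \<Longrightarrow> line_poly (\<lambda>A. \<Prod>x\<in>X. F x A)"
  by (induction X rule: infinite_finite_induct) (auto intro: line_poly_const line_poly_mult)

lemma col_minor_leibniz:
  "col_minor C A = (\<Sum>p | p permutes {0..<card C}. signof p * (\<Prod>i = 0..<card C. A (sorted_list_of_set C ! i) (Suc (p i))))"
  unfolding col_minor_def
  by (subst det_def', rule mat_carrier, rule sum.cong, simp)
    (auto intro!: prod.cong simp: permutes_in_image)

lemma line_poly_col_minor: "line_poly (col_minor C)"
proof -
  have "line_poly (\<lambda>A. \<Sum>p | p permutes {0..<card C}. signof p * (\<Prod>i = 0..<card C. A (sorted_list_of_set C ! i) (Suc (p i))))"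
    by (intro line_poly_sum line_poly_mult line_poly_const line_poly_prod line_poly_entry)
  then show ?thesis by (subst (asm) col_minor_leibniz[symmetric])
qed

lemma line_poly_col_product: "line_poly (col_product Cs)"
proof (induction Cs)
  case Nil
  then show ?case by (simp add: col_product_def line_poly_const)
next
  case (Cons C Cs)
  have "line_poly (\<lambda>A. col_minor C A * col_product Cs A)"
    by (intro line_poly_mult line_poly_col_minor Cons)
  then show ?case by (simp add: col_product_def)
qed

text \<open>If column \<open>j\<close> enters the minor, so does the earlier column
  \<open>i\<close>: this is where it matters that the minors are initial.\<close>

lemma shear_col_minor:
  assumes "1 \<le> i" "i < j"
  shows "col_minor C (shear i j s A) = col_minor C A"
proof (cases "j \<le> card C")
  case True
  let ?q = "card C"
  let ?M = "\<lambda>A. mat ?q ?q (\<lambda>(i, j). A (sorted_list_of_set C ! i) (Suc j)) :: complex mat"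
  have "?M (shear i j s A) = mat_addcol s (j - 1) (i - 1) (?M A)"
    using assms True by (auto simp: shear_def mat_addcol_def intro!: eq_matI)
  moreover have "det (mat_addcol s (j - 1) (i - 1) (?M A)) = det (?M A)"
    by (rule det_addcol[where n = ?q]) (use assms True in auto)
  ultimately have "det (?M (shear i j s A)) = det (?M A)" by metis
  then show ?thesis by (simp add: col_minor_def)
next
  case False
  have "mat (card C) (card C) (\<lambda>(i', j'). shear i j s A (sorted_list_of_set C ! i') (Suc j'))
      = mat (card C) (card C) (\<lambda>(i, j). A (sorted_list_of_set C ! i) (Suc j))"
    using False by (intro cong_mat) (auto simp: shear_def)
  then show ?thesis by (simp add: col_minor_def)
qed

lemma shear_col_product: "1 \<le> i \<Longrightarrow> i < j \<Longrightarrow> col_product Cs (shear i j s A) = col_product Cs A"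
  by (simp add: col_product_def shear_col_minor)

lemma poly_eq_0_punctured:
  fixes p :: "complex poly"
  assumes "\<And>t. t \<noteq> 0 \<Longrightarrow> poly p t = 0"
  shows "p = 0"
proof -
  \<comment> \<open>Multiplication by the variable takes care of the excluded point 0.\<close>
  have "poly (p * [:0, 1:]) t = 0" for t using assms[of t] by (cases "t = 0") auto
  then have "p * [:0, 1:] = 0" using poly_all_0_iff_0 by blast
  then show ?thesis by simp
qed

text \<open>With \<open>a\<close>, \<open>b\<close> the columns \<open>j\<close>, \<open>i\<close> of \<open>A\<close>, the columns \<open>b + t a\<close>, \<open>- b / t\<close> are admissible for the
  larger permutation; a shear turns them into \<open>b + t a\<close>, \<open>a\<close>, and then \<open>t\<close> tends to 0.\<close>

lemma vanishes_transpose: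
  assumes F: "line_poly F" "shear_invariant F"
    and ij: "1 \<le> i" "i < j" "j \<le> n" "u i < u j"
    and van: "vanishes n (u \<circ> transpose i j) F"
  shows "vanishes n u F"
  unfolding vanishes_def
proof (intro allI impI)
  fix A assume A: "supported n u A"
  define D where "D = (\<lambda>r c. if c = i then A r j else 0)"
  obtain p where p: "\<And>t. F (\<lambda>r c. A r c + t * D r c) = poly p t"
    using F(1) unfolding line_poly_def by metis
  have "poly p t = 0" if t: "t \<noteq> 0" for t
  proof -
    define B where "B = (\<lambda>r c. if c = i then A r i + t * A r j else if c = j then - (A r i / t) else A r c)"
    have "supported n (u \<circ> transpose i j) B"
      using A ij by (auto simp: supported_def B_def transpose_def)
    then have "F B = 0" using van by (simp add: vanishes_def)
    moreover have "shear i j (1 / t) B = (\<lambda>r c. A r c + t * D r c)"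
      using ij t by (auto simp: shear_def B_def D_def field_simps intro!: ext)
    moreover have "F (shear i j (1 / t) B) = F B" using F(2) ij by (simp add: shear_invariant_def)
    ultimately show ?thesis using p[of t] by simp
  qed
  then have "p = 0" by (rule poly_eq_0_punctured)
  then show "F A = 0" using p[of 0] by simp
qed

lemma vanishes_bruhat:
  assumes F: "line_poly F" "shear_invariant F"
    and "u permutes {1..n}" "v permutes {1..n}" "bruhat_le n u v" "vanishes n v F"
  shows "vanishes n u F"
proof (rule bruhat_induct[where Pr = "\<lambda>u. vanishes n u F", OF assms(3-6)])
  fix u i j assume "1 \<le> i" "i < j" "j \<le> n" "u i < u j" "vanishes n (u \<circ> transpose i j) F"
  then show "vanishes n u F" by (rule vanishes_transpose[OF F])
qed

text \<open>Irreducibility of the linear space \<open>X\<^sub>v\<close>: the line from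
  \<open>A\<close> to \<open>B\<close> stays inside it, both functions are polynomials on that line,
  and \<open>G\<close> is nonzero at parameter 1.\<close>

lemma vanishes_cancel:
  assumes "line_poly F" "line_poly G" "vanishes n v (\<lambda>A. F A * G A)" "supported n v B" "G B \<noteq> 0"
  shows "vanishes n v F"
  unfolding vanishes_def
proof (intro allI impI)
  fix A assume A: "supported n v A"
  define D where "D = (\<lambda>i j. B i j - A i j)"
  obtain p where p: "\<And>t. F (\<lambda>r c. A r c + t * D r c) = poly p t"
    using assms(1) unfolding line_poly_def by metis
  obtain q where q: "\<And>t. G (\<lambda>r c. A r c + t * D r c) = poly q t"
    using assms(2) unfolding line_poly_def by metis
  have "poly (p * q) t = 0" for t
  proof -
    have "supported n v (\<lambda>r c. A r c + t * D r c)" using A assms(4) by (auto simp: supported_def D_def)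
    then show ?thesis using assms(3) p q by (auto simp: vanishes_def)
  qed
  then have "p * q = 0" using poly_all_0_iff_0 by blast
  moreover have "poly q 1 \<noteq> 0" using q[of 1] assms(5) by (simp add: D_def)
  ultimately have "p = 0" by auto
  then show "F A = 0" using p[of 0] by simp
qed

lemma col_minor_vanishes:
  assumes "finite C" "card C \<le> n" "v permutes {1..n}" "\<not> C \<preceq> v ` {1..card C}"
  shows "vanishes n v (col_minor C)"
  unfolding vanishes_def
proof (intro allI impI)
  fix A assume A: "supported n v A"
  let ?q = "card C" and ?c = "\<lambda>i. sorted_list_of_set C ! i"
  have "(\<Prod>i = 0..<?q. A (?c i) (Suc (p i))) = 0" if p: "p permutes {0..<?q}" for p
  proof (rule ccontr)
    assume "(\<Prod>i = 0..<?q. A (?c i) (Suc (p i))) \<noteq> 0"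
    then have nz: "A (?c i) (Suc (p i)) \<noteq> 0" if "i < ?q" for i using that by auto
    have le: "?c i \<le> v (Suc (p i))" if i: "i < ?q" for i
    proof -
      have "p i < ?q" using p i permutes_in_image[OF p, of i] by simp
      then show ?thesis using A nz[OF i] assms(2) by (force simp: supported_def not_le[symmetric])
    qed
    have "C \<preceq> v ` {1..?q}" unfolding col_le_def
    proof
      fix z
      define I where "I = {i \<in> {0..<?q}. v (Suc (p i)) \<le> z}"
      have I: "finite I" by (simp add: I_def)
      have dist: "distinct (sorted_list_of_set C)" "length (sorted_list_of_set C) = ?q" "set (sorted_list_of_set C) = C"
        using assms(1) by auto
      have "{1..?q} = Suc ` {0..<?q}" by (simp add: image_Suc_atLeastLessThan atLeastLessThanSuc_atLeastAtMost)
      also have "\<dots> = Suc ` p ` {0..<?q}" using permutes_image[OF p] by simp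
      finally have "v ` {1..?q} = (\<lambda>i. v (Suc (p i))) ` {0..<?q}" by (simp add: image_image)
      then have "{a \<in> v ` {1..?q}. a \<le> z} \<subseteq> (\<lambda>i. v (Suc (p i))) ` I" by (auto simp: I_def)
      then have "cnt (v ` {1..?q}) z \<le> card I" unfolding cnt_def using surj_card_le[OF I] by simp
      also have "card I = card (?c ` I)"
        using dist by (intro card_image[symmetric] inj_onI) (auto simp: I_def nth_eq_iff_index_eq)
      also have "\<dots> \<le> cnt C z" unfolding cnt_def
      proof (rule card_mono)
        show "?c ` I \<subseteq> {a \<in> C. a \<le> z}"
        proof
          fix y assume "y \<in> ?c ` I"
          then obtain i where i: "i < ?q" "v (Suc (p i)) \<le> z" "y = ?c i" by (auto simp: I_def)
          then show "y \<in> {a \<in> C. a \<le> z}" using le[OF i(1)] dist nth_mem[of i "sorted_list_of_set C"] by auto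
        qed
      qed (use assms(1) in simp)
      finally show "cnt (v ` {1..?q}) z \<le> cnt C z" .
    qed
    then show False using assms(4) by simp
  qed
  then show "col_minor C A = 0" unfolding col_minor_leibniz by (intro sum.neutral) auto
qed

text \<open>The permutation matrix of \<open>v\<close> is a witness: its rows in \<open>C\<close>
  form a permutation matrix, whose product with its transpose is the identity.\<close>

lemma col_minor_nonzero:
  assumes v: "v permutes {1..n}" and q: "q \<le> n" and C: "v ` {1..q} = C"
  obtains B where "supported n v B" "col_minor C B \<noteq> 0"
proof
  define B :: cmat where "B = (\<lambda>i j. if i = v j then 1 else 0)"
  show "supported n v B" by (auto simp: supported_def B_def)
  have cC: "card C = q" using permutes_image_card[OF v, of q] C by simp
  have fC: "finite C" using C by auto
  let ?c = "\<lambda>i. sorted_list_of_set C ! i"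
  let ?M = "mat q q (\<lambda>(i, j). B (?c i) (Suc j))"
  have dist: "distinct (sorted_list_of_set C)" "length (sorted_list_of_set C) = q" "set (sorted_list_of_set C) = C"
    using fC cC by auto
  have "?M * transpose_mat ?M = 1\<^sub>m q"
  proof (rule eq_matI)
    fix i k assume "i < dim_row (1\<^sub>m q)" "k < dim_col (1\<^sub>m q)"
    then have ik: "i < q" "k < q" by auto
    have "?c i \<in> C" using ik dist nth_mem by metis
    then obtain m where m: "m \<in> {1..q}" "?c i = v m" using C by blast
    define j where "j = m - 1"
    have j: "j < q" "?c i = v (Suc j)" using m by (auto simp: j_def)
    have "(?M * transpose_mat ?M) $$ (i, k) = (\<Sum>l = 0..<q. B (?c i) (Suc l) * B (?c k) (Suc l))"
      using ik by (simp add: scalar_prod_def)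
    also have "\<dots> = (\<Sum>l = 0..<q. if l = j then B (?c k) (Suc l) else 0)"
      using j permutes_inj[OF v] by (intro sum.cong) (auto simp: B_def dest: injD)
    also have "\<dots> = B (?c k) (Suc j)" using j by simp
    also have "\<dots> = (if i = k then 1 else 0)"
      using j ik dist nth_eq_iff_index_eq[of "sorted_list_of_set C" i k] by (auto simp: B_def)
    finally show "(?M * transpose_mat ?M) $$ (i, k) = 1\<^sub>m q $$ (i, k)" using ik by simp
  qed auto
  then have "det ?M * det (transpose_mat ?M) = 1"
    using det_mult[of ?M q "transpose_mat ?M"] by simp
  then show "col_minor C B \<noteq> 0" unfolding col_minor_def cC by auto
qed


section \<open>Linear independence of standard monomials\<close>

definition down_closed :: "nat \<Rightarrow> (nat \<Rightarrow> nat) set \<Rightarrow> bool" where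
  "down_closed n I \<longleftrightarrow> (\<forall>v\<in>I. v permutes {1..n}) \<and>
     (\<forall>v\<in>I. \<forall>u. u permutes {1..n} \<and> bruhat_le n u v \<longrightarrow> u \<in> I)"

abbreviation flag :: "(nat \<Rightarrow> nat) \<Rightarrow> nat \<Rightarrow> nat set" where
  "flag v p \<equiv> v ` {1..p}"

text \<open>Standardness on the union of the Schubert varieties in \<open>I\<close>: a single member
  has to bound all right keys at once.\<close>

definition standard_on :: "nat \<Rightarrow> (nat \<Rightarrow> nat) set \<Rightarrow> nat list \<Rightarrow> nat set list \<Rightarrow> bool" where
  "standard_on n I ls T \<longleftrightarrow> tab n T \<and> map card T = ls \<and> (\<exists>v\<in>I. key_bounded (flag v) T)"

text \<open>All ideals are included because the induction on the number of columns passes to smaller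
  ideals.\<close>

definition standard_independent :: "nat \<Rightarrow> nat list \<Rightarrow> bool" where
  "standard_independent n ls \<longleftrightarrow> (\<forall>I F a. down_closed n I \<longrightarrow> finite F \<longrightarrow> (\<forall>T\<in>F. standard_on n I ls T) \<longrightarrow>
     (\<forall>v\<in>I. vanishes n v (\<lambda>A. \<Sum>T\<in>F. a T * col_product T A)) \<longrightarrow> (\<forall>T\<in>F. a T = 0))"

lemma bruhat_le_trans: "bruhat_le n u v \<Longrightarrow> bruhat_le n v w \<Longrightarrow> bruhat_le n u w"
  unfolding bruhat_le_def using col_le_trans by blast

lemma bruhat_le_refl: "bruhat_le n u u"
  by (simp add: bruhat_le_def col_le_refl)

text \<open>The permutations that bound a tableau all lie above one whose flag equals the right
  keys, so an ideal containing any of them contains that one.\<close>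

lemma key_permutation:
  assumes "tab n T"
  obtains v where "v permutes {1..n}" "\<forall>S\<in>set (right_keys T). flag v (card S) = S"
    "\<And>u. u permutes {1..n} \<Longrightarrow> key_bounded (flag u) T \<Longrightarrow> bruhat_le n v u"
proof -
  have "\<forall>S\<in>set (right_keys T). S \<subseteq> {1..n}" using right_keys_cols[OF assms] by blast
  from chain_minimal_permutation[OF right_keys_chain[OF assms] this] obtain v where
    "v permutes {1..n}" "\<forall>S\<in>set (right_keys T). flag v (card S) = S"
    "\<And>u. u permutes {1..n} \<Longrightarrow> \<forall>S\<in>set (right_keys T). S \<preceq> flag u (card S) \<Longrightarrow> bruhat_le n v u" by blast
  then show thesis using that by (simp add: key_bounded_def)
qed

lemma key_bounded_flag: "\<forall>S\<in>set (right_keys T). flag v (card S) = S \<Longrightarrow> key_bounded (flag v) T"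
  by (simp add: key_bounded_def col_le_refl)

text \<open>Take a minimal column among those that occur. On flags through it the minors of all
  other columns vanish, and its own minor can be cancelled.\<close>

lemma separate_column:
  assumes I: "\<And>v. v \<in> I \<Longrightarrow> v permutes {1..n}" and F: "finite F"
    and c: "\<And>T. T \<in> F \<Longrightarrow> c T \<subseteq> {1..n} \<and> card (c T) = q"
    and van: "\<And>v. v \<in> I \<Longrightarrow> vanishes n v (\<lambda>A. \<Sum>T\<in>F. a T * (m T A * col_minor (c T) A))"
    and lp: "\<And>T. T \<in> F \<Longrightarrow> line_poly (m T)"
    and ex: "\<exists>T\<in>F. a T \<noteq> 0"
  obtains T0 where "T0 \<in> F" "a T0 \<noteq> 0"
    "\<And>v. v \<in> I \<Longrightarrow> flag v q = c T0 \<Longrightarrow> vanishes n v (\<lambda>A. \<Sum>T\<in>{T\<in>F. a T \<noteq> 0 \<and> c T = c T0}. a T * m T A)"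
proof -
  \<comment> \<open>Among columns of equal size in \<open>{1..n}\<close>, \<open>\<mu>\<close>
    strictly decreases along \<open>\<preceq>\<close>, so a maximum of \<open>\<mu>\<close> is a
    minimal column.\<close>
  define \<mu> where "\<mu> C = (\<Sum>z\<le>n. cnt C z)" for C
  define F0 where "F0 = {T\<in>F. a T \<noteq> 0}"
  have F0: "finite F0" "F0 \<noteq> {}" using F ex by (auto simp: F0_def)
  define M where "M = Max ((\<mu> \<circ> c) ` F0)"
  have "M \<in> (\<mu> \<circ> c) ` F0" unfolding M_def using F0 by (intro Max_in) auto
  then obtain T0 where T0: "T0 \<in> F0" "\<mu> (c T0) = M" by auto
  have max: "\<mu> (c T) \<le> \<mu> (c T0)" if "T \<in> F0" for T unfolding T0(2) M_def using F0 that by (intro Max_ge) auto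
  have qn: "q \<le> n" using c[of T0] T0 card_mono[of "{1..n}" "c T0"] by (auto simp: F0_def)
  show thesis
  proof
    show "T0 \<in> F" "a T0 \<noteq> 0" using T0 by (auto simp: F0_def)
    fix v assume v: "v \<in> I" "flag v q = c T0"
    let ?G = "{T\<in>F. a T \<noteq> 0 \<and> c T = c T0}"
    have zero: "col_minor (c T) A = 0" if T: "T \<in> F0" "c T \<noteq> c T0" and A: "supported n v A" for T A
    proof -
      have cT: "c T \<subseteq> {1..n}" "card (c T) = q" "finite (c T)" "c T0 \<subseteq> {1..n}" "card (c T0) = q" "finite (c T0)"
        using c[of T] c[of T0] T T0 colD by (auto simp: F0_def)
      have "\<not> c T \<preceq> c T0"
      proof
        assume le: "c T \<preceq> c T0"
        then have "\<mu> (c T0) \<le> \<mu> (c T)" unfolding \<mu>_def col_le_def by (intro sum_mono) auto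
        then have "\<mu> (c T0) = \<mu> (c T)" using max[OF T(1)] by simp
        then have small: "cnt (c T0) z = cnt (c T) z" if "z \<le> n" for z
          using sum_mono_inv[of "cnt (c T0)" "{..n}" "cnt (c T)" z] le that by (auto simp: \<mu>_def col_le_def)
        have large: "cnt (c T0) z = cnt (c T) z" if "n < z" for z
          using cnt_eq_card[of "c T0" z] cnt_eq_card[of "c T" z] cT that by fastforce
        have "c T0 = c T"
          by (rule cnt_eq_imp_eq) (use cT small large in \<open>auto simp: not_le[symmetric]\<close>)
        then show False using T by simp
      qed
      then have "vanishes n v (col_minor (c T))"
        using col_minor_vanishes[OF cT(3) _ I[OF v(1)]] cT qn v by simp
      then show ?thesis using A by (simp add: vanishes_def)
    qed
    obtain B where B: "supported n v B" "col_minor (c T0) B \<noteq> 0"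
      using col_minor_nonzero[OF I[OF v(1)] qn v(2)] .
    have fg: "vanishes n v (\<lambda>A. (\<Sum>T\<in>?G. a T * m T A) * col_minor (c T0) A)"
      unfolding vanishes_def
    proof (intro allI impI)
      fix A assume A: "supported n v A"
      have "(\<Sum>T\<in>?G. a T * m T A) * col_minor (c T0) A = (\<Sum>T\<in>?G. a T * (m T A * col_minor (c T) A))"
        unfolding sum_distrib_right by (intro sum.cong) auto
      also have "\<dots> = (\<Sum>T\<in>F. a T * (m T A * col_minor (c T) A))"
        using F zero[OF _ _ A] by (intro sum.mono_neutral_left) (auto simp: F0_def)
      finally show "(\<Sum>T\<in>?G. a T * m T A) * col_minor (c T0) A = 0"
        using van[OF v(1)] A by (simp add: vanishes_def)
    qed
    have "line_poly (\<lambda>A. \<Sum>T\<in>?G. a T * m T A)"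
      by (intro line_poly_sum line_poly_mult line_poly_const) (use lp in auto)
    from vanishes_cancel[OF this line_poly_col_minor fg B]
    show "vanishes n v (\<lambda>A. \<Sum>T\<in>?G. a T * m T A)" .
  qed
qed

text \<open>The induction step, abstract in \<open>r\<close> and \<open>c\<close>: it serves both
  for the last column of a tableau and for a right key rotated to the end, where \<open>r T\<close>
  followed by \<open>c T\<close> need not be a tableau.\<close>

lemma independent_extend:
  assumes ind: "standard_independent n ls" and I: "down_closed n I" and F: "finite F"
    and inj: "inj_on (\<lambda>T. (r T, c T)) F"
    and T: "\<And>T. T \<in> F \<Longrightarrow> tab n (r T) \<and> map card (r T) = ls \<and> c T \<subseteq> {1..n} \<and> card (c T) = q \<and>
      (\<exists>v\<in>I. flag v q = c T \<and> key_bounded (flag v) (r T))"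
    and van: "\<And>v. v \<in> I \<Longrightarrow> vanishes n v (\<lambda>A. \<Sum>T\<in>F. a T * (col_product (r T) A * col_minor (c T) A))"
  shows "\<forall>T\<in>F. a T = 0"
proof (rule ccontr)
  assume "\<not> (\<forall>T\<in>F. a T = 0)"
  then have ex: "\<exists>T\<in>F. a T \<noteq> 0" by blast
  have Ip: "\<And>v. v \<in> I \<Longrightarrow> v permutes {1..n}" using I by (simp add: down_closed_def)
  have cT: "\<And>T. T \<in> F \<Longrightarrow> c T \<subseteq> {1..n} \<and> card (c T) = q" using T by blast
  obtain T0 where T0: "T0 \<in> F" "a T0 \<noteq> 0"
    "\<And>v. v \<in> I \<Longrightarrow> flag v q = c T0 \<Longrightarrow> vanishes n v (\<lambda>A. \<Sum>T\<in>{T\<in>F. a T \<noteq> 0 \<and> c T = c T0}. a T * col_product (r T) A)"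
    by (rule separate_column[where c = c and m = "\<lambda>T. col_product (r T)" and I = I and a = a, OF Ip F cT van line_poly_col_product ex])
      (assumption | erule that)+
  define G where "G = {T\<in>F. a T \<noteq> 0 \<and> c T = c T0}"
  have injG: "inj_on r G" using inj by (auto simp: inj_on_def G_def)
  define b where "b D = a (the_inv_into G r D)" for D
  have b: "b (r T) = a T" if "T \<in> G" for T using the_inv_into_f_f[OF injG that] by (simp add: b_def)
  \<comment> \<open>The shortened relation holds at the members of \<open>I\<close> whose flag
    passes through the chosen column, and descends to everything below them.\<close>
  define J where "J = {u. u permutes {1..n} \<and> (\<exists>v\<in>I. flag v q = c T0 \<and> bruhat_le n u v)}"
  have "down_closed n J" unfolding down_closed_def J_def using bruhat_le_trans by blast
  moreover have "finite (r ` G)" using F by (auto simp: G_def)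
  moreover have "standard_on n J ls D" if D: "D \<in> r ` G" for D
  proof -
    obtain S where S: "S \<in> G" "D = r S" using D by blast
    then have "S \<in> F" "c S = c T0" by (auto simp: G_def)
    with T[OF this(1)] obtain v where "v \<in> I" "flag v q = c T0" "key_bounded (flag v) D" using S by auto
    moreover then have "v \<in> J" using Ip bruhat_le_refl unfolding J_def by blast
    ultimately show ?thesis using T[OF \<open>S \<in> F\<close>] S by (auto simp: standard_on_def)
  qed
  moreover have "vanishes n u (\<lambda>A. \<Sum>D\<in>r ` G. b D * col_product D A)" if "u \<in> J" for u
  proof -
    obtain v where v: "v \<in> I" "flag v q = c T0" "bruhat_le n u v" "u permutes {1..n}" using \<open>u \<in> J\<close> by (auto simp: J_def)
    have eq: "(\<Sum>D\<in>r ` G. b D * col_product D A) = (\<Sum>T\<in>G. a T * col_product (r T) A)" for A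
      using b by (simp add: sum.reindex[OF injG])
    have "vanishes n u (\<lambda>A. \<Sum>T\<in>G. a T * col_product (r T) A)"
    proof (rule vanishes_bruhat[OF _ _ v(4) Ip[OF v(1)] v(3)])
      show "line_poly (\<lambda>A. \<Sum>T\<in>G. a T * col_product (r T) A)"
        by (intro line_poly_sum line_poly_mult line_poly_const line_poly_col_product)
      show "shear_invariant (\<lambda>A. \<Sum>T\<in>G. a T * col_product (r T) A)"
        by (auto simp: shear_invariant_def shear_col_product)
      show "vanishes n v (\<lambda>A. \<Sum>T\<in>G. a T * col_product (r T) A)" using T0(3)[OF v(1,2)] by (simp add: G_def)
    qed
    then show ?thesis by (simp add: eq)
  qed
  ultimately have "\<forall>D\<in>r ` G. b D = 0" using ind unfolding standard_independent_def by blast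
  moreover have "T0 \<in> G" using T0 by (simp add: G_def)
  ultimately show False using b T0 by force
qed

lemma standard_on_flag:
  assumes "down_closed n I" "standard_on n I ls T"
  obtains v where "v \<in> I" "\<forall>S\<in>set (right_keys T). flag v (card S) = S"
proof -
  obtain u where u: "u \<in> I" "key_bounded (flag u) T" using assms by (auto simp: standard_on_def)
  obtain v where v: "v permutes {1..n}" "\<forall>S\<in>set (right_keys T). flag v (card S) = S"
    "\<And>u. u permutes {1..n} \<Longrightarrow> key_bounded (flag u) T \<Longrightarrow> bruhat_le n v u"
    using key_permutation[of n T] assms(2) unfolding standard_on_def by blast
  then show thesis using that[of v] u assms(1) unfolding down_closed_def by blast
qed

lemma standard_independence: "standard_independent n ls"
proof (induction ls rule: rev_induct)
  case Nil
  show ?case unfolding standard_independent_def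
  proof (intro allI impI ballI)
    fix I F a T
    assume I: "down_closed n I" and F: "finite F" "\<forall>T\<in>F. standard_on n I [] T" and T: "T \<in> F"
      and van: "\<forall>v\<in>I. vanishes n v (\<lambda>A. \<Sum>T\<in>F. a T * col_product T A)"
    have FT: "F = {[]}" using F(2) T by (auto simp: standard_on_def)
    obtain v where "v \<in> I" using F(2) T by (auto simp: standard_on_def)
    then have "vanishes n v (\<lambda>A. \<Sum>T\<in>F. a T * col_product T A)" using van by blast
    \<comment> \<open>The empty product is 1, so one admissible matrix already isolates the
      coefficient.\<close>
    moreover have "supported n v (\<lambda>i j. 0)" by (simp add: supported_def)
    ultimately show "a T = 0" using FT T by (auto simp: vanishes_def col_product_def)
  qed
next
  case (snoc q ls)
  show ?case unfolding standard_independent_def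
  proof (intro allI impI)
    fix I F and a :: "nat set list \<Rightarrow> complex"
    assume I: "down_closed n I" and F: "finite F" "\<forall>T\<in>F. standard_on n I (ls @ [q]) T"
      and van: "\<forall>v\<in>I. vanishes n v (\<lambda>A. \<Sum>T\<in>F. a T * col_product T A)"
    have dec: "T = butlast T @ [last T]" if "T \<in> F" for T
      using F(2) that by (cases T rule: rev_cases) (auto simp: standard_on_def)
    have prod: "col_product T A = col_product (butlast T) A * col_minor (last T) A" if "T \<in> F" for T A
      by (subst dec[OF that]) (simp add: col_product_def)
    show "\<forall>T\<in>F. a T = 0"
    proof (rule independent_extend[OF snoc I F(1), where r = butlast and c = last])
      show "inj_on (\<lambda>T. (butlast T, last T)) F" using dec by (intro inj_onI) (metis prod.inject)
      show "vanishes n v (\<lambda>A. \<Sum>T\<in>F. a T * (col_product (butlast T) A * col_minor (last T) A))" if "v \<in> I" for v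
        using van that prod by (simp cong: sum.cong)
      fix T assume T: "T \<in> F"
      define D C where "D = butlast T" "C = last T"
      have TD: "T = D @ [C]" using dec[OF T] by (simp add: D_C_def)
      have st: "standard_on n I (ls @ [q]) T" using F T by blast
      then have t: "tab n (D @ [C])" "map card D = ls" "card C = q" by (auto simp: standard_on_def TD)
      obtain v where v: "v \<in> I" "\<forall>S\<in>set (right_keys T). flag v (card S) = S" using standard_on_flag[OF I st] .
      have "flag v q = C" using v(2) t(3) by (simp add: TD right_keys_snoc)
      moreover have "key_bounded (flag v) D"
        using key_bounded_butlast[OF t(1)] key_bounded_flag[OF v(2)] by (simp add: TD)
      ultimately show "tab n (butlast T) \<and> map card (butlast T) = ls \<and> last T \<subseteq> {1..n} \<and> card (last T) = q \<and>
        (\<exists>v\<in>I. flag v q = last T \<and> key_bounded (flag v) (butlast T))"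
        using t v(1) unfolding D_C_def[symmetric] by (auto simp: tab_append tab_Cons)
    qed
  qed
qed

section \<open>Independence of rotated and adapted monomials\<close>

definition rotated :: "nat \<Rightarrow> nat set list \<Rightarrow> nat set list" where
  "rotated e T = (take e T @ moved (T ! e) (drop (Suc e) T)) @ [foldl lift (T ! e) (drop (Suc e) T)]"

lemma right_keys_nth: "e < length T \<Longrightarrow> right_keys T ! e = foldl lift (T ! e) (drop (Suc e) T)"
proof (induction T arbitrary: e)
  case (Cons C T)
  then show ?case by (cases e) auto
qed simp

lemma length_right_keys[simp]: "length (right_keys T) = length T"
  by (induction T) auto

text \<open>The permutation whose flag equals the right keys of \<open>T\<close> passes through the
  rotated column and, by \<open>key_bounded_moved\<close>, still bounds the columns left behind;
  \<open>moved_inj\<close> recovers \<open>T\<close> from the result.\<close>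

lemma rotated_independent:
  assumes I: "down_closed n I" and F: "finite F" "\<And>T. T \<in> F \<Longrightarrow> standard_on n I ls T" and e: "e < length ls"
    and van: "\<And>v. v \<in> I \<Longrightarrow> vanishes n v (\<lambda>A. \<Sum>T\<in>F. a T * col_product (rotated e T) A)"
  shows "\<forall>T\<in>F. a T = 0"
proof -
  define r where "r T = take e T @ moved (T ! e) (drop (Suc e) T)" for T
  define c where "c T = foldl lift (T ! e) (drop (Suc e) T)" for T
  have rot: "rotated e T = r T @ [c T]" for T by (simp add: rotated_def r_def c_def)
  have T: "tab n T" "length T = length ls" "map card T = ls" if "T \<in> F" for T
    using F(2)[OF that] by (auto simp: standard_on_def dest: map_eq_imp_length_eq)
  have dec: "T = take e T @ (T ! e) # drop (Suc e) T" if "T \<in> F" for T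
    using id_take_nth_drop[of e T] T(2)[OF that] e by simp
  have t2: "tab n (take e T @ (T ! e) # drop (Suc e) T)" if "T \<in> F" for T
    using T(1)[OF that] dec[OF that] by simp
  have t1: "tab n ((T ! e) # drop (Suc e) T)" if "T \<in> F" for T
    using t2[OF that] unfolding tab_append by blast
  show ?thesis
  proof (rule independent_extend[OF standard_independence I F(1), where r = r and c = c])
    show "inj_on (\<lambda>T. (r T, c T)) F"
    proof (rule inj_onI)
      fix T U assume TU: "T \<in> F" "U \<in> F" "(r T, c T) = (r U, c U)"
      have "take e T = take e U \<and> moved (T ! e) (drop (Suc e) T) = moved (U ! e) (drop (Suc e) U)"
        using TU T(2) e by (simp add: r_def)
      moreover then have "T ! e = U ! e \<and> drop (Suc e) T = drop (Suc e) U"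
        using moved_inj[OF t1 t1] TU by (simp add: c_def)
      ultimately show "T = U" using dec TU by metis
    qed
    show "vanishes n v (\<lambda>A. \<Sum>T\<in>F. a T * (col_product (r T) A * col_minor (c T) A))" if "v \<in> I" for v
      using van[OF that] by (simp add: rot col_product_def)
    fix T assume TF: "T \<in> F"
    obtain v where v: "v \<in> I" "\<forall>S\<in>set (right_keys T). flag v (card S) = S"
      using standard_on_flag[OF I F(2)[OF TF]] .
    have "c T \<in> set (right_keys T)"
      using right_keys_nth[of e T] T(2)[OF TF] e by (metis c_def length_right_keys nth_mem)
    then have "flag v (card (c T)) = c T" using v(2) by blast
    moreover have "c T \<subseteq> {1..n}" "card (c T) = ls ! e"
      using foldl_lift[OF t1[OF TF]] T[OF TF] e by (auto simp: c_def)
    ultimately have "flag v (ls ! e) = c T \<and> c T \<subseteq> {1..n} \<and> card (c T) = ls ! e" by metis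
    moreover have "key_bounded (flag v) (r T)"
      unfolding r_def by (rule key_bounded_moved[OF t2[OF TF]])
        (use key_bounded_flag[OF v(2)] dec[OF TF] in simp)
    moreover have "tab n (r T)" unfolding r_def by (rule tab_append_moved[OF t2[OF TF]])
    moreover have "map card (r T) = take e ls @ drop (Suc e) ls"
      using tab_moved[OF t1[OF TF]] T(3)[OF TF] by (auto simp: r_def take_map drop_map)
    ultimately show "tab n (r T) \<and> map card (r T) = take e ls @ drop (Suc e) ls \<and> c T \<subseteq> {1..n} \<and> card (c T) = ls ! e \<and>
        (\<exists>v\<in>I. flag v (ls ! e) = c T \<and> key_bounded (flag v) (r T))"
      using v(1) by blast
  qed
qed

definition failing :: "(nat \<Rightarrow> nat set) \<Rightarrow> nat set list \<Rightarrow> nat \<Rightarrow> bool" where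
  "failing w T e \<longleftrightarrow> e < length T \<and> \<not> right_keys T ! e \<preceq> w (card (right_keys T ! e))"

text \<open>A tableau within the bound gets its length as value, so that it ranks after all genuine
  failures.\<close>

definition first_failure :: "(nat \<Rightarrow> nat set) \<Rightarrow> nat set list \<Rightarrow> nat" where
  "first_failure w T = (if key_bounded w T then length T else (LEAST e. failing w T e))"

definition adapted :: "(nat \<Rightarrow> nat set) \<Rightarrow> nat set list \<Rightarrow> nat set list" where
  "adapted w T = (if key_bounded w T then T else rotated (first_failure w T) T)"

lemma key_bounded_iff: "key_bounded w T \<longleftrightarrow> (\<forall>e. \<not> failing w T e)"
  by (fastforce simp: key_bounded_def failing_def in_set_conv_nth)

lemma first_failure: "\<not> key_bounded w T \<Longrightarrow> failing w T (first_failure w T)"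
proof -
  assume k: "\<not> key_bounded w T"
  then have "\<exists>e. failing w T e" by (simp add: key_bounded_iff)
  then have "failing w T (LEAST e. failing w T e)" by (rule LeastI_ex)
  then show ?thesis using k by (simp add: first_failure_def)
qed

lemma before_first_failure: "e < first_failure w T \<Longrightarrow> \<not> failing w T e"
  by (cases "key_bounded w T") (auto simp: first_failure_def key_bounded_iff[symmetric] dest: not_less_Least, simp add: key_bounded_iff)

lemma adapted_independent:
  assumes F: "finite F" "\<And>T. T \<in> F \<Longrightarrow> tab n T \<and> map card T = ls"
    and van: "\<And>A. (\<Sum>T\<in>F. a T * col_product (adapted w T) A) = 0"
  shows "\<forall>T\<in>F. a T = 0"
proof (rule ccontr)
  assume "\<not> ?thesis"
  then have ne: "{T \<in> F. a T \<noteq> 0} \<noteq> {}" by blast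
  have len: "length T = length ls" if "T \<in> F" for T using F(2)[OF that] by auto
  define e where "e = Max (first_failure w ` {T \<in> F. a T \<noteq> 0})"
  have "e \<in> first_failure w ` {T \<in> F. a T \<noteq> 0}" unfolding e_def using F(1) ne by (intro Max_in) auto
  then obtain T1 where T1: "T1 \<in> F" "a T1 \<noteq> 0" "first_failure w T1 = e" by auto
  have max: "a T = 0" if "T \<in> F" "e < first_failure w T" for T
  proof (rule ccontr)
    assume "a T \<noteq> 0"
    then have "first_failure w T \<le> e" unfolding e_def using F(1) that by (intro Max_ge) auto
    then show False using that by simp
  qed
  define G where "G = {T \<in> F. first_failure w T = e}"
  have G: "finite G" using F by (simp add: G_def)
  \<comment> \<open>Only the columns before \<open>e\<close> are constrained: every tableau in
    \<open>G\<close> obeys the bound there, while at \<open>e\<close>, if that is a column, it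
    fails.\<close>
  define I where "I = {v. v permutes {1..n} \<and> (\<forall>d<e. d < length ls \<longrightarrow> flag v (ls ! d) \<preceq> w (ls ! d))}"
  have lsn: "ls ! d \<le> n" if "d < length ls" for d
  proof -
    have d: "d < length T1" using that len[OF T1(1)] by simp
    then have "T1 ! d \<subseteq> {1..n}" using F(2)[OF T1(1)] nth_mem unfolding tab_def by blast
    then have "card (T1 ! d) \<le> card {1..n}" by (rule card_mono[OF finite_atLeastAtMost])
    moreover have "ls ! d = card (T1 ! d)" using nth_map[OF d, of card] F(2)[OF T1(1)] by metis
    ultimately show ?thesis by simp
  qed
  have I: "down_closed n I" unfolding down_closed_def
  proof (intro conjI ballI allI impI)
    fix v u assume v: "v \<in> I" and u: "u permutes {1..n} \<and> bruhat_le n u v"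
    have "flag u (ls ! d) \<preceq> w (ls ! d)" if d: "d < e" "d < length ls" for d
    proof -
      have "flag u (ls ! d) \<preceq> flag v (ls ! d)" using u lsn[OF d(2)] by (simp add: bruhat_le_def)
      moreover have "flag v (ls ! d) \<preceq> w (ls ! d)" using v d by (simp add: I_def)
      ultimately show ?thesis by (rule col_le_trans)
    qed
    then show "u \<in> I" using u by (simp add: I_def)
  qed (simp add: I_def)
  have cards: "card (right_keys T ! d) = ls ! d" if "T \<in> F" "d < length ls" for T d
    using right_keys_card[of n T] F(2)[OF that(1)] that(2) len[OF that(1)] by (metis length_right_keys nth_map)
  have st: "standard_on n I ls T" if T: "T \<in> G" for T
  proof -
    have TF: "T \<in> F" "first_failure w T = e" using T by (auto simp: G_def)
    obtain v where v: "v permutes {1..n}" "\<forall>S\<in>set (right_keys T). flag v (card S) = S"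
      using key_permutation F(2)[OF TF(1)] by metis
    have "flag v (ls ! d) \<preceq> w (ls ! d)" if d: "d < e" "d < length ls" for d
    proof -
      have "right_keys T ! d \<in> set (right_keys T)" using d len[OF TF(1)] by simp
      then have "flag v (ls ! d) = right_keys T ! d" using v(2) cards[OF TF(1) d(2)] by metis
      then show ?thesis
        using before_first_failure[of d w T] d TF len[OF TF(1)] cards[OF TF(1) d(2)] by (simp add: failing_def)
    qed
    then have "v \<in> I" using v by (simp add: I_def)
    then show ?thesis using key_bounded_flag[OF v(2)] F(2)[OF TF(1)] unfolding standard_on_def by blast
  qed
  have vanG: "vanishes n v (\<lambda>A. \<Sum>T\<in>G. a T * col_product (adapted w T) A)" if v: "v \<in> I" for v
    unfolding vanishes_def
  proof (intro allI impI)
    fix A assume A: "supported n v A"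
    have "(\<Sum>T\<in>G. a T * col_product (adapted w T) A) = (\<Sum>T\<in>F. a T * col_product (adapted w T) A)"
    proof (rule sum.mono_neutral_left)
      show "\<forall>T\<in>F - G. a T * col_product (adapted w T) A = 0"
      proof
        fix T assume T: "T \<in> F - G"
        then have "first_failure w T \<noteq> e" by (simp add: G_def)
        then consider "e < first_failure w T" | "first_failure w T < e" by linarith
        then show "a T * col_product (adapted w T) A = 0"
        proof cases
          case 1 then show ?thesis using max T by simp
        next
          case 2
          let ?d = "first_failure w T" let ?S = "right_keys T ! ?d"
          have TF: "T \<in> F" using T by simp
          have el: "e \<le> length ls"
          proof (cases "key_bounded w T1")
            case True
            then show ?thesis using T1(3) len[OF T1(1)] by (simp add: first_failure_def)
          next
            case False
            from first_failure[OF this] show ?thesis using T1(3) len[OF T1(1)] by (simp add: failing_def)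
          qed
          have nb: "\<not> key_bounded w T"
          proof
            assume "key_bounded w T"
            then show False using 2 el len[OF TF] by (simp add: first_failure_def)
          qed
          have d: "?d < length ls" using 2 el by simp
          have "\<not> ?S \<preceq> w (ls ! ?d)" using first_failure[OF nb] cards[OF TF d] by (simp add: failing_def)
          moreover have "flag v (ls ! ?d) \<preceq> w (ls ! ?d)" using v 2 d by (simp add: I_def)
          ultimately have nS: "\<not> ?S \<preceq> flag v (card ?S)" using col_le_trans cards[OF TF d] by auto
          have "?S \<in> set (right_keys T)" using d len[OF TF] by simp
          then have "?S \<subseteq> {1..n}" using right_keys_cols[of n T ?S] F(2)[OF TF] by blast
          then have "vanishes n v (col_minor ?S)"
            using col_minor_vanishes[OF _ _ _ nS, of n] cards[OF TF d] lsn[OF d] v colD(1)[of ?S n] by (simp add: I_def)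
          then have "col_minor ?S A = 0" using A by (simp add: vanishes_def)
          moreover have "adapted w T = (take ?d T @ moved (T ! ?d) (drop (Suc ?d) T)) @ [?S]"
            using nb right_keys_nth[of ?d T] d len[OF TF] by (simp add: adapted_def rotated_def)
          ultimately show ?thesis by (simp add: col_product_def)
        qed
      qed
    qed (use F in \<open>auto simp: G_def\<close>)
    then show "(\<Sum>T\<in>G. a T * col_product (adapted w T) A) = 0" using van by simp
  qed
  have "\<forall>T\<in>G. a T = 0"
  proof (cases "e < length ls")
    case True
    have "adapted w T = rotated e T" if "T \<in> G" for T
      using that True len[of T] unfolding adapted_def G_def by (auto simp: first_failure_def[of w T])
    then show ?thesis using rotated_independent[OF I G st True] vanG by (simp cong: sum.cong)
  next
    \<comment> \<open>Now \<open>G\<close> consists of the tableaux within the bound, whose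
      monomials were left unchanged.\<close>
    case False
    have "adapted w T = T" if "T \<in> G" for T
    proof (cases "key_bounded w T")
      case False
      from first_failure[OF this] show ?thesis using that \<open>\<not> e < length ls\<close> len[of T] by (simp add: G_def failing_def)
    qed (simp add: adapted_def)
    then have "vanishes n v (\<lambda>A. \<Sum>T\<in>G. a T * col_product T A)" if "v \<in> I" for v
      using vanG[OF that] by (simp cong: sum.cong)
    then show ?thesis using standard_independence[of n ls] I G st unfolding standard_independent_def by blast
  qed
  moreover have "T1 \<in> G" using T1 by (simp add: G_def)
  ultimately show False using T1 by simp
qed


section \<open>Straightening\<close>

lemma cnt_card_indices:
  assumes "finite A"
  shows "cnt A z = card {j. j < card A \<and> sorted_list_of_set A ! j \<le> z}"
proof -
  let ?c = "\<lambda>j. sorted_list_of_set A ! j"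
  have d: "distinct (sorted_list_of_set A)" "length (sorted_list_of_set A) = card A" "set (sorted_list_of_set A) = A"
    using assms by auto
  have "?c ` {0..<card A} = A" using nth_image[of "card A" "sorted_list_of_set A"] d by simp
  moreover have "{a \<in> ?c ` {0..<card A}. a \<le> z} = ?c ` {j. j < card A \<and> ?c j \<le> z}" by auto
  ultimately have "{a \<in> A. a \<le> z} = ?c ` {j. j < card A \<and> ?c j \<le> z}" by (simp only:)
  moreover have "inj_on ?c {j. j < card A \<and> ?c j \<le> z}"
    using d by (auto intro!: inj_onI simp: nth_eq_iff_index_eq)
  ultimately show ?thesis unfolding cnt_def by (simp add: card_image)
qed

lemma nth_le_iff_cnt:
  assumes "finite A" "i < card A"
  shows "sorted_list_of_set A ! i \<le> z \<longleftrightarrow> i < cnt A z"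
proof -
  let ?c = "\<lambda>j. sorted_list_of_set A ! j"
  let ?J = "{j. j < card A \<and> ?c j \<le> z}"
  have mono: "?c j \<le> ?c k" if "j \<le> k" "k < card A" for j k
    using sorted_nth_mono[of "sorted_list_of_set A" j k] that by simp
  show ?thesis
  proof
    assume "?c i \<le> z"
    then have "{0..i} \<subseteq> ?J" using mono[of _ i] assms by fastforce
    then have "card {0..i} \<le> card ?J" by (intro card_mono) auto
    then show "i < cnt A z" unfolding cnt_card_indices[OF assms(1)] by simp
  next
    assume c: "i < cnt A z"
    show "?c i \<le> z"
    proof (rule ccontr)
      assume "\<not> ?c i \<le> z"
      then have "j < i" if "j \<in> ?J" for j using mono[of i j] that by (cases "j < i") auto
      then have "?J \<subseteq> {0..<i}" by auto
      then have "card ?J \<le> card {0..<i}" by (intro card_mono) auto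
      then show False using c unfolding cnt_card_indices[OF assms(1)] by simp
    qed
  qed
qed

text \<open>Here counting functions meet the row condition of tableaux; the rows of \<open>A\<close>
  beyond \<open>card B\<close> are unconstrained.\<close>

lemma col_le_iff_nth:
  assumes "finite A" "finite B" "card B \<le> card A"
  shows "A \<preceq> B \<longleftrightarrow> (\<forall>i<card B. sorted_list_of_set A ! i \<le> sorted_list_of_set B ! i)"
proof
  assume le: "A \<preceq> B"
  show "\<forall>i<card B. sorted_list_of_set A ! i \<le> sorted_list_of_set B ! i"
  proof (intro allI impI)
    fix i assume i: "i < card B"
    have "i < cnt B (sorted_list_of_set B ! i)" using nth_le_iff_cnt[OF assms(2) i] by blast
    then have "i < cnt A (sorted_list_of_set B ! i)" using le unfolding col_le_def by (meson less_le_trans)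
    then show "sorted_list_of_set A ! i \<le> sorted_list_of_set B ! i" using nth_le_iff_cnt[OF assms(1)] i assms(3) by simp
  qed
next
  assume le: "\<forall>i<card B. sorted_list_of_set A ! i \<le> sorted_list_of_set B ! i"
  show "A \<preceq> B" unfolding col_le_def
  proof
    fix z
    show "cnt B z \<le> cnt A z"
    proof (cases "cnt B z")
      case (Suc i)
      have i: "i < card B" using cnt_le_card[OF assms(2), of z] Suc by simp
      have "sorted_list_of_set B ! i \<le> z" using nth_le_iff_cnt[OF assms(2) i] Suc by simp
      then have "sorted_list_of_set A ! i \<le> z" using le i by (meson order_trans)
      then show ?thesis using nth_le_iff_cnt[OF assms(1)] i assms(3) Suc by (metis Suc_leI less_le_trans)
    qed simp
  qed
qed

section \<open>Exchange relations between minors\<close>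

text \<open>Row labels may be unsorted or repeated, as happens after an exchange and before the
  columns are sorted again.\<close>

definition row_minor :: "(nat \<Rightarrow> nat \<Rightarrow> 'a :: comm_ring_1) \<Rightarrow> nat \<Rightarrow> (nat \<Rightarrow> nat) \<Rightarrow> 'a" where
  "row_minor x q rs = det (mat q q (\<lambda>(i, j). x (rs i) j))"

lemma row_minor_leibniz:
  "row_minor x q rs = (\<Sum>p | p permutes {0..<q}. signof p * (\<Prod>i = 0..<q. x (rs i) (p i)))"
  unfolding row_minor_def
  by (subst det_def', rule mat_carrier, rule sum.cong, simp)
    (auto intro!: prod.cong simp: permutes_in_image)

lemma row_minor_cong: "(\<And>i. i < q \<Longrightarrow> rs i = rs' i) \<Longrightarrow> row_minor x q rs = row_minor x q rs'"
  unfolding row_minor_def by (intro arg_cong[where f = det] cong_mat) auto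

lemma row_minor_permute:
  assumes "p permutes {0..<q}"
  shows "row_minor x q (rs \<circ> p) = signof p * row_minor x q rs"
proof -
  let ?A = "mat q q (\<lambda>(i, j). x (rs i) j)"
  have "mat q q (\<lambda>(i, j). x ((rs \<circ> p) i) j) = mat q q (\<lambda>(i, j). ?A $$ (p i, j))"
    using permutes_in_image[OF assms] by (intro cong_mat) auto
  then show ?thesis using det_permute_rows[of ?A q p] assms unfolding row_minor_def by simp
qed

lemma row_minor_swap:
  assumes "a < q" "b < q" "a \<noteq> b"
  shows "row_minor x q (rs \<circ> transpose a b) = - row_minor x q rs"
  using row_minor_permute[OF permutes_swap_id[of a "{0..<q}" b], of x rs] assms by (simp add: sign_swap_id)

lemma row_minor_not_inj:
  assumes "\<not> inj_on rs {0..<q}"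
  shows "row_minor x q rs = 0"
proof -
  obtain i j where ij: "i < q" "j < q" "i \<noteq> j" "rs i = rs j" using assms by (auto simp: inj_on_def)
  show ?thesis unfolding row_minor_def
    by (rule det_identical_rows[of _ q i j]) (use ij in \<open>auto intro!: eq_vecI\<close>)
qed

lemma row_minor_sorted:
  assumes "inj_on rs {0..<q}"
  shows "\<exists>e\<in>{1, -1}. row_minor x q rs = e * row_minor x q (\<lambda>i. sorted_list_of_set (rs ` {0..<q}) ! i)"
proof -
  let ?C = "rs ` {0..<q}" let ?c = "\<lambda>i. sorted_list_of_set ?C ! i"
  have d: "distinct (sorted_list_of_set ?C)" "length (sorted_list_of_set ?C) = q" "set (sorted_list_of_set ?C) = ?C"
    using card_image[OF assms] by auto
  have bc: "bij_betw ?c {0..<q} ?C"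
    using bij_betw_nth[OF d(1), of "{0..<q}" ?C] d by (simp add: atLeast0LessThan)
  have br: "bij_betw rs {0..<q} ?C" using assms by (simp add: bij_betw_def)
  define p where "p i = (if i \<in> {0..<q} then the_inv_into {0..<q} ?c (rs i) else i)" for i
  have bp: "bij_betw (the_inv_into {0..<q} ?c \<circ> rs) {0..<q} {0..<q}"
    by (rule bij_betw_trans[OF br bij_betw_the_inv_into[OF bc]])
  have "bij_betw p {0..<q} {0..<q}"
    by (rule bij_betw_cong[THEN iffD1, OF _ bp]) (simp add: p_def)
  then have p: "p permutes {0..<q}" by (rule bij_imp_permutes) (auto simp: p_def)
  have "rs i = (?c \<circ> p) i" if "i < q" for i
    using that f_the_inv_into_f_bij_betw[OF bc] by (simp add: p_def)
  then have "row_minor x q rs = row_minor x q (?c \<circ> p)" by (rule row_minor_cong)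
  also have "\<dots> = signof p * row_minor x q ?c" by (rule row_minor_permute[OF p])
  finally show ?thesis by (cases p rule: sign_cases) auto
qed

text \<open>The rows \<open>h 0, \<dots>, h k\<close> are distributed over a minor of size \<open>k = t + s\<close>, after \<open>t\<close> fixed rows,
  and a minor of size \<open>q\<close>, before \<open>q - t - 1\<close> fixed rows.\<close>

definition left_rows :: "nat \<Rightarrow> (nat \<Rightarrow> nat) \<Rightarrow> (nat \<Rightarrow> nat) \<Rightarrow> (nat \<Rightarrow> nat) \<Rightarrow> nat \<Rightarrow> nat" where
  "left_rows t b h \<sigma> i = (if i < t then b i else h (\<sigma> (i - t)))"

definition right_rows :: "nat \<Rightarrow> nat \<Rightarrow> (nat \<Rightarrow> nat) \<Rightarrow> (nat \<Rightarrow> nat) \<Rightarrow> (nat \<Rightarrow> nat) \<Rightarrow> nat \<Rightarrow> nat" where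
  "right_rows t s y h \<sigma> i = (if i \<le> t then h (\<sigma> (s + i)) else y i)"

lemma prod_split:
  "(\<Prod>i = 0..<t + s. f i) = (\<Prod>i = 0..<t. f i) * (\<Prod>i = 0..<s. f (t + i))" for f :: "nat \<Rightarrow> 'a :: comm_monoid_mult"
  using prod.atLeastLessThan_concat[of 0 t "t + s" f] prod.shift_bounds_nat_ivl[of f 0 t s] by (simp add: add.commute)

text \<open>Expand both minors. For fixed \<open>\<tau>\<close> and \<open>\<rho>\<close> the
  alternating sum over \<open>\<sigma>\<close> is a determinant of size \<open>k + 1\<close>, but
  only \<open>k\<close> matrix columns occur in it because \<open>q \<le> k\<close>; so two of its
  lines coincide.\<close>

lemma garnir:
  fixes x :: "nat \<Rightarrow> nat \<Rightarrow> 'a :: comm_ring_1"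
  assumes k: "k = t + s" and q: "t < q" "q \<le> k"
  shows "(\<Sum>\<sigma> | \<sigma> permutes {0..<Suc k}. signof \<sigma> * (row_minor x k (left_rows t b h \<sigma>) * row_minor x q (right_rows t s y h \<sigma>))) = 0"
proof -
  let ?P = "\<lambda>m::nat. {p. p permutes {0..<m}}"
  obtain r where r: "q = Suc t + r" using q by (metis less_iff_Suc_add add_Suc)
  define u where "u \<tau> \<rho> = signof \<tau> * signof \<rho> * (\<Prod>i = 0..<t. x (b i) (\<tau> i)) * (\<Prod>i = 0..<r. x (y (Suc t + i)) (\<rho> (Suc t + i)))"
    for \<tau> \<rho> :: "nat \<Rightarrow> nat"
  \<comment> \<open>The matrix column met by the row in slot \<open>l\<close> of \<open>h\<close>;
    slots below \<open>s\<close> belong to the left minor.\<close>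
  define col where "col \<tau> \<rho> l = (if l < s then \<tau> (t + l) else \<rho> (l - s))" for \<tau> \<rho> :: "nat \<Rightarrow> nat" and l
  define g where "g \<tau> \<rho> \<sigma> = (\<Prod>l = 0..<Suc k. x (h (\<sigma> l)) (col \<tau> \<rho> l))" for \<tau> \<rho> \<sigma> :: "nat \<Rightarrow> nat"
  have L: "row_minor x k (left_rows t b h \<sigma>) = (\<Sum>\<tau>\<in>?P k. signof \<tau> * (\<Prod>i = 0..<t. x (b i) (\<tau> i)) * (\<Prod>l = 0..<s. x (h (\<sigma> l)) (\<tau> (t + l))))" for \<sigma>
    unfolding row_minor_leibniz k prod_split by (simp add: left_rows_def mult.assoc)
  have R: "row_minor x q (right_rows t s y h \<sigma>) = (\<Sum>\<rho>\<in>?P q. signof \<rho> * (\<Prod>l = 0..<Suc t. x (h (\<sigma> (s + l))) (\<rho> l)) * (\<Prod>i = 0..<r. x (y (Suc t + i)) (\<rho> (Suc t + i))))" for \<sigma>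
    unfolding row_minor_leibniz r prod_split by (simp add: right_rows_def mult.assoc)
  have G: "g \<tau> \<rho> \<sigma> = (\<Prod>l = 0..<s. x (h (\<sigma> l)) (\<tau> (t + l))) * (\<Prod>l = 0..<Suc t. x (h (\<sigma> (s + l))) (\<rho> l))" for \<tau> \<rho> \<sigma>
    unfolding g_def k using prod_split[of "\<lambda>l. x (h (\<sigma> l)) (col \<tau> \<rho> l)" s "Suc t"] by (simp add: col_def add.commute)
  have "row_minor x k (left_rows t b h \<sigma>) * row_minor x q (right_rows t s y h \<sigma>) = (\<Sum>\<tau>\<in>?P k. \<Sum>\<rho>\<in>?P q. u \<tau> \<rho> * g \<tau> \<rho> \<sigma>)" for \<sigma>
    unfolding L R sum_product G u_def by (intro sum.cong refl) (simp only: ac_simps)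
  then have "(\<Sum>\<sigma>\<in>?P (Suc k). signof \<sigma> * (row_minor x k (left_rows t b h \<sigma>) * row_minor x q (right_rows t s y h \<sigma>)))
     = (\<Sum>\<sigma>\<in>?P (Suc k). \<Sum>\<tau>\<in>?P k. \<Sum>\<rho>\<in>?P q. u \<tau> \<rho> * (signof \<sigma> * g \<tau> \<rho> \<sigma>))"
    by (simp add: sum_distrib_left ac_simps)
  also have "\<dots> = (\<Sum>\<tau>\<in>?P k. \<Sum>\<sigma>\<in>?P (Suc k). \<Sum>\<rho>\<in>?P q. u \<tau> \<rho> * (signof \<sigma> * g \<tau> \<rho> \<sigma>))"
    by (rule sum.swap)
  also have "\<dots> = (\<Sum>\<tau>\<in>?P k. \<Sum>\<rho>\<in>?P q. \<Sum>\<sigma>\<in>?P (Suc k). u \<tau> \<rho> * (signof \<sigma> * g \<tau> \<rho> \<sigma>))"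
    by (intro sum.cong refl sum.swap)
  also have "\<dots> = (\<Sum>\<tau>\<in>?P k. \<Sum>\<rho>\<in>?P q. u \<tau> \<rho> * 0)"
  proof (intro sum.cong refl)
    fix \<tau> \<rho> assume tr: "\<tau> \<in> ?P k" "\<rho> \<in> ?P q"
    let ?M = "mat (Suc k) (Suc k) (\<lambda>(l, m). x (h m) (col \<tau> \<rho> l))"
    have "(\<Sum>\<sigma>\<in>?P (Suc k). signof \<sigma> * g \<tau> \<rho> \<sigma>) = det ?M"
      unfolding g_def by (subst det_def', rule mat_carrier, rule sum.cong, simp)
        (auto intro!: prod.cong simp: permutes_in_image simp del: prod.op_ivl_Suc)
    also have "det ?M = 0"
    proof -
      have "col \<tau> \<rho> l < k" if "l < Suc k" for l
      proof (cases "l < s")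
        case True
        then show ?thesis using permutes_in_image[of \<tau> "{0..<k}" "t + l"] tr k by (simp add: col_def)
      next
        case False
        show ?thesis
        proof (cases "l - s < q")
          case True
          then have "\<rho> (l - s) < q" using permutes_in_image[of \<rho> "{0..<q}" "l - s"] tr by simp
          then show ?thesis using False q by (simp add: col_def)
        next
          case lq: False
          then have "q \<le> t" using that k False by linarith
          then show ?thesis using q by simp
        qed
      qed
      then have "col \<tau> \<rho> ` {0..<Suc k} \<subseteq> {0..<k}" by auto
      then have "\<not> inj_on (col \<tau> \<rho>) {0..<Suc k}"
        using card_inj_on_le[of "col \<tau> \<rho>" "{0..<Suc k}" "{0..<k}"] by auto
      then obtain i j where ij: "i < Suc k" "j < Suc k" "i \<noteq> j" "col \<tau> \<rho> i = col \<tau> \<rho> j" by (auto simp: inj_on_def)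
      show ?thesis by (rule det_identical_rows[of _ "Suc k" i j]) (use ij in \<open>auto intro!: eq_vecI\<close>)
    qed
    finally show "(\<Sum>\<sigma>\<in>?P (Suc k). u \<tau> \<rho> * (signof \<sigma> * g \<tau> \<rho> \<sigma>)) = u \<tau> \<rho> * 0"
      by (simp add: sum_distrib_left[symmetric])
  qed
  finally show ?thesis by simp
qed

lemma sum_closed:
  assumes "0 \<in> W" "\<And>p q. p \<in> W \<Longrightarrow> q \<in> W \<Longrightarrow> p + q \<in> W" "\<And>x. x \<in> X \<Longrightarrow> f x \<in> W"
  shows "sum f X \<in> W"
  using assms(3) by (induction X rule: infinite_finite_induct) (auto intro: assms(1,2))

text \<open>A permutation that preserves the first \<open>s\<close> slots only reorders rows inside
  each minor, so with its sign it contributes the leading product again. That product occurs a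
  positive number of times, and \<open>W\<close> allows division by this number.\<close>

lemma garnir_leading:
  fixes x :: "nat \<Rightarrow> nat \<Rightarrow> 'a :: comm_ring_1"
  assumes W: "0 \<in> W" "\<And>p q. p \<in> W \<Longrightarrow> q \<in> W \<Longrightarrow> p + q \<in> W" "\<And>p. p \<in> W \<Longrightarrow> - p \<in> W"
      "\<And>c p. 0 < c \<Longrightarrow> of_nat c * p \<in> W \<Longrightarrow> p \<in> W"
    and k: "k = t + s" and q: "t < q" "q \<le> k"
    and mixed: "\<And>\<sigma>. \<sigma> permutes {0..<Suc k} \<Longrightarrow> \<exists>l<s. s \<le> \<sigma> l \<Longrightarrow>
      row_minor x k (left_rows t b h \<sigma>) * row_minor x q (right_rows t s y h \<sigma>) \<in> W"
  shows "row_minor x k (left_rows t b h id) * row_minor x q (right_rows t s y h id) \<in> W"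
proof -
  define \<Phi> where "\<Phi> \<sigma> = signof \<sigma> * (row_minor x k (left_rows t b h \<sigma>) * row_minor x q (right_rows t s y h \<sigma>))" for \<sigma>
  have perm: "permutation \<sigma>" if "\<sigma> permutes {0..<Suc k}" for \<sigma>
    using that permutation_permutes by blast
  have swap_left: "\<Phi> (\<sigma> \<circ> transpose a c) = \<Phi> \<sigma>" if \<sigma>: "\<sigma> permutes {0..<Suc k}" and ac: "a < s" "c < s" for \<sigma> a c
  proof (cases "a = c")
    case False
    have "left_rows t b h (\<sigma> \<circ> transpose a c) = left_rows t b h \<sigma> \<circ> transpose (t + a) (t + c)"
      by (rule ext) (auto simp: left_rows_def transpose_def)
    then have "row_minor x k (left_rows t b h (\<sigma> \<circ> transpose a c)) = - row_minor x k (left_rows t b h \<sigma>)"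
      using row_minor_swap[of "t + a" k "t + c" x "left_rows t b h \<sigma>"] ac k False by simp
    moreover have "row_minor x q (right_rows t s y h (\<sigma> \<circ> transpose a c)) = row_minor x q (right_rows t s y h \<sigma>)"
      by (rule row_minor_cong) (use ac in \<open>auto simp: right_rows_def transpose_def\<close>)
    moreover have "sign (\<sigma> \<circ> transpose a c) = - sign \<sigma>"
      using perm[OF \<sigma>] False by (subst sign_compose) (auto simp: sign_swap_id permutation_swap_id)
    ultimately show ?thesis by (simp add: \<Phi>_def)
  qed simp
  have swap_right: "\<Phi> (\<sigma> \<circ> transpose a c) = \<Phi> \<sigma>"
    if \<sigma>: "\<sigma> permutes {0..<Suc k}" and ac: "a \<in> {s..<Suc k}" "c \<in> {s..<Suc k}" for \<sigma> a c
  proof (cases "a = c")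
    case False
    have "row_minor x q (right_rows t s y h (\<sigma> \<circ> transpose a c)) = row_minor x q (right_rows t s y h \<sigma> \<circ> transpose (a - s) (c - s))"
      by (rule row_minor_cong) (use ac k in \<open>auto simp: right_rows_def transpose_def\<close>)
    also have "\<dots> = - row_minor x q (right_rows t s y h \<sigma>)"
      by (rule row_minor_swap) (use ac k q False in auto)
    finally have 1: "row_minor x q (right_rows t s y h (\<sigma> \<circ> transpose a c)) = - row_minor x q (right_rows t s y h \<sigma>)" .
    moreover have "row_minor x k (left_rows t b h (\<sigma> \<circ> transpose a c)) = row_minor x k (left_rows t b h \<sigma>)"
      by (rule row_minor_cong) (use ac k in \<open>auto simp: left_rows_def transpose_def\<close>)
    moreover have "sign (\<sigma> \<circ> transpose a c) = - sign \<sigma>"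
      using perm[OF \<sigma>] False by (subst sign_compose) (auto simp: sign_swap_id permutation_swap_id)
    ultimately show ?thesis by (simp add: \<Phi>_def)
  qed simp
  \<comment> \<open>Such a \<open>\<sigma>\<close> is the product of a permutation of the slots
    below \<open>s\<close> and one of the other slots; each is built up from transpositions.\<close>
  have pres: "\<Phi> \<sigma> = \<Phi> id" if \<sigma>: "\<sigma> permutes {0..<Suc k}" and low: "\<forall>l<s. \<sigma> l < s" for \<sigma>
  proof -
    define \<sigma>1 where "\<sigma>1 i = (if i < s then \<sigma> i else i)" for i
    define \<sigma>2 where "\<sigma>2 i = (if i < s then i else \<sigma> i)" for i
    have inj: "inj \<sigma>" using \<sigma> permutes_inj by auto
    have im: "\<sigma> ` {0..<s} = {0..<s}"
      by (rule endo_inj_surj) (use low inj in \<open>auto intro: inj_on_subset\<close>)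
    have "bij_betw \<sigma>1 {0..<s} {0..<s}"
      unfolding bij_betw_def using im inj by (auto simp: \<sigma>1_def inj_on_def)
    then have p1: "\<sigma>1 permutes {0..<s}" by (rule bij_imp_permutes) (simp add: \<sigma>1_def)
    have "\<sigma> ` ({0..<Suc k} - {0..<s}) = {0..<Suc k} - {0..<s}"
      using image_set_diff[OF inj, of "{0..<Suc k}" "{0..<s}"] im permutes_image[OF \<sigma>] by simp
    moreover have "{0..<Suc k} - {0..<s} = {s..<Suc k}" by auto
    ultimately have im2: "\<sigma> ` {s..<Suc k} = {s..<Suc k}" by simp
    have "bij_betw \<sigma>2 {s..<Suc k} {s..<Suc k}"
      unfolding bij_betw_def using im2 inj by (auto simp: \<sigma>2_def inj_on_def)
    then have p2: "\<sigma>2 permutes {s..<Suc k}"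
      by (rule bij_imp_permutes) (use permutes_not_in[OF \<sigma>] in \<open>auto simp: \<sigma>2_def\<close>)
    have comp: "\<sigma> = \<sigma>1 \<circ> \<sigma>2"
    proof
      fix i show "\<sigma> i = (\<sigma>1 \<circ> \<sigma>2) i"
      proof (cases "i \<in> {s..<Suc k}")
        case True
        then have "\<sigma> i \<in> {s..<Suc k}" using im2 by blast
        then show ?thesis using True by (simp add: \<sigma>1_def \<sigma>2_def)
      next
        case False
        then show ?thesis using permutes_not_in[OF \<sigma>, of i] k by (auto simp: \<sigma>1_def \<sigma>2_def)
      qed
    qed
    have ext1: "p permutes {0..<s} \<Longrightarrow> p permutes {0..<Suc k}" for p
      by (rule permutes_subset) (use k in auto)
    have ext2: "p permutes {s..<Suc k} \<Longrightarrow> p permutes {0..<Suc k}" for p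
      by (rule permutes_subset) (use k in auto)
    have 1: "\<Phi> \<sigma>1 = \<Phi> id" using finite_atLeastLessThan p1
    proof (induction rule: permutes_rev_induct)
      case (swap a c p)
      then have p: "p permutes {0..<s}" "a < s" "c < s" by auto
      from swap_left[OF ext1[OF p(1)] p(2,3)] swap.IH show ?case by (rule trans)
    qed simp
    have 2: "\<Phi> (\<sigma>1 \<circ> \<sigma>2) = \<Phi> \<sigma>1" using finite_atLeastLessThan p2
    proof (induction rule: permutes_rev_induct)
      case (swap a c p)
      then have "p permutes {s..<Suc k}" by simp
      then have "(\<sigma>1 \<circ> p) permutes {0..<Suc k}" using ext1[OF p1] ext2 permutes_compose by blast
      from swap_right[OF this swap.hyps(1,2)] swap.IH show ?case unfolding comp_assoc by (rule trans)
    qed simp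
    show ?thesis using 1 2 comp by simp
  qed
  let ?P = "{\<sigma>. \<sigma> permutes {0..<Suc k}}"
  let ?A = "{\<sigma> \<in> ?P. \<forall>l<s. \<sigma> l < s}" and ?B = "{\<sigma> \<in> ?P. \<exists>l<s. s \<le> \<sigma> l}"
  have fin: "finite ?P" by (rule finite_permutations) simp
  have PAB: "?P = ?A \<union> ?B" using leI by blast
  have dj: "?A \<inter> ?B = {}" using leD by blast
  have finAB: "finite ?A" "finite ?B" using fin by simp_all
  have "(\<Sum>\<sigma>\<in>?P. \<Phi> \<sigma>) = 0" unfolding \<Phi>_def by (rule garnir[OF k q])
  then have "(\<Sum>\<sigma>\<in>?A \<union> ?B. \<Phi> \<sigma>) = 0" using PAB by metis
  then have "(\<Sum>\<sigma>\<in>?A. \<Phi> \<sigma>) + (\<Sum>\<sigma>\<in>?B. \<Phi> \<sigma>) = 0"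
    unfolding sum.union_disjoint[OF finAB dj] .
  moreover have "(\<Sum>\<sigma>\<in>?A. \<Phi> \<sigma>) = (\<Sum>\<sigma>\<in>?A. \<Phi> id)" by (rule sum.cong[OF refl]) (use pres in blast)
  ultimately have eq: "of_nat (card ?A) * \<Phi> id = - (\<Sum>\<sigma>\<in>?B. \<Phi> \<sigma>)"
    unfolding eq_neg_iff_add_eq_0 sum_constant by metis
  have inB: "\<Phi> \<sigma> \<in> W" if "\<sigma> \<in> ?B" for \<sigma>
  proof -
    have "row_minor x k (left_rows t b h \<sigma>) * row_minor x q (right_rows t s y h \<sigma>) \<in> W"
      using mixed that by blast
    then show ?thesis using W(3) unfolding \<Phi>_def by (cases \<sigma> rule: sign_cases) simp_all
  qed
  have "(\<Sum>\<sigma>\<in>?B. \<Phi> \<sigma>) \<in> W"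
    by (rule sum_closed[OF W(1,2) inB])
  then have "of_nat (card ?A) * \<Phi> id \<in> W" unfolding eq by (rule W(3))
  moreover have "id \<in> ?A" using permutes_id by simp
  then have "0 < card ?A" using finAB(1) card_gt_0_iff by blast
  ultimately have "\<Phi> id \<in> W" using W(4) by blast
  then show ?thesis by (simp add: \<Phi>_def)
qed

section \<open>Straightening of products of minors\<close>

text \<open>This type-based vector space supplies the dimension arguments;
  \<open>poly_space_span\<close> links it with the record-based spaces of the definitions.\<close>

lemma cpoly_vector_space: "vector_space (\<lambda>(a::complex) (p::cpoly). Poly_Mapping.single 0 a * p)"
  by unfold_locales (simp_all add: algebra_simps single_add mult_single)

interpretation cpoly: vector_space "\<lambda>(a::complex) (p::cpoly). Poly_Mapping.single 0 a * p"
  by (rule cpoly_vector_space)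

text \<open>Matrix columns are numbered from 0 here and from 1 in \<^const>\<open>indet\<close>.\<close>

definition poly_var :: "nat \<Rightarrow> nat \<Rightarrow> cpoly" where
  "poly_var i j = indet i (Suc j)"

definition poly_col :: "nat set \<Rightarrow> cpoly" where
  "poly_col C = row_minor poly_var (card C) (\<lambda>i. sorted_list_of_set C ! i)"

definition poly_product :: "nat set list \<Rightarrow> cpoly" where
  "poly_product Cs = (\<Prod>C\<leftarrow>Cs. poly_col C)"

lemma of_nat_cpoly: "(of_nat c :: cpoly) = Poly_Mapping.single 0 (of_nat c)"
  by (induction c) (simp_all add: single_add)

lemma row_minor_poly_col:
  "row_minor poly_var q rs = 0 \<or> inj_on rs {0..<q} \<and>
     (row_minor poly_var q rs = poly_col (rs ` {0..<q}) \<or> row_minor poly_var q rs = - poly_col (rs ` {0..<q}))"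
proof (cases "inj_on rs {0..<q}")
  case True
  then show ?thesis using row_minor_sorted[OF True, of poly_var] card_image[OF True] by (auto simp: poly_col_def)
qed (simp add: row_minor_not_inj)

lemma sum_split:
  "(\<Sum>i = 0..<t + s. f i) = (\<Sum>i = 0..<t. f i) + (\<Sum>i = 0..<s. f (t + i))" for f :: "nat \<Rightarrow> 'a :: comm_monoid_add"
  using sum.atLeastLessThan_concat[of 0 t "t + s" f] sum.shift_bounds_nat_ivl[of f 0 t s] by (simp add: add.commute)

text \<open>The values above \<open>c\<close> start in the left slots and the others in the right
  ones. Any mixing brings some values above \<open>c\<close> into the right minor in exchange for
  equally many values of at most \<open>c\<close>.\<close>

lemma mixed_row_sums:
  fixes h b y :: "nat \<Rightarrow> nat"
  assumes k: "k = t + s" and q: "t < q" "q \<le> k" and \<sigma>: "\<sigma> permutes {0..<Suc k}" and l: "l < s" "s \<le> \<sigma> l"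
    and hi: "\<And>m. m < s \<Longrightarrow> c < h m" and lo: "\<And>m. s \<le> m \<Longrightarrow> m < Suc k \<Longrightarrow> h m \<le> c"
  shows "(\<Sum>i = 0..<q. right_rows t s y h id i) < (\<Sum>i = 0..<q. right_rows t s y h \<sigma> i)"
    and "(\<Sum>i = 0..<k. left_rows t b h id i) + (\<Sum>i = 0..<q. right_rows t s y h id i)
       = (\<Sum>i = 0..<k. left_rows t b h \<sigma> i) + (\<Sum>i = 0..<q. right_rows t s y h \<sigma> i)"
proof -
  obtain r where r: "q = Suc t + r" using q by (metis less_iff_Suc_add add_Suc)
  have R: "(\<Sum>i = 0..<q. right_rows t s y h \<sigma> i) = (\<Sum>i = 0..<Suc t. h (\<sigma> (s + i))) + (\<Sum>i = 0..<r. y (Suc t + i))" for \<sigma>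
    unfolding r sum_split by (simp add: right_rows_def del: sum.op_ivl_Suc)
  have L: "(\<Sum>i = 0..<k. left_rows t b h \<sigma> i) = (\<Sum>i = 0..<t. b i) + (\<Sum>i = 0..<s. h (\<sigma> i))" for \<sigma>
    unfolding k sum_split by (simp add: left_rows_def)
  have T: "(\<Sum>i = 0..<s. h (\<sigma> i)) + (\<Sum>i = 0..<Suc t. h (\<sigma> (s + i))) = (\<Sum>i = 0..<Suc k. h (\<sigma> i))" for \<sigma>
  proof -
    have "Suc k = s + Suc t" using k by simp
    then show ?thesis by (simp only: sum_split)
  qed
  have all: "(\<Sum>i = 0..<Suc k. h (\<sigma> i)) = (\<Sum>i = 0..<Suc k. h (id i))"
    using sum.permute[OF \<sigma>, of h] by (simp only: comp_def id_apply)
  show "(\<Sum>i = 0..<k. left_rows t b h id i) + (\<Sum>i = 0..<q. right_rows t s y h id i)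
       = (\<Sum>i = 0..<k. left_rows t b h \<sigma> i) + (\<Sum>i = 0..<q. right_rows t s y h \<sigma> i)"
    unfolding L R using T[of \<sigma>] T[of id] all by linarith
  define Z where "Z = {s..<Suc k}"
  define X where "X = \<sigma> ` Z"
  have inj: "inj \<sigma>" using \<sigma> permutes_inj by auto
  have Xsub: "X \<subseteq> {0..<Suc k}"
    using image_mono[of Z "{0..<Suc k}" \<sigma>] permutes_image[OF \<sigma>] by (simp add: X_def Z_def)
  have fin: "finite X" "finite Z" by (auto simp: X_def Z_def)
  have cX: "card X = card Z" unfolding X_def using inj by (simp add: card_image inj_on_subset)
  have lZ: "\<sigma> l \<in> Z - X"
  proof -
    have "\<sigma> l \<in> \<sigma> ` {0..<Suc k}" using l k by simp
    then have "\<sigma> l \<in> Z" using l permutes_image[OF \<sigma>] by (simp add: Z_def)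
    moreover have "\<sigma> l \<notin> X" using l inj_image_mem_iff[OF inj, of l Z] by (simp add: X_def Z_def)
    ultimately show ?thesis by blast
  qed
  have card_diff: "card (X - Z) = card (Z - X)"
    using card_Diff_subset_Int[of X Z] card_Diff_subset_Int[of Z X] fin cX by (simp add: Int_commute)
  have shift: "(\<Sum>i = 0..<Suc t. f (s + i)) = sum f Z" for f :: "nat \<Rightarrow> nat"
  proof -
    have "{s..<Suc k} = {0 + s..<Suc t + s}" using k by simp
    then show ?thesis using sum.shift_bounds_nat_ivl[of f 0 s "Suc t"] unfolding Z_def by (simp only: add.commute)
  qed
  have "sum h Z = sum h (X \<inter> Z) + sum h (Z - X)"
    using sum.Int_Diff[OF fin(2), of h X] by (simp add: Int_commute)
  moreover have "sum h X = sum h (X \<inter> Z) + sum h (X - Z)"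
    using sum.Int_Diff[OF fin(1), of h Z] .
  moreover have "sum h (Z - X) < sum h (X - Z)"
  proof -
    have "sum h (Z - X) \<le> of_nat (card (Z - X)) * c"
      by (rule sum_bounded_above) (use lo in \<open>auto simp: Z_def\<close>)
    also have "\<dots> < of_nat (card (X - Z)) * Suc c"
    proof -
      have "0 < card (Z - X)" using lZ fin card_gt_0_iff by blast
      then show ?thesis using card_diff by simp
    qed
    also have "\<dots> \<le> sum h (X - Z)"
      by (rule sum_bounded_below) (use hi Xsub in \<open>auto simp: Z_def Suc_le_eq\<close>)
    finally show ?thesis .
  qed
  moreover have "sum h X = (\<Sum>i\<in>Z. h (\<sigma> i))" unfolding X_def using inj by (simp add: sum.reindex inj_on_subset)
  ultimately have "sum h Z < (\<Sum>i\<in>Z. h (\<sigma> i))" by linarith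
  then show "(\<Sum>i = 0..<q. right_rows t s y h id i) < (\<Sum>i = 0..<q. right_rows t s y h \<sigma> i)"
    unfolding R using shift[of "\<lambda>i. h (\<sigma> i)"] shift[of h] by simp
qed

text \<open>Column sums weighted by position: shifting content to the right raises the
  weight.\<close>

fun weight_from :: "nat \<Rightarrow> nat set list \<Rightarrow> nat" where
  "weight_from d [] = 0"
| "weight_from d (C # Cs) = d * \<Sum>C + weight_from (Suc d) Cs"

lemma weight_from_append: "weight_from d (Xs @ Ys) = weight_from d Xs + weight_from (d + length Xs) Ys"
  by (induction Xs arbitrary: d) auto

lemma weight_from_le:
  "(\<forall>C\<in>set Cs. C \<subseteq> {1..n}) \<Longrightarrow> weight_from d Cs \<le> length Cs * ((d + length Cs) * \<Sum>{1..n})"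
proof (induction Cs arbitrary: d)
  case (Cons C Cs)
  have "\<Sum>C \<le> \<Sum>{1..n}" using Cons.prems by (intro sum_mono2) auto
  then have "d * \<Sum>C \<le> (d + length (C # Cs)) * \<Sum>{1..n}" by (intro mult_le_mono) auto
  moreover have "weight_from (Suc d) Cs \<le> length Cs * ((Suc d + length Cs) * \<Sum>{1..n})"
    by (rule Cons.IH) (use Cons.prems in simp)
  ultimately show ?case by simp
qed simp

lemma exchange_columns:
  assumes B: "B \<subseteq> {1..n}" and Y: "Y \<subseteq> {1..n}" and card: "card Y \<le> card B" and nle: "\<not> B \<preceq> Y"
    and W: "cpoly.subspace W"
    and W': "\<And>B' Y'. B' \<subseteq> {1..n} \<Longrightarrow> Y' \<subseteq> {1..n} \<Longrightarrow> card B' = card B \<Longrightarrow> card Y' = card Y \<Longrightarrow>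
      \<Sum>B' + \<Sum>Y' = \<Sum>B + \<Sum>Y \<Longrightarrow> \<Sum>Y < \<Sum>Y' \<Longrightarrow> poly_col B' * poly_col Y' \<in> W"
  shows "poly_col B * poly_col Y \<in> W"
proof -
  let ?k = "card B" and ?q = "card Y"
  define b where "b i = sorted_list_of_set B ! i" for i
  define y where "y i = sorted_list_of_set Y ! i" for i
  have fin: "finite B" "finite Y" using B Y colD by auto
  obtain t where t: "t < ?q" "y t < b t"
    using nle col_le_iff_nth[OF fin card] by (auto simp: b_def y_def not_le)
  define s where "s = ?k - t"
  have k: "?k = t + s" "0 < s" using t card by (auto simp: s_def)
  \<comment> \<open>At the violating row \<open>t\<close>, take the entries of \<open>B\<close> from
    row \<open>t\<close> downwards and those of \<open>Y\<close> down to row \<open>t\<close>. These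
    are \<open>?k + 1\<close> entries, one more than a column of the length of \<open>B\<close> can
    hold, and \<open>y t\<close> separates the two groups.\<close>
  define h where "h m = (if m < s then b (m + t) else y (m - s))" for m
  have bmono: "b i \<le> b j" if "i \<le> j" "j < ?k" for i j
    using sorted_nth_mono[of "sorted_list_of_set B" i j] that by (simp add: b_def)
  have ymono: "y i \<le> y j" if "i \<le> j" "j < ?q" for i j
    using sorted_nth_mono[of "sorted_list_of_set Y" i j] that by (simp add: y_def)
  have bB: "b i \<in> B" if "i < ?k" for i using that fin nth_mem[of i "sorted_list_of_set B"] by (simp add: b_def)
  have yY: "y i \<in> Y" if "i < ?q" for i using that fin nth_mem[of i "sorted_list_of_set Y"] by (simp add: y_def)
  have hi: "y t < h m" if "m < s" for m
    using bmono[of t "m + t"] that k t by (simp add: h_def)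
  have lo: "h m \<le> y t" if "s \<le> m" "m < Suc ?k" for m
    using ymono[of "m - s" t] that k t by (simp add: h_def)
  have hn: "h m \<in> {1..n}" if "m < Suc ?k" for m
  proof (cases "m < s")
    case True
    then show ?thesis using bB[of "m + t"] k B by (auto simp: h_def)
  next
    case False
    then have "y (m - s) \<in> Y" using yY[of "m - s"] that k t by simp
    then show ?thesis using False Y by (auto simp: h_def)
  qed
  have Lid: "left_rows t b h id i = b i" if "i < ?k" for i using that k by (auto simp: left_rows_def h_def)
  have Rid: "right_rows t s y h id i = y i" if "i < ?q" for i using that k by (auto simp: right_rows_def h_def)
  have sums: "(\<Sum>i = 0..<?k. b i) = \<Sum>B" "(\<Sum>i = 0..<?q. y i) = \<Sum>Y"
  proof -
    have "bij_betw b {0..<?k} B" "bij_betw y {0..<?q} Y"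
      unfolding b_def y_def using bij_betw_nth[of "sorted_list_of_set B" "{0..<?k}" B] bij_betw_nth[of "sorted_list_of_set Y" "{0..<?q}" Y] fin
      by (auto simp: atLeast0LessThan)
    then show "(\<Sum>i = 0..<?k. b i) = \<Sum>B" "(\<Sum>i = 0..<?q. y i) = \<Sum>Y"
      using sum.reindex_bij_betw[of _ _ _ "\<lambda>x. x"] by blast+
  qed
  have "row_minor poly_var ?k (left_rows t b h id) * row_minor poly_var ?q (right_rows t s y h id) \<in> W"
  proof (rule garnir_leading[OF _ _ _ _ k(1) t(1) card])
    show "0 \<in> W" using W by (rule cpoly.subspace_0)
    show "\<And>p q. p \<in> W \<Longrightarrow> q \<in> W \<Longrightarrow> p + q \<in> W" using W by (rule cpoly.subspace_add)
    show neg: "\<And>p. p \<in> W \<Longrightarrow> - p \<in> W" using W by (rule cpoly.subspace_neg)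
    show "p \<in> W" if "0 < c" "of_nat c * p \<in> W" for c p
    proof -
      have "Poly_Mapping.single 0 (1 / of_nat c) * (of_nat c * p) \<in> W"
        using cpoly.subspace_scale[OF W that(2)] .
      moreover have "Poly_Mapping.single 0 (1 / complex_of_nat c) * (of_nat c :: cpoly) = 1"
        using that(1) by (simp only: of_nat_cpoly mult_single) simp
      ultimately show ?thesis by (simp add: mult.assoc[symmetric])
    qed
    fix \<sigma> assume \<sigma>: "\<sigma> permutes {0..<Suc ?k}" and ex: "\<exists>l<s. s \<le> \<sigma> l"
    then obtain l where l: "l < s" "s \<le> \<sigma> l" by blast
    let ?L = "left_rows t b h \<sigma>" and ?R = "right_rows t s y h \<sigma>"
    have \<sigma>k: "\<sigma> m < Suc ?k" if "m < Suc ?k" for m using permutes_in_image[OF \<sigma>, of m] that by simp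
    have Ln: "?L ` {0..<?k} \<subseteq> {1..n}"
    proof
      fix z assume "z \<in> ?L ` {0..<?k}"
      then obtain i where i: "i < ?k" "z = ?L i" by auto
      then show "z \<in> {1..n}" using hn[OF \<sigma>k[of "i - t"]] bB[OF i(1)] B by (auto simp: left_rows_def)
    qed
    have Rn: "?R ` {0..<?q} \<subseteq> {1..n}"
    proof
      fix z assume "z \<in> ?R ` {0..<?q}"
      then obtain i where i: "i < ?q" "z = ?R i" by auto
      then show "z \<in> {1..n}" using hn[OF \<sigma>k[of "s + i"]] yY[OF i(1)] Y k by (auto simp: right_rows_def)
    qed
    show "row_minor poly_var ?k ?L * row_minor poly_var ?q ?R \<in> W"
    proof (cases "row_minor poly_var ?k ?L = 0 \<or> row_minor poly_var ?q ?R = 0")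
      case True
      then show ?thesis using cpoly.subspace_0[OF W] by auto
    next
      case False
      let ?B = "?L ` {0..<?k}" and ?Y = "?R ` {0..<?q}"
      have inj: "inj_on ?L {0..<?k}" "inj_on ?R {0..<?q}"
        and val: "row_minor poly_var ?k ?L = poly_col ?B \<or> row_minor poly_var ?k ?L = - poly_col ?B"
          "row_minor poly_var ?q ?R = poly_col ?Y \<or> row_minor poly_var ?q ?R = - poly_col ?Y"
        using row_minor_poly_col[of ?k ?L] row_minor_poly_col[of ?q ?R] False by auto
      have "\<Sum>?B = (\<Sum>i = 0..<?k. ?L i)" "\<Sum>?Y = (\<Sum>i = 0..<?q. ?R i)"
        using sum.reindex[OF inj(1), of "\<lambda>x. x"] sum.reindex[OF inj(2), of "\<lambda>x. x"] by (simp_all add: comp_def)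
      moreover have "(\<Sum>i = 0..<?k. left_rows t b h id i) = \<Sum>B" "(\<Sum>i = 0..<?q. right_rows t s y h id i) = \<Sum>Y"
        using Lid Rid sums by simp_all
      ultimately have "\<Sum>?B + \<Sum>?Y = \<Sum>B + \<Sum>Y" "\<Sum>Y < \<Sum>?Y"
        using mixed_row_sums(1)[where h = h and y = y, OF k(1) t(1) card \<sigma> l hi lo]
          mixed_row_sums(2)[where h = h and b = b and y = y, OF k(1) t(1) card \<sigma> l hi lo] by linarith+
      then have "poly_col ?B * poly_col ?Y \<in> W"
        using W'[OF Ln Rn] inj by (simp add: card_image)
      then show ?thesis using val cpoly.subspace_neg[OF W] by auto
    qed
  qed
  moreover have "row_minor poly_var ?k (left_rows t b h id) = poly_col B"
    unfolding poly_col_def by (rule row_minor_cong) (use Lid in \<open>simp add: b_def\<close>)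
  moreover have "row_minor poly_var ?q (right_rows t s y h id) = poly_col Y"
    unfolding poly_col_def by (rule row_minor_cong) (use Rid in \<open>simp add: y_def\<close>)
  ultimately show ?thesis by simp
qed

text \<open>For a fixed shape the weight is bounded, and exchanging at a violating adjacent pair
  produces only terms of larger weight; so the distance to the bound is the induction
  measure.\<close>

lemma straightening:
  assumes ls: "sorted_wrt (\<ge>) ls"
    and Cs: "\<forall>C\<in>set Cs. C \<subseteq> {1..n}" "map card Cs = ls"
  shows "poly_product Cs \<in> cpoly.span (poly_product ` {T. tab n T \<and> map card T = ls})"
  using Cs
proof (induction "length ls * (length ls * \<Sum>{1..n}) - weight_from 0 Cs" arbitrary: Cs rule: less_induct)
  case less
  let ?S = "cpoly.span (poly_product ` {T. tab n T \<and> map card T = ls})"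
  show ?case
  proof (cases "sorted_wrt (\<preceq>) Cs")
    case True
    then have "tab n Cs" using less.prems by (simp add: tab_def)
    then show ?thesis using less.prems by (intro cpoly.span_base) auto
  next
    case False
    then obtain i where i: "Suc i < length Cs" "\<not> Cs ! i \<preceq> Cs ! Suc i"
      using sorted_wrt_iff_nth_Suc_transp[OF transp_col_le] by blast
    define B Y where "B = Cs ! i" and "Y = Cs ! Suc i"
    define Xs Zs where "Xs = take i Cs" and "Zs = drop (Suc (Suc i)) Cs"
    have dec: "Cs = Xs @ B # Y # Zs"
      unfolding Xs_def Zs_def B_def Y_def using i by (metis Cons_nth_drop_Suc Suc_lessD append_take_drop_id)
    have nle: "\<not> B \<preceq> Y" using i by (simp add: B_def Y_def)
    have BY: "B \<subseteq> {1..n}" "Y \<subseteq> {1..n}" using less.prems(1) dec by auto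
    have ls': "ls = map card Xs @ card B # card Y # map card Zs" using less.prems(2) dec by auto
    have card: "card Y \<le> card B" using ls unfolding ls' by (simp add: sorted_wrt_append)
    let ?rest = "poly_product Xs * poly_product Zs"
    have prod: "poly_product (Xs @ B' # Y' # Zs) = poly_col B' * poly_col Y' * ?rest" for B' Y'
      by (simp add: poly_product_def ac_simps)
    \<comment> \<open>The exchange concerns two columns only; the polynomials that become good after
      multiplication by the other columns form a subspace.\<close>
    let ?W = "{p. p * ?rest \<in> ?S}"
    have "cpoly.subspace ?W"
      by (rule cpoly.subspaceI)
        (auto simp: distrib_right mult.assoc intro: cpoly.span_zero cpoly.span_add cpoly.span_scale)
    then have "poly_col B * poly_col Y \<in> ?W"
    proof (rule exchange_columns[OF BY card nle])
      fix B' Y' assume new: "B' \<subseteq> {1..n}" "Y' \<subseteq> {1..n}" "card B' = card B" "card Y' = card Y"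
        "\<Sum>B' + \<Sum>Y' = \<Sum>B + \<Sum>Y" "\<Sum>Y < \<Sum>Y'"
      let ?Cs = "Xs @ B' # Y' # Zs"
      have sub: "\<forall>C\<in>set ?Cs. C \<subseteq> {1..n}" and m: "map card ?Cs = ls"
        using less.prems(1) new by (auto simp: dec ls')
      have "length Xs * (\<Sum>B' + \<Sum>Y') = length Xs * (\<Sum>B + \<Sum>Y)" using new(5) by simp
      then have "weight_from 0 Cs < weight_from 0 ?Cs"
        using new(6) unfolding dec weight_from_append by (simp add: distrib_left)
      moreover have "weight_from 0 ?Cs \<le> length ls * (length ls * \<Sum>{1..n})"
        using weight_from_le[OF sub, of 0] m by (metis add_0 length_map)
      ultimately have "length ls * (length ls * \<Sum>{1..n}) - weight_from 0 ?Cs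
          < length ls * (length ls * \<Sum>{1..n}) - weight_from 0 Cs" by linarith
      then have "poly_product ?Cs \<in> ?S" using sub m by (rule less.hyps)
      then show "poly_col B' * poly_col Y' \<in> ?W" by (simp add: prod)
    qed
    then show ?thesis using prod[of B Y] dec by simp
  qed
qed


section \<open>Scanning computes right keys\<close>

text \<open>The lift carried out in place: a matched \<open>x\<close> is replaced by its partner and
  an unmatched one keeps its slot, so that slot \<open>k\<close> can follow round \<open>k\<close>
  of a scan.\<close>

fun greedy_new :: "nat list \<Rightarrow> nat list \<Rightarrow> nat list" where
  "greedy_new (x # xs) (y # ys) = (if x \<le> y then y # greedy_new xs ys else x # greedy_new xs (y # ys))"
| "greedy_new xs ys = xs"

fun greedy_rest :: "nat list \<Rightarrow> nat list \<Rightarrow> nat list" where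
  "greedy_rest (x # xs) (y # ys) = (if x \<le> y then greedy_rest xs ys else greedy_rest xs (y # ys))"
| "greedy_rest xs ys = ys"

lemma greedy_new_Nil[simp]: "greedy_new xs [] = xs" by (cases xs) auto
lemma greedy_rest_Nil[simp]: "greedy_rest xs [] = []" by (cases xs) auto

lemma length_greedy_new[simp]: "length (greedy_new xs ys) = length xs"
  by (induction xs ys rule: greedy_new.induct) auto

lemma length_greedy_rest: "length (greedy_matched xs ys) + length (greedy_rest xs ys) = length ys"
  by (induction xs ys rule: greedy_matched.induct) auto

lemma greedy_new_subset: "set (greedy_new xs ys) \<subseteq> set xs \<union> set ys"
  by (induction xs ys rule: greedy_new.induct) auto

lemma set_greedy_new:
  assumes "distinct xs" "distinct ys"
  shows "set (greedy_new xs ys) \<union> set (greedy_rest xs ys) = set ys \<union> (set xs - set (greedy_matched xs ys))"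
  using assms
proof (induction xs ys rule: greedy_matched.induct)
  case (1 x xs y ys)
  have sub: "set (greedy_matched xs zs) \<subseteq> set xs" for zs by (rule greedy_matched_subset)
  show ?case
  proof (cases "x \<le> y")
    case True
    then show ?thesis using 1 sub[of ys] by auto
  next
    case False
    then have "set (greedy_new xs (y # ys)) \<union> set (greedy_rest xs (y # ys)) = set (y # ys) \<union> (set xs - set (greedy_matched xs (y # ys)))"
      using 1 by simp
    moreover have "x \<notin> set (greedy_matched xs (y # ys))" using 1(3) sub[of "y # ys"] by auto
    ultimately show ?thesis using False by auto
  qed
qed auto

lemma sorted_greedy_new:
  assumes "sorted_wrt (>) xs" "sorted_wrt (>) ys"
  shows "sorted_wrt (>) (greedy_new xs ys)"
  using assms
proof (induction xs ys rule: greedy_new.induct)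
  case (1 x xs y ys)
  have sub: "set (greedy_new xs zs) \<subseteq> set xs \<union> set zs" for zs by (rule greedy_new_subset)
  show ?case using 1 sub[of ys] sub[of "y # ys"] by fastforce
qed auto

lemma desc_list_eq:
  assumes "sorted_wrt (>) (xs :: nat list)"
  shows "xs = rev (sorted_list_of_set (set xs))"
proof -
  have "sorted_wrt (<) (rev xs)" using assms by (simp add: sorted_wrt_rev)
  then have "sorted (rev xs)" "distinct (rev xs)" by (auto simp: strict_sorted_iff)
  then have "sorted_list_of_set (set (rev xs)) = rev xs" by (rule sorted_list_of_set.idem_if_sorted_distinct)
  then show ?thesis by simp
qed

definition desc :: "nat set \<Rightarrow> nat list" where
  "desc A = rev (sorted_list_of_set A)"

text \<open>When \<open>B \<preceq> Y\<close> every element of \<open>Y\<close> finds a partner, so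
  nothing is left over, and the result, still decreasing, lists the lift.\<close>

lemma greedy_new_lift:
  assumes "finite B" "finite Y" "B \<preceq> Y"
  shows "greedy_new (desc B) (desc Y) = desc (lift B Y)"
proof -
  have d: "distinct (desc B)" "distinct (desc Y)" "set (desc B) = B" "set (desc Y) = Y" "length (desc Y) = card Y"
    "sorted_wrt (>) (desc B)" "sorted_wrt (>) (desc Y)"
    using assms sorted_desc by (auto simp: desc_def)
  have m: "set (greedy_matched (desc B) (desc Y)) = matched B Y" by (simp add: matched_def desc_def)
  have "card (matched B Y) = card Y" using pairing_matched[OF assms] by (simp add: pairing_def)
  then have "card Y \<le> length (greedy_matched (desc B) (desc Y))"
    using card_length[of "greedy_matched (desc B) (desc Y)"] m by simp
  then have "length (greedy_rest (desc B) (desc Y)) = 0"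
    using length_greedy_rest[of "desc B" "desc Y"] d by linarith
  then have "greedy_rest (desc B) (desc Y) = []" by simp
  then have "set (greedy_new (desc B) (desc Y)) = lift B Y"
    using set_greedy_new[OF d(1,2)] d m by (simp add: lift_def)
  then show ?thesis using desc_list_eq[OF sorted_greedy_new[OF d(6,7)]] by (simp add: desc_def)
qed

lemma foldl_greedy_new:
  assumes "tab n (B # Cs)"
  shows "foldl greedy_new (desc B) (map desc Cs) = desc (foldl lift B Cs)"
  using assms
proof (induction Cs arbitrary: B)
  case (Cons Y Cs)
  have "finite B" "finite Y" "B \<preceq> Y" using Cons.prems colD by (auto simp: tab_Cons)
  then show ?case using Cons.IH[OF tab_lift[OF Cons.prems]] by (simp add: greedy_new_lift)
qed simp

text \<open>The greedy run reads its first list once, so its state after \<open>k\<close> slots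
  depends only on \<open>take k xs\<close>. This reconciles lifting column by column with scanning
  round by round.\<close>

lemma greedy_rest_take_Suc:
  "k < length xs \<Longrightarrow> greedy_rest (take (Suc k) xs) ys =
     (case greedy_rest (take k xs) ys of [] \<Rightarrow> [] | y # zs \<Rightarrow> if xs ! k \<le> y then zs else y # zs)"
proof (induction xs arbitrary: k ys)
  case (Cons x xs)
  then show ?case by (cases k; cases ys) (auto split: list.splits)
qed simp

lemma greedy_new_nth:
  "k < length xs \<Longrightarrow> greedy_new xs ys ! k =
     (case greedy_rest (take k xs) ys of [] \<Rightarrow> xs ! k | y # zs \<Rightarrow> if xs ! k \<le> y then y else xs ! k)"
proof (induction xs arbitrary: k ys)
  case (Cons x xs)
  then show ?case by (cases k; cases ys) (auto split: list.splits)
qed simp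

text \<open>Partners are consumed from the front. As columns are listed from the bottom up, the
  unmarked part of a column is always a top segment.\<close>

lemma greedy_rest_drop: "greedy_rest xs ys = drop (length ys - length (greedy_rest xs ys)) ys"
proof (induction xs ys rule: greedy_rest.induct)
  case (1 x xs y ys)
  have "length (greedy_rest xs ys) \<le> length ys" using length_greedy_rest[of xs ys] by simp
  then show ?case using 1 by (auto simp: Suc_diff_le)
qed auto

lemma length_greedy_rest_le: "length (greedy_rest xs ys) \<le> length ys"
  using length_greedy_rest[of xs ys] by simp

section \<open>Earliest increasing subsequences with a carried value\<close>

text \<open>The continuation of an EWIS whose latest value is \<open>t\<close>, as needed when a
  scan enters a column from the left.\<close>

definition ewis_from :: "('a \<Rightarrow> nat) \<Rightarrow> nat \<Rightarrow> 'a list \<Rightarrow> 'a list" where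
  "ewis_from f t xs = ewis f (dropWhile (\<lambda>y. \<not> t \<le> f y) xs)"

lemma ewis_from_simps[simp]:
  "ewis_from f t [] = []"
  "ewis_from f t (x # xs) = (if t \<le> f x then x # ewis_from f (f x) xs else ewis_from f t xs)"
  by (simp_all add: ewis_from_def)

lemma ewis_Cons: "ewis f (x # xs) = x # ewis_from f (f x) xs"
  by (simp add: ewis_from_def)

text \<open>If nothing follows, the value \<open>t\<close> carried in remains the last one.\<close>

definition last_value :: "('a \<Rightarrow> nat) \<Rightarrow> nat \<Rightarrow> 'a list \<Rightarrow> nat" where
  "last_value f t xs = (if ewis_from f t xs = [] then t else f (last (ewis_from f t xs)))"

lemma last_value_simps[simp]:
  "last_value f t [] = t"
  "last_value f t (x # xs) = (if t \<le> f x then last_value f (f x) xs else last_value f t xs)"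
  by (auto simp: last_value_def)

lemma last_ewis_Cons: "f (last (ewis f (x # xs))) = last_value f (f x) xs"
  by (simp add: ewis_Cons last_value_def del: ewis.simps)

lemma finite_downset_eq:
  assumes "finite A" "\<And>r s. s \<in> A \<Longrightarrow> 1 \<le> r \<Longrightarrow> r \<le> s \<Longrightarrow> r \<in> A" "\<And>r. r \<in> A \<Longrightarrow> 1 \<le> (r :: nat)"
  shows "A = {1..card A}"
proof (cases "A = {}")
  case False
  then have M: "Max A \<in> A" using assms(1) by simp
  have "A = {1..Max A}"
  proof (intro equalityI subsetI)
    fix r assume "r \<in> A"
    then show "r \<in> {1..Max A}" using assms(1,3) by simp
  next
    fix r assume "r \<in> {1..Max A}"
    then show "r \<in> A" using assms(2)[OF M, of r] by simp
  qed
  then show ?thesis by (metis card_atLeastAtMost diff_Suc_1 Suc_eq_plus1 One_nat_def)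
qed simp

lemma sorted_list_of_set_image:
  assumes "\<And>r s. 1 \<le> r \<Longrightarrow> r < s \<Longrightarrow> s \<le> m \<Longrightarrow> f r < (f s :: nat)"
  shows "sorted_list_of_set (f ` {1..m}) = map f [1..<Suc m]"
proof -
  have "sorted_wrt (<) (map f [1..<Suc m])"
    unfolding sorted_wrt_map by (rule sorted_wrt_mono_rel[OF _ sorted_wrt_upt]) (use assms in auto)
  then have "sorted (map f [1..<Suc m])" "distinct (map f [1..<Suc m])" by (auto simp only: strict_sorted_iff)
  then have "sorted_list_of_set (set (map f [1..<Suc m])) = map f [1..<Suc m]"
    by (rule sorted_list_of_set.idem_if_sorted_distinct)
  moreover have "set (map f [1..<Suc m]) = f ` {1..m}" by (simp only: set_map set_upt atLeastLessThanSuc_atLeastAtMost)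
  ultimately show ?thesis by simp
qed

section \<open>Fillings of a shape as lists of column sets\<close>

locale partition_shape =
  fixes n :: nat and lam :: "nat \<Rightarrow> nat"
  assumes part: "n_partition n lam"
begin

abbreviation \<zeta> :: "nat \<Rightarrow> nat" where "\<zeta> \<equiv> col_len lam"
abbreviation m :: nat where "m \<equiv> lam 1"

lemma part_zero: "r \<notin> {1..n} \<Longrightarrow> lam r = 0"
  using conjunct2[OF part[unfolded n_partition_def]] by simp

lemma part_antimono: "r \<in> {1..n} \<Longrightarrow> s \<in> {1..n} \<Longrightarrow> r \<le> s \<Longrightarrow> lam s \<le> lam r"
  using conjunct1[OF part[unfolded n_partition_def]] by simp

lemma shape_iff: "1 \<le> c \<Longrightarrow> (r, c) \<in> shape lam \<longleftrightarrow> 1 \<le> r \<and> r \<le> \<zeta> c"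
  and col_len_le: "1 \<le> c \<Longrightarrow> \<zeta> c \<le> n"
proof -
  assume c: "1 \<le> c"
  let ?A = "{r. (r, c) \<in> shape lam}"
  have sub: "?A \<subseteq> {1..n}"
  proof
    fix r assume "r \<in> ?A"
    then have "lam r \<noteq> 0" using c by (auto simp: shape_def)
    then show "r \<in> {1..n}" using part_zero[of r] by argo
  qed
  then have fin: "finite ?A" using finite_subset by blast
  have "?A = {1..card ?A}"
  proof (rule finite_downset_eq[OF fin])
    fix r s assume rs: "s \<in> ?A" "1 \<le> r" "r \<le> s"
    then have "s \<in> {1..n}" "r \<in> {1..n}" using sub by auto
    then have "lam s \<le> lam r" using part_antimono rs by blast
    then show "r \<in> ?A" using rs by (simp add: shape_def)
  qed (use sub in auto)
  then have "?A = {1..\<zeta> c}" by (simp add: col_len_def)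
  then show "(r, c) \<in> shape lam \<longleftrightarrow> 1 \<le> r \<and> r \<le> \<zeta> c" by auto
  show "\<zeta> c \<le> n" using card_mono[OF _ sub] by (simp add: col_len_def)
qed

lemma shape_cases: "(r, c) \<in> shape lam \<longleftrightarrow> c \<in> {1..m} \<and> r \<in> {1..\<zeta> c}"
proof -
  have "c \<le> m" if "(r, c) \<in> shape lam"
  proof -
    have "(1, c) \<in> shape lam" using that shape_iff[of c r] shape_iff[of c 1] by (auto simp: shape_def)
    then show ?thesis by (simp add: shape_def)
  qed
  then show ?thesis using shape_iff[of c r] by (auto simp: shape_def)
qed

lemma col_len_antimono: "1 \<le> c \<Longrightarrow> c \<le> d \<Longrightarrow> \<zeta> d \<le> \<zeta> c"
  using shape_iff[of d "\<zeta> d"] shape_iff[of c "\<zeta> d"] by (cases "\<zeta> d") (auto simp: shape_def)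


definition lens :: "nat list" where
  "lens = map \<zeta> [1..<Suc m]"

lemma lens_nth: "i < m \<Longrightarrow> lens ! i = \<zeta> (Suc i)" and length_lens[simp]: "length lens = m"
  by (simp_all add: lens_def del: upt_Suc)

lemma sorted_lens: "sorted_wrt (\<ge>) lens"
  unfolding sorted_wrt_iff_nth_less by (auto simp: lens_nth intro!: col_len_antimono)

definition column :: "(nat \<Rightarrow> nat \<Rightarrow> nat) \<Rightarrow> nat \<Rightarrow> nat set" where
  "column T c = (\<lambda>r. T r c) ` {1..\<zeta> c}"

definition columns :: "(nat \<Rightarrow> nat \<Rightarrow> nat) \<Rightarrow> nat set list" where
  "columns T = map (column T) [1..<Suc m]"

lemma columns_nth: "i < m \<Longrightarrow> columns T ! i = column T (Suc i)" and length_columns[simp]: "length (columns T) = m"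
  by (simp_all add: columns_def del: upt_Suc)

lemma column_sorted_list:
  assumes "T \<in> tabloids n lam" "c \<in> {1..m}"
  shows "sorted_list_of_set (column T c) = map (\<lambda>r. T r c) [1..<Suc (\<zeta> c)]"
  unfolding column_def
  by (rule sorted_list_of_set_image) (use assms shape_cases in \<open>auto simp: tabloids_def\<close>)

lemma column_nth:
  assumes "T \<in> tabloids n lam" "c \<in> {1..m}" "r \<in> {1..\<zeta> c}"
  shows "sorted_list_of_set (column T c) ! (r - 1) = T r c"
proof -
  have "map (\<lambda>r. T r c) [1..<Suc (\<zeta> c)] ! (r - 1) = T (1 + (r - 1)) c"
    by (rule nth_map_upt) (use assms(3) in auto)
  then show ?thesis using column_sorted_list[OF assms(1,2)] assms(3) by (metis atLeastAtMost_iff le_add_diff_inverse)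
qed

lemma column_card: "T \<in> tabloids n lam \<Longrightarrow> c \<in> {1..m} \<Longrightarrow> card (column T c) = \<zeta> c"
proof -
  assume "T \<in> tabloids n lam" "c \<in> {1..m}"
  from column_sorted_list[OF this] have "length (sorted_list_of_set (column T c)) = \<zeta> c" by (simp del: upt_Suc)
  then show ?thesis by (simp add: column_def)
qed

lemma column_sub: "T \<in> tabloids n lam \<Longrightarrow> c \<in> {1..m} \<Longrightarrow> column T c \<subseteq> {1..n}"
  using shape_cases by (auto simp: column_def tabloids_def)

lemma column_finite: "finite (column T c)" by (simp add: column_def)

lemma columns_sub: "T \<in> tabloids n lam \<Longrightarrow> \<forall>C\<in>set (columns T). C \<subseteq> {1..n}"
  using column_sub[of T] by (auto simp: columns_def simp del: upt_Suc)

lemma columns_card: "T \<in> tabloids n lam \<Longrightarrow> map card (columns T) = lens"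
  using column_card by (auto simp: columns_def lens_def simp del: upt_Suc)

lemma tableaux_iff: "T \<in> tabloids n lam \<Longrightarrow> T \<in> tableaux n lam \<longleftrightarrow> tab n (columns T)"
proof -
  assume T: "T \<in> tabloids n lam"
  have le: "column T c \<preceq> column T d \<longleftrightarrow> (\<forall>r\<in>{1..\<zeta> d}. T r c \<le> T r d)" if cd: "c \<in> {1..m}" "d \<in> {1..m}" "c \<le> d" for c d
  proof -
    have z: "\<zeta> d \<le> \<zeta> c" using col_len_antimono cd by simp
    have "column T c \<preceq> column T d \<longleftrightarrow> (\<forall>i<\<zeta> d. sorted_list_of_set (column T c) ! i \<le> sorted_list_of_set (column T d) ! i)"
      using col_le_iff_nth[OF column_finite column_finite, of T d T c] column_card[OF T] cd z by simp
    also have "\<dots> \<longleftrightarrow> (\<forall>r\<in>{1..\<zeta> d}. T r c \<le> T r d)"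
    proof (intro iffI ballI allI impI)
      fix r assume a: "\<forall>i<\<zeta> d. sorted_list_of_set (column T c) ! i \<le> sorted_list_of_set (column T d) ! i" and r: "r \<in> {1..\<zeta> d}"
      have "r - 1 < \<zeta> d" using r by auto
      from a[rule_format, OF this] show "T r c \<le> T r d" using column_nth[OF T cd(1), of r] column_nth[OF T cd(2), of r] r z by simp
    next
      fix i assume a: "\<forall>r\<in>{1..\<zeta> d}. T r c \<le> T r d" and i: "i < \<zeta> d"
      then show "sorted_list_of_set (column T c) ! i \<le> sorted_list_of_set (column T d) ! i"
        using column_nth[OF T cd(1), of "Suc i"] column_nth[OF T cd(2), of "Suc i"] z by simp
    qed
    finally show ?thesis .
  qed
  have "tab n (columns T) \<longleftrightarrow> (\<forall>i j. i < j \<longrightarrow> j < m \<longrightarrow> column T (Suc i) \<preceq> column T (Suc j))"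
    using columns_sub[OF T] by (auto simp: tab_def sorted_wrt_iff_nth_less columns_nth)
  also have "\<dots> \<longleftrightarrow> (\<forall>i j. i < j \<longrightarrow> j < m \<longrightarrow> (\<forall>r\<in>{1..\<zeta> (Suc j)}. T r (Suc i) \<le> T r (Suc j)))"
    using le by simp
  also have "\<dots> \<longleftrightarrow> (\<forall>r c d. (r, c) \<in> shape lam \<and> (r, d) \<in> shape lam \<and> c \<le> d \<longrightarrow> T r c \<le> T r d)"
  proof
    assume a: "\<forall>i j. i < j \<longrightarrow> j < m \<longrightarrow> (\<forall>r\<in>{1..\<zeta> (Suc j)}. T r (Suc i) \<le> T r (Suc j))"
    show "\<forall>r c d. (r, c) \<in> shape lam \<and> (r, d) \<in> shape lam \<and> c \<le> d \<longrightarrow> T r c \<le> T r d"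
    proof (intro allI impI)
      fix r c d assume s: "(r, c) \<in> shape lam \<and> (r, d) \<in> shape lam \<and> c \<le> d"
      then have cd: "c \<in> {1..m}" "d \<in> {1..m}" "r \<in> {1..\<zeta> d}" using shape_cases by blast+
      show "T r c \<le> T r d"
      proof (cases "c = d")
        case False
        then have "c - 1 < d - 1" "d - 1 < m" using s cd by auto
        from a[rule_format, OF this, of r] show ?thesis using cd by simp
      qed simp
    qed
  next
    assume a: "\<forall>r c d. (r, c) \<in> shape lam \<and> (r, d) \<in> shape lam \<and> c \<le> d \<longrightarrow> T r c \<le> T r d"
    show "\<forall>i j. i < j \<longrightarrow> j < m \<longrightarrow> (\<forall>r\<in>{1..\<zeta> (Suc j)}. T r (Suc i) \<le> T r (Suc j))"
    proof (intro allI impI ballI)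
      fix i j r assume ij: "i < j" "j < m" "r \<in> {1..\<zeta> (Suc j)}"
      then have "\<zeta> (Suc j) \<le> \<zeta> (Suc i)" by (intro col_len_antimono) auto
      then show "T r (Suc i) \<le> T r (Suc j)" using a ij shape_cases by auto
    qed
  qed
  finally show ?thesis using T by (simp add: tableaux_def)
qed

definition filling :: "nat set list \<Rightarrow> nat \<Rightarrow> nat \<Rightarrow> nat" where
  "filling Cs r c = (if (r, c) \<in> shape lam then sorted_list_of_set (Cs ! (c - 1)) ! (r - 1) else 0)"

lemma filling_props:
  assumes "\<forall>C\<in>set Cs. C \<subseteq> {1..n}" "map card Cs = lens"
  shows "filling Cs \<in> tabloids n lam" "columns (filling Cs) = Cs"
proof -
  have len: "length Cs = m" using assms(2) by (metis length_lens length_map)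
  have C: "Cs ! (c - 1) \<subseteq> {1..n}" "card (Cs ! (c - 1)) = \<zeta> c" "finite (Cs ! (c - 1))" if c: "c \<in> {1..m}" for c
  proof -
    have i: "c - 1 < m" "Suc (c - 1) = c" using c by auto
    show sub: "Cs ! (c - 1) \<subseteq> {1..n}" using assms(1) i len by simp
    then show "finite (Cs ! (c - 1))" by (rule col_finite)
    show "card (Cs ! (c - 1)) = \<zeta> c" using nth_map[of "c - 1" Cs card] assms(2) lens_nth[of "c - 1"] i len by simp
  qed
  show "filling Cs \<in> tabloids n lam" unfolding tabloids_def
  proof (intro CollectI conjI allI impI)
    fix r c assume "(r, c) \<in> shape lam"
    then have rc: "c \<in> {1..m}" "r \<in> {1..\<zeta> c}" "(r, c) \<in> shape lam" using shape_cases by auto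
    then have "sorted_list_of_set (Cs ! (c - 1)) ! (r - 1) \<in> Cs ! (c - 1)"
      using C[OF rc(1)] nth_mem[of "r - 1" "sorted_list_of_set (Cs ! (c - 1))"] by auto
    then show "filling Cs r c \<in> {1..n}" using C[OF rc(1)] rc by (auto simp: filling_def)
  next
    fix r s c assume a: "(r, c) \<in> shape lam \<and> (s, c) \<in> shape lam \<and> r < s"
    then have rc: "c \<in> {1..m}" "r \<in> {1..\<zeta> c}" "s \<in> {1..\<zeta> c}" using shape_cases by auto
    have "sorted_list_of_set (Cs ! (c - 1)) ! (r - 1) < sorted_list_of_set (Cs ! (c - 1)) ! (s - 1)"
      using sorted_wrt_nth_less[OF strict_sorted_list_of_set, of "r - 1" "s - 1" "Cs ! (c - 1)"] C[OF rc(1)] rc a by auto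
    then show "filling Cs r c < filling Cs s c" using a by (simp add: filling_def)
  qed (simp add: filling_def)
  show "columns (filling Cs) = Cs"
  proof (rule nth_equalityI)
    fix i assume "i < length (columns (filling Cs))"
    then have i: "i < m" "Suc i \<in> {1..m}" by auto
    have "column (filling Cs) (Suc i) = (\<lambda>r. sorted_list_of_set (Cs ! i) ! (r - 1)) ` {1..\<zeta> (Suc i)}"
      unfolding column_def using shape_cases i by (intro image_cong) (auto simp: filling_def)
    also have "\<dots> = (\<lambda>r. sorted_list_of_set (Cs ! i) ! r) ` {0..<\<zeta> (Suc i)}"
    proof -
      have "{0..<\<zeta> (Suc i)} = (\<lambda>r. r - 1) ` {1..\<zeta> (Suc i)}" by (auto simp: image_iff intro!: bexI[of _ "Suc _"])
      then show ?thesis by (simp add: image_image)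
    qed
    also have "\<dots> = Cs ! i" using C[OF i(2)] nth_image[of "\<zeta> (Suc i)" "sorted_list_of_set (Cs ! i)"] by simp
    finally show "columns (filling Cs) ! i = Cs ! i" using i by (simp add: columns_nth)
  qed (simp add: len)
qed

lemma columns_inj: "inj_on columns (tabloids n lam)"
proof (rule inj_onI)
  fix T U assume T: "T \<in> tabloids n lam" and U: "U \<in> tabloids n lam" and eq: "columns T = columns U"
  show "T = U"
  proof (intro ext)
    fix r c
    show "T r c = U r c"
    proof (cases "(r, c) \<in> shape lam")
      case True
      then have rc: "c \<in> {1..m}" "r \<in> {1..\<zeta> c}" using shape_cases by auto
      have i: "c - 1 < m" "Suc (c - 1) = c" using rc by auto
      have "column T c = column U c" using columns_nth[OF i(1), of T] columns_nth[OF i(1), of U] eq i(2) by simp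
      then show ?thesis using column_nth[OF T rc] column_nth[OF U rc] by simp
    next
      case False
      then show ?thesis using T U by (simp add: tabloids_def)
    qed
  qed
qed

lemma columns_tableaux: "columns ` tableaux n lam = {Cs. tab n Cs \<and> map card Cs = lens}"
proof (intro equalityI subsetI)
  fix Cs assume "Cs \<in> columns ` tableaux n lam"
  then show "Cs \<in> {Cs. tab n Cs \<and> map card Cs = lens}" using tableaux_iff columns_card by (auto simp: tableaux_def)
next
  fix Cs assume a: "Cs \<in> {Cs. tab n Cs \<and> map card Cs = lens}"
  then have s: "\<forall>C\<in>set Cs. C \<subseteq> {1..n}" "map card Cs = lens" by (auto simp: tab_def)
  show "Cs \<in> columns ` tableaux n lam"
    using filling_props[OF s] tableaux_iff[OF filling_props(1)[OF s]] a by (metis (mono_tags, lifting) image_eqI mem_Collect_eq)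
qed

end

section \<open>The scan, round by round\<close>

context partition_shape
begin

text \<open>Entry \<open>k\<close> is the value carried by round \<open>k\<close>, counted from 0,
  after the columns \<open>c\<close> to \<open>e\<close> have been visited.\<close>

definition state :: "(nat \<Rightarrow> nat \<Rightarrow> nat) \<Rightarrow> nat \<Rightarrow> nat \<Rightarrow> nat list" where
  "state T c e = foldl greedy_new (desc (column T c)) (map (\<lambda>d. desc (column T d)) [Suc c..<Suc e])"

text \<open>The number of entries of column \<open>d\<close> still unmarked before round
  \<open>k\<close>. Column \<open>c\<close> starts every path and loses one entry per round;
  elsewhere the loss is read off from the greedy run.\<close>

definition remaining :: "(nat \<Rightarrow> nat \<Rightarrow> nat) \<Rightarrow> nat \<Rightarrow> nat \<Rightarrow> nat \<Rightarrow> nat" where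
  "remaining T c k d = (if d = c then \<zeta> c - k
     else length (greedy_rest (take k (state T c (d - 1))) (desc (column T d))))"

text \<open>A closed form for \<open>marks\<close>, as established in
  \<open>marks_eq\<close>.\<close>

definition marked :: "(nat \<Rightarrow> nat \<Rightarrow> nat) \<Rightarrow> nat \<Rightarrow> nat \<Rightarrow> (nat \<times> nat) set" where
  "marked T c k = {(r, d). d \<in> {c..m} \<and> remaining T c k d < r \<and> r \<le> \<zeta> d}"

lemma state_step: "c < d \<Longrightarrow> state T c d = greedy_new (state T c (d - 1)) (desc (column T d))"
proof -
  assume "c < d"
  then have "[Suc c..<Suc d] = [Suc c..<Suc (d - 1)] @ [d]" by simp
  then show ?thesis by (simp add: state_def del: upt_Suc)
qed

lemma state_self: "state T c c = desc (column T c)"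
  by (simp add: state_def)

lemma length_desc[simp]: "finite A \<Longrightarrow> length (desc A) = card A"
  by (simp add: desc_def)

lemma length_state:
  assumes "T \<in> tabloids n lam" "c \<in> {1..m}"
  shows "length (state T c e) = \<zeta> c"
proof -
  have "length (foldl greedy_new xs Ys) = length xs" for xs Ys by (induction Ys arbitrary: xs) auto
  then show ?thesis using column_card[OF assms] column_finite by (simp add: state_def)
qed

lemma desc_nth:
  assumes "T \<in> tabloids n lam" "d \<in> {1..m}" "i < \<zeta> d"
  shows "desc (column T d) ! i = T (\<zeta> d - i) d"
proof -
  have "length (sorted_list_of_set (column T d)) = \<zeta> d" using column_card[OF assms(1,2)] column_finite by simp
  then have "desc (column T d) ! i = sorted_list_of_set (column T d) ! (\<zeta> d - Suc i)"
    using assms(3) by (simp add: desc_def rev_nth)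
  also have "\<dots> = T (\<zeta> d - i) d" using column_nth[OF assms(1,2), of "\<zeta> d - i"] assms(3) by simp
  finally show ?thesis .
qed

lemma remaining_le:
  assumes "T \<in> tabloids n lam" "c \<in> {1..m}" "d \<in> {c..m}"
  shows "remaining T c k d \<le> \<zeta> d"
proof (cases "d = c")
  case False
  have "length (desc (column T d)) = \<zeta> d" using column_card[of T d] column_finite assms by simp
  then show ?thesis using False length_greedy_rest_le[of "take k (state T c (d - 1))" "desc (column T d)"]
    by (simp add: remaining_def)
qed (simp add: remaining_def)

lemma remaining_step:
  assumes T: "T \<in> tabloids n lam" and c: "c \<in> {1..m}" and d: "d \<in> {Suc c..m}" and k: "k < \<zeta> c"
  defines "u \<equiv> remaining T c k d" and "x \<equiv> state T c (d - 1) ! k"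
  shows "remaining T c (Suc k) d = (if 0 < u \<and> x \<le> T u d then u - 1 else u)"
    "state T c d ! k = (if 0 < u \<and> x \<le> T u d then T u d else x)"
proof -
  let ?X = "state T c (d - 1)" and ?Y = "desc (column T d)"
  have kX: "k < length ?X" using length_state[OF T c] k by simp
  have dm: "d \<in> {1..m}" "d \<noteq> c" "c < d" using c d by auto
  have lY: "length ?Y = \<zeta> d" using column_card[OF T dm(1)] column_finite by simp
  have u: "u = length (greedy_rest (take k ?X) ?Y)" using dm by (simp add: u_def remaining_def)
  have ule: "u \<le> \<zeta> d" unfolding u using length_greedy_rest_le[of "take k ?X" ?Y] lY by simp
  have rest: "greedy_rest (take k ?X) ?Y = drop (\<zeta> d - u) ?Y"
    using greedy_rest_drop[of "take k ?X" ?Y] u lY by simp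
  have S: "remaining T c (Suc k) d = length (greedy_rest (take (Suc k) ?X) ?Y)" using dm by (simp add: remaining_def)
  have N: "state T c d ! k = greedy_new ?X ?Y ! k" using state_step[OF dm(3)] by simp
  show "remaining T c (Suc k) d = (if 0 < u \<and> x \<le> T u d then u - 1 else u)"
    "state T c d ! k = (if 0 < u \<and> x \<le> T u d then T u d else x)"
  proof (atomize (full), cases "u = 0")
    case True
    then have "greedy_rest (take k ?X) ?Y = []" using u by simp
    then show "remaining T c (Suc k) d = (if 0 < u \<and> x \<le> T u d then u - 1 else u) \<and>
      state T c d ! k = (if 0 < u \<and> x \<le> T u d then T u d else x)"
      unfolding S N greedy_rest_take_Suc[OF kX] greedy_new_nth[OF kX] using True by (simp add: x_def)
  next
    case False
    then have lt: "\<zeta> d - u < \<zeta> d" using ule by simp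
    then have "greedy_rest (take k ?X) ?Y = T u d # drop (Suc (\<zeta> d - u)) ?Y"
      using rest Cons_nth_drop_Suc[of "\<zeta> d - u" ?Y] lY desc_nth[OF T dm(1) lt] ule by simp
    then show "remaining T c (Suc k) d = (if 0 < u \<and> x \<le> T u d then u - 1 else u) \<and>
      state T c d ! k = (if 0 < u \<and> x \<le> T u d then T u d else x)"
      unfolding S N greedy_rest_take_Suc[OF kX] greedy_new_nth[OF kX] using False lY ule by (simp add: x_def)
  qed
qed

lemma unmarked_marked:
  assumes T: "T \<in> tabloids n lam" and c: "c \<in> {1..m}" and d: "d \<in> {c..m}"
  shows "unmarked_rows lam (marked T c k) d = {1..remaining T c k d}"
proof (rule Set.set_eqI)
  fix r
  have "(r, d) \<in> shape lam \<longleftrightarrow> 1 \<le> r \<and> r \<le> \<zeta> d" using shape_iff[of d r] c d by simp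
  moreover have "(r, d) \<in> marked T c k \<longleftrightarrow> remaining T c k d < r \<and> r \<le> \<zeta> d" using d by (simp add: marked_def)
  ultimately show "r \<in> unmarked_rows lam (marked T c k) d \<longleftrightarrow> r \<in> {1..remaining T c k d}"
    using remaining_le[OF T c d, of k] unfolding unmarked_rows_def mem_Collect_eq atLeastAtMost_iff by linarith
qed

definition unmarked_bottoms :: "(nat \<Rightarrow> nat \<Rightarrow> nat) \<Rightarrow> nat \<Rightarrow> nat \<Rightarrow> nat list \<Rightarrow> (nat \<times> nat) list" where
  "unmarked_bottoms T c k ds = map (\<lambda>d. (remaining T c k d, d)) (filter (\<lambda>d. 0 < remaining T c k d) ds)"

lemma bottom_locs_marked:
  assumes T: "T \<in> tabloids n lam" and c: "c \<in> {1..m}"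
  shows "bottom_locs lam c (marked T c k) = unmarked_bottoms T c k [c..<Suc m]"
proof -
  let ?u = "\<lambda>d. unmarked_rows lam (marked T c k) d"
  have u: "?u d = {1..remaining T c k d}" if "d \<in> set [c..<Suc m]" for d
    by (rule unmarked_marked[OF T c]) (use that in auto)
  have 1: "filter (\<lambda>d. ?u d \<noteq> {}) [c..<Suc m] = filter (\<lambda>d. 0 < remaining T c k d) [c..<Suc m]"
    by (rule filter_cong[OF refl]) (auto simp: u simp del: upt_Suc)
  have 2: "Max (?u d) = remaining T c k d" if "d \<in> set (filter (\<lambda>d. 0 < remaining T c k d) [c..<Suc m])" for d
  proof -
    have r: "?u d = {1..remaining T c k d}" "1 \<le> remaining T c k d" using that u[of d] by (auto simp del: upt_Suc)
    show ?thesis unfolding r(1) by (rule Max_eqI) (use r(2) in simp_all)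
  qed
  show ?thesis unfolding bottom_locs_def 1 unmarked_bottoms_def by (rule map_cong[OF refl]) (simp add: 2 del: upt_Suc)
qed

text \<open>Induction from the last column to the left: the rest of a path depends only on the value
  carried in and on the columns still to come.\<close>

lemma scan_from:
  assumes T: "T \<in> tabloids n lam" and c: "c \<in> {1..m}" and k: "k < \<zeta> c" and e: "c \<le> e" "e \<le> m"
  defines "f \<equiv> \<lambda>(r, d). T r d"
  shows "last_value f (state T c e ! k) (unmarked_bottoms T c k [Suc e..<Suc m]) = state T c m ! k \<and>
    set (ewis_from f (state T c e ! k) (unmarked_bottoms T c k [Suc e..<Suc m])) =
      {(remaining T c k d, d) | d. d \<in> {Suc e..m} \<and> 0 < remaining T c k d \<and> state T c (d - 1) ! k \<le> T (remaining T c k d) d}"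
  using e(2,1)
proof (induction rule: inc_induct)
  case base
  then show ?case by (simp add: unmarked_bottoms_def)
next
  case (step e)
  let ?d = "Suc e"
  let ?u = "remaining T c k ?d" and ?x = "state T c e ! k"
  let ?R = "\<lambda>e. {(remaining T c k d, d) | d. d \<in> {Suc e..m} \<and> 0 < remaining T c k d \<and> state T c (d - 1) ! k \<le> T (remaining T c k d) d}"
  have ups: "[?d..<Suc m] = ?d # [Suc ?d..<Suc m]" using step.hyps by (simp add: upt_conv_Cons del: upt_Suc)
  have nx: "state T c ?d ! k = (if 0 < ?u \<and> ?x \<le> T ?u ?d then T ?u ?d else ?x)"
    using remaining_step(2)[OF T c _ k, of ?d] step.hyps step.prems by simp
  have IH: "last_value f (state T c ?d ! k) (unmarked_bottoms T c k [Suc ?d..<Suc m]) = state T c m ! k"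
    "set (ewis_from f (state T c ?d ! k) (unmarked_bottoms T c k [Suc ?d..<Suc m])) = ?R ?d"
    using step.IH step.prems by auto
  have ins: "{Suc e..m} = insert ?d {Suc ?d..m}" using step.hyps by auto
  show ?case
  proof (cases "0 < ?u \<and> ?x \<le> T ?u ?d")
    case True
    then have ub: "unmarked_bottoms T c k [?d..<Suc m] = (?u, ?d) # unmarked_bottoms T c k [Suc ?d..<Suc m]"
      unfolding ups by (simp add: unmarked_bottoms_def)
    have f: "f (?u, ?d) = T ?u ?d" by (simp add: f_def)
    have "?R e = insert (?u, ?d) (?R ?d)" unfolding ins using True by auto
    then show ?thesis using IH True nx unfolding ub by (simp add: f)
  next
    case False
    have "last_value f ?x (unmarked_bottoms T c k [?d..<Suc m]) = last_value f ?x (unmarked_bottoms T c k [Suc ?d..<Suc m])"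
      "ewis_from f ?x (unmarked_bottoms T c k [?d..<Suc m]) = ewis_from f ?x (unmarked_bottoms T c k [Suc ?d..<Suc m])"
      unfolding ups using False by (auto simp: unmarked_bottoms_def f_def)
    moreover have "?R e = ?R ?d" unfolding ins using False by auto
    ultimately show ?thesis using IH False nx by auto
  qed
qed

lemma scan_path_marked:
  assumes T: "T \<in> tabloids n lam" and c: "c \<in> {1..m}" and k: "k < \<zeta> c"
  shows "(case last (scan_path lam T c (marked T c k)) of (s, d) \<Rightarrow> T s d) = state T c m ! k"
    and "set (scan_path lam T c (marked T c k)) = insert (\<zeta> c - k, c)
      {(remaining T c k d, d) | d. d \<in> {Suc c..m} \<and> 0 < remaining T c k d \<and> state T c (d - 1) ! k \<le> T (remaining T c k d) d}"
proof -
  let ?f = "\<lambda>(r, d). T r d"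
  have rc: "remaining T c k c = \<zeta> c - k" by (simp add: remaining_def)
  have "[c..<Suc m] = c # [Suc c..<Suc m]" using c by (simp add: upt_conv_Cons del: upt_Suc)
  then have "unmarked_bottoms T c k [c..<Suc m] = (\<zeta> c - k, c) # unmarked_bottoms T c k [Suc c..<Suc m]"
    using k rc by (simp add: unmarked_bottoms_def del: upt_Suc)
  then have path: "scan_path lam T c (marked T c k) = ewis ?f ((\<zeta> c - k, c) # unmarked_bottoms T c k [Suc c..<Suc m])"
    by (simp add: scan_path_def bottom_locs_marked[OF T c] del: ewis.simps upt_Suc)
  have fc: "?f (\<zeta> c - k, c) = state T c c ! k" using desc_nth[OF T c k] by (simp add: state_self)
  have cm: "c \<le> c" "c \<le> m" using c by auto
  note sf = scan_from[OF T c k cm]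
  have "?f (last (scan_path lam T c (marked T c k))) = last_value ?f (state T c c ! k) (unmarked_bottoms T c k [Suc c..<Suc m])"
    unfolding path last_ewis_Cons fc ..
  also have "\<dots> = state T c m ! k" by (rule conjunct1[OF sf])
  finally show "(case last (scan_path lam T c (marked T c k)) of (s, d) \<Rightarrow> T s d) = state T c m ! k" .
  show "set (scan_path lam T c (marked T c k)) = insert (\<zeta> c - k, c)
      {(remaining T c k d, d) | d. d \<in> {Suc c..m} \<and> 0 < remaining T c k d \<and> state T c (d - 1) ! k \<le> T (remaining T c k d) d}"
    unfolding path ewis_Cons fc list.set conjunct2[OF sf] ..
qed

lemma marked_0: "T \<in> tabloids n lam \<Longrightarrow> c \<in> {1..m} \<Longrightarrow> marked T c 0 = {}"
proof -
  assume T: "T \<in> tabloids n lam" and c: "c \<in> {1..m}"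
  have "remaining T c 0 d = \<zeta> d" if "d \<in> {c..m}" for d
  proof (cases "d = c")
    case False
    have "greedy_rest [] ys = ys" for ys by (cases ys) auto
    then show ?thesis using False column_card[OF T, of d] column_finite that c by (simp add: remaining_def)
  qed (simp add: remaining_def)
  then show ?thesis by (auto simp: marked_def)
qed

lemma marked_Suc:
  assumes T: "T \<in> tabloids n lam" and c: "c \<in> {1..m}" and k: "k < \<zeta> c"
  shows "marked T c (Suc k) = marked T c k \<union> set (scan_path lam T c (marked T c k))"
proof (intro equalityI subsetI)
  fix p assume p: "p \<in> marked T c (Suc k)"
  obtain r d where rd: "p = (r, d)" by (cases p)
  have a: "d \<in> {c..m}" "remaining T c (Suc k) d < r" "r \<le> \<zeta> d" using p rd by (auto simp: marked_def)
  show "p \<in> marked T c k \<union> set (scan_path lam T c (marked T c k))"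
  proof (cases "d = c")
    case True
    then have "r = \<zeta> c - k \<or> \<zeta> c - k < r" using a k by (auto simp: remaining_def)
    then show ?thesis using a True rd unfolding scan_path_marked(2)[OF T c k] by (auto simp: marked_def remaining_def)
  next
    case False
    then have d: "d \<in> {Suc c..m}" using a by auto
    show ?thesis
      using a rd remaining_step(1)[OF T c d k] d unfolding scan_path_marked(2)[OF T c k]
      by (auto simp: marked_def split: if_splits)
  qed
next
  fix p assume p: "p \<in> marked T c k \<union> set (scan_path lam T c (marked T c k))"
  obtain r d where rd: "p = (r, d)" by (cases p)
  from p rd consider "(r, d) \<in> marked T c k" | "r = \<zeta> c - k" "d = c"
    | "d \<in> {Suc c..m}" "r = remaining T c k d" "0 < r" "state T c (d - 1) ! k \<le> T r d"
    unfolding scan_path_marked(2)[OF T c k] by auto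
  then show "p \<in> marked T c (Suc k)"
  proof cases
    case 1
    then have a: "d \<in> {c..m}" "remaining T c k d < r" "r \<le> \<zeta> d" by (auto simp: marked_def)
    have "remaining T c (Suc k) d \<le> remaining T c k d"
    proof (cases "d = c")
      case False
      then have d: "d \<in> {Suc c..m}" using a by auto
      show ?thesis using remaining_step(1)[OF T c d k] by simp
    qed (simp add: remaining_def)
    then show ?thesis using a rd by (simp add: marked_def)
  next
    case 2
    then show ?thesis using rd c k by (simp add: marked_def remaining_def)
  next
    case 3
    then have "r \<le> \<zeta> d" using remaining_le[OF T c, of d k] by simp
    then show ?thesis using 3 rd remaining_step(1)[OF T c 3(1) k] by (simp add: marked_def)
  qed
qed

lemma marks_eq:
  assumes T: "T \<in> tabloids n lam" and c: "c \<in> {1..m}" and k: "k \<le> \<zeta> c"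
  shows "marks lam T c k = marked T c k"
  using k
proof (induction k)
  case 0
  then show ?case using marked_0[OF T c] by simp
next
  case (Suc k)
  then show ?case using marked_Suc[OF T c, of k] by simp
qed

lemma drop_columns: "c \<in> {1..m} \<Longrightarrow> drop (c - 1) (columns T) = column T c # map (column T) [Suc c..<Suc m]"
proof -
  assume c: "c \<in> {1..m}"
  then have "drop (c - 1) [1..<Suc m] = [c..<Suc m]" by (simp add: drop_upt del: upt_Suc)
  also have "\<dots> = c # [Suc c..<Suc m]" by (rule upt_conv_Cons) (use c in auto)
  finally show ?thesis by (simp only: columns_def drop_map list.map)
qed

lemma right_keys_columns:
  assumes "c \<in> {1..m}"
  shows "right_keys (columns T) ! (c - 1) = foldl lift (column T c) (map (column T) [Suc c..<Suc m])"
proof -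
  have i: "c - 1 < m" "Suc (c - 1) = c" using assms by auto
  moreover have "drop (Suc (c - 1)) (columns T) = map (column T) [Suc c..<Suc m]"
    using assms by (simp add: columns_def drop_map del: upt_Suc)
  ultimately show ?thesis using right_keys_nth[of "c - 1" "columns T"] columns_nth[OF i(1), of T] by simp
qed

lemma scanning_tableau_eq:
  assumes T: "T \<in> tableaux n lam" and c: "c \<in> {1..m}" and r: "r \<in> {1..\<zeta> c}"
  shows "scanning_tableau lam T r c = sorted_list_of_set (right_keys (columns T) ! (c - 1)) ! (r - 1)"
proof -
  have T': "T \<in> tabloids n lam" using T by (simp add: tableaux_def)
  have tab: "tab n (columns T)" using T tableaux_iff[OF T'] by simp
  then have tab': "tab n (column T c # map (column T) [Suc c..<Suc m])"
    unfolding drop_columns[OF c, symmetric] by (metis append_take_drop_id tab_append)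
  let ?S = "foldl lift (column T c) (map (column T) [Suc c..<Suc m])"
  have k: "\<zeta> c - r < \<zeta> c" "\<zeta> c - r \<le> \<zeta> c" using r by auto
  \<comment> \<open>Row \<open>r\<close> is filled in round \<open>\<zeta> c - r\<close>, counted
    from 0, which is also its index in the descending list.\<close>
  have "scanning_tableau lam T r c = state T c m ! (\<zeta> c - r)"
    using scan_path_marked(1)[OF T' c k(1)] marks_eq[OF T' c k(2)] shape_cases[of r c] c r
    by (simp add: scanning_tableau_def)
  also have "state T c m = desc ?S"
    using foldl_greedy_new[OF tab'] by (simp add: state_def comp_def del: upt_Suc)
  also have "desc ?S ! (\<zeta> c - r) = sorted_list_of_set ?S ! (r - 1)"
  proof -
    have "card ?S = \<zeta> c" "finite ?S" using foldl_lift[OF tab'] column_card[OF T' c] col_finite by auto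
    then show ?thesis using r by (auto simp: desc_def rev_nth intro!: arg_cong[where f = "(!) _"])
  qed
  finally show ?thesis by (simp only: right_keys_columns[OF c])
qed

end


section \<open>Evaluating polynomials at matrices\<close>

lemma cpoly_decomp: "(p :: cpoly) = (\<Sum>m\<in>Poly_Mapping.keys p. Poly_Mapping.single m (poly_mapping.lookup p m))"
  by (rule poly_mapping_eqI) (auto simp: lookup_sum lookup_single when_def in_keys_iff sum.delta)

definition eval_mono :: "cmat \<Rightarrow> ((nat \<times> nat) \<Rightarrow>\<^sub>0 nat) \<Rightarrow> complex" where
  "eval_mono A m = (\<Prod>k\<in>Poly_Mapping.keys m. A (fst k) (snd k) ^ poly_mapping.lookup m k)"

text \<open>Turns relations between polynomials into relations between functions on matrices, to
  which the independence results apply.\<close>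

definition eval_cpoly :: "cmat \<Rightarrow> cpoly \<Rightarrow> complex" where
  "eval_cpoly A p = (\<Sum>m\<in>Poly_Mapping.keys p. poly_mapping.lookup p m * eval_mono A m)"

lemma eval_mono_superset:
  assumes "finite S" "Poly_Mapping.keys m \<subseteq> S"
  shows "eval_mono A m = (\<Prod>k\<in>S. A (fst k) (snd k) ^ poly_mapping.lookup m k)"
  unfolding eval_mono_def using assms by (intro prod.mono_neutral_left) (auto simp: in_keys_iff)

lemma eval_mono_add: "eval_mono A (m + m') = eval_mono A m * eval_mono A m'"
proof -
  let ?S = "Poly_Mapping.keys m \<union> Poly_Mapping.keys m'"
  have "eval_mono A (m + m') = (\<Prod>k\<in>?S. A (fst k) (snd k) ^ poly_mapping.lookup (m + m') k)"
    using Poly_Mapping.keys_add[of m m'] by (intro eval_mono_superset) auto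
  also have "\<dots> = eval_mono A m * eval_mono A m'"
    by (simp add: eval_mono_superset[of ?S m] eval_mono_superset[of ?S m'] lookup_add power_add prod.distrib)
  finally show ?thesis .
qed

lemma eval_cpoly_superset:
  assumes "finite S" "Poly_Mapping.keys p \<subseteq> S"
  shows "eval_cpoly A p = (\<Sum>m\<in>S. poly_mapping.lookup p m * eval_mono A m)"
  unfolding eval_cpoly_def using assms by (intro sum.mono_neutral_left) (auto simp: in_keys_iff)

lemma eval_cpoly_add: "eval_cpoly A (p + q) = eval_cpoly A p + eval_cpoly A q"
proof -
  let ?S = "Poly_Mapping.keys p \<union> Poly_Mapping.keys q"
  have "eval_cpoly A (p + q) = (\<Sum>m\<in>?S. poly_mapping.lookup (p + q) m * eval_mono A m)"
    using Poly_Mapping.keys_add[of p q] by (intro eval_cpoly_superset) auto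
  also have "\<dots> = eval_cpoly A p + eval_cpoly A q"
    by (simp add: eval_cpoly_superset[of ?S p] eval_cpoly_superset[of ?S q] lookup_add algebra_simps sum.distrib)
  finally show ?thesis .
qed

lemma eval_cpoly_0[simp]: "eval_cpoly A 0 = 0" by (simp add: eval_cpoly_def)

lemma eval_cpoly_single: "eval_cpoly A (Poly_Mapping.single m c) = c * eval_mono A m"
  using eval_cpoly_superset[of "{m}" "Poly_Mapping.single m c" A] by simp

lemma eval_cpoly_sum: "eval_cpoly A (\<Sum>x\<in>X. f x) = (\<Sum>x\<in>X. eval_cpoly A (f x))"
  by (induction X rule: infinite_finite_induct) (auto simp: eval_cpoly_add)

lemma eval_mono_0[simp]: "eval_mono A 0 = 1" by (simp add: eval_mono_def)

lemma eval_cpoly_mult: "eval_cpoly A (p * q) = eval_cpoly A p * eval_cpoly A q"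
proof -
  have "p * q = (\<Sum>m\<in>Poly_Mapping.keys p. \<Sum>m'\<in>Poly_Mapping.keys q.
      Poly_Mapping.single (m + m') (poly_mapping.lookup p m * poly_mapping.lookup q m'))"
    by (subst cpoly_decomp[of p], subst cpoly_decomp[of q]) (simp add: sum_product mult_single)
  then have "eval_cpoly A (p * q) = (\<Sum>m\<in>Poly_Mapping.keys p. \<Sum>m'\<in>Poly_Mapping.keys q.
      (poly_mapping.lookup p m * poly_mapping.lookup q m') * (eval_mono A m * eval_mono A m'))"
    by (simp add: eval_cpoly_sum eval_cpoly_single eval_mono_add)
  also have "\<dots> = eval_cpoly A p * eval_cpoly A q"
    unfolding eval_cpoly_def sum_product by (intro sum.cong refl) (simp only: ac_simps)
  finally show ?thesis .
qed

lemma eval_cpoly_1[simp]: "eval_cpoly A 1 = 1"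
  using eval_cpoly_single[of A 0 1] by simp

lemma eval_cpoly_scale: "eval_cpoly A (Poly_Mapping.single 0 c * p) = c * eval_cpoly A p"
  by (simp add: eval_cpoly_mult eval_cpoly_single)

lemma eval_indet: "eval_cpoly A (indet i j) = A i j"
  by (simp add: indet_def eval_cpoly_single eval_mono_def)

lemma eval_poly_col: "eval_cpoly A (poly_col C) = col_minor C A"
proof -
  interpret comm_ring_hom "eval_cpoly A"
    by unfold_locales (auto simp: eval_cpoly_add eval_cpoly_mult)
  have "map_mat (eval_cpoly A) (mat (card C) (card C) (\<lambda>(i, j). poly_var (sorted_list_of_set C ! i) j))
      = mat (card C) (card C) (\<lambda>(i, j). A (sorted_list_of_set C ! i) (Suc j))"
    by (rule eq_matI) (auto simp: poly_var_def eval_indet)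
  then show ?thesis unfolding poly_col_def row_minor_def col_minor_def by (simp flip: hom_det)
qed

lemma eval_poly_product: "eval_cpoly A (poly_product Cs) = col_product Cs A"
  by (induction Cs) (auto simp: poly_product_def col_product_def eval_cpoly_mult eval_poly_col)

section \<open>Spans in the polynomial ring\<close>

lemma poly_space_subspace: "cpoly.subspace (carrier (poly_space n))"
  by (rule cpoly.subspaceI)
    (auto intro: poly_space_add_closed poly_space_mult_closed poly_space_const, simp add: poly_space_def)

lemma indet_carrier: "i \<in> {1..n} \<Longrightarrow> j \<in> {1..n} \<Longrightarrow> indet i j \<in> carrier (poly_space n)"
  unfolding poly_space_simps indet_def by simp

lemma one_carrier: "1 \<in> carrier (poly_space n)"
  using poly_space_const[of 1 n] by simp

lemma poly_col_carrier:
  assumes "C \<subseteq> {1..n}"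
  shows "poly_col C \<in> carrier (poly_space n)"
proof -
  have "card C \<le> n" using card_mono[OF finite_atLeastAtMost assms] by simp
  have prod: "(\<Prod>i\<in>I. f i) \<in> carrier (poly_space n)" if "\<And>i. i \<in> I \<Longrightarrow> f i \<in> carrier (poly_space n)" for I :: "nat set" and f
    using that by (induction I rule: infinite_finite_induct) (auto intro: poly_space_mult_closed one_carrier)
  have fin: "finite C" using assms col_finite by blast
  have "poly_var (sorted_list_of_set C ! i) (p i) \<in> carrier (poly_space n)"
    if "i \<in> {0..<card C}" "p permutes {0..<card C}" for i p
  proof -
    have "sorted_list_of_set C ! i \<in> C" using nth_mem[of i "sorted_list_of_set C"] fin that by simp
    moreover have "p i < card C" using permutes_in_image[OF that(2), of i] that(1) by simp
    ultimately show ?thesis using assms \<open>card C \<le> n\<close> unfolding poly_var_def by (intro indet_carrier) auto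
  qed
  then have "(\<Prod>i = 0..<card C. poly_var (sorted_list_of_set C ! i) (p i)) \<in> carrier (poly_space n)"
    if "p permutes {0..<card C}" for p using that by (intro prod) auto
  moreover have "signof p * q \<in> carrier (poly_space n)" if "q \<in> carrier (poly_space n)" for p :: "nat \<Rightarrow> nat" and q
    using that cpoly.subspace_neg[OF poly_space_subspace] by (cases p rule: sign_cases) auto
  ultimately show ?thesis unfolding poly_col_def row_minor_leibniz
    by (intro cpoly.subspace_sum[OF poly_space_subspace]) auto
qed

lemma poly_product_carrier:
  "\<forall>C\<in>set Cs. C \<subseteq> {1..n} \<Longrightarrow> poly_product Cs \<in> carrier (poly_space n)"
proof (induction Cs)
  case Nil
  then show ?case by (simp add: poly_product_def one_carrier)
next
  case (Cons C Cs)
  then have "poly_col C \<in> carrier (poly_space n)" "poly_product Cs \<in> carrier (poly_space n)"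
    using poly_col_carrier[of C n] by auto
  then show ?case using poly_space_mult_closed by (simp add: poly_product_def)
qed

text \<open>Each of the two spans is a subspace containing \<open>S\<close> in the sense of the
  other, so each contains the other by minimality.\<close>

lemma poly_space_span:
  assumes "S \<subseteq> carrier (poly_space n)"
  shows "LinearCombinations.module.span (class_ring :: complex ring) (poly_space n) S = cpoly.span S"
proof -
  interpret P: vectorspace "class_ring :: complex ring" "poly_space n" by (rule vectorspace_poly_space)
  have mod: "Module.module (class_ring :: complex ring) (poly_space n)" by (rule P.module_axioms)
  show ?thesis
  proof
    have "submodule (class_ring :: complex ring) (cpoly.span S) (poly_space n)"
    proof (rule submodule.intro[OF mod])
      show "cpoly.span S \<subseteq> carrier (poly_space n)" by (rule cpoly.span_minimal[OF assms poly_space_subspace])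
    qed (auto simp: poly_space_simps(2-4) intro: cpoly.span_add cpoly.span_zero cpoly.span_scale)
    then show "P.span S \<subseteq> cpoly.span S" by (intro P.span_is_subset) (auto intro: cpoly.span_base)
  next
    interpret S: submodule "class_ring :: complex ring" "P.span S" "poly_space n" by (rule P.span_is_submodule[OF assms])
    have "cpoly.subspace (P.span S)"
    proof (rule cpoly.subspaceI)
      show "0 \<in> P.span S" using S.zero_closed by (simp add: poly_space_simps(3))
      show "x + y \<in> P.span S" if "x \<in> P.span S" "y \<in> P.span S" for x y
        using S.m_closed[OF that] by (simp add: poly_space_simps(2))
      show "Poly_Mapping.single 0 c * x \<in> P.span S" if "x \<in> P.span S" for c x
        using S.smult_closed[of c x] that by (simp add: poly_space_simps(4))
    qed
    then show "cpoly.span S \<subseteq> P.span S" by (intro cpoly.span_minimal P.in_own_span[OF assms])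
  qed
qed


section \<open>The basis of the quotient\<close>

context partition_shape
begin

lemma initial_minor_column:
  assumes "T \<in> tabloids n lam" "c \<in> {1..m}"
  shows "initial_minor (\<zeta> c) (\<lambda>r. T r c) = poly_col (column T c)"
proof -
  have "T (Suc i) c = sorted_list_of_set (column T c) ! i" if "i < \<zeta> c" for i
    using column_nth[OF assms, of "Suc i"] that by simp
  then have "mat (\<zeta> c) (\<zeta> c) (\<lambda>(i, j). indet (T (Suc i) c) (Suc j))
      = mat (\<zeta> c) (\<zeta> c) (\<lambda>(i, j). poly_var (sorted_list_of_set (column T c) ! i) j)"
    by (intro cong_mat) (auto simp: poly_var_def)
  then show ?thesis unfolding initial_minor_def poly_col_def row_minor_def column_card[OF assms] by simp
qed

lemma tabloid_monomial_columns:
  assumes "T \<in> tabloids n lam"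
  shows "tabloid_monomial lam T = poly_product (columns T)"
proof -
  have "tabloid_monomial lam T = (\<Prod>c\<in>set [1..<Suc m]. poly_col (column T c))"
    unfolding tabloid_monomial_def set_upt atLeastLessThanSuc_atLeastAtMost
    by (rule prod.cong[OF refl initial_minor_column[OF assms]])
  also have "\<dots> = (\<Prod>c\<leftarrow>[1..<Suc m]. poly_col (column T c))"
    by (rule prod.distinct_set_conv_list) simp
  finally show ?thesis by (simp add: poly_product_def columns_def comp_def del: upt_Suc)
qed

definition tableau_lists :: "nat set list set" where
  "tableau_lists = {Cs. tab n Cs \<and> map card Cs = lens}"

definition tabloid_lists :: "nat set list set" where
  "tabloid_lists = {Cs. (\<forall>C\<in>set Cs. C \<subseteq> {1..n}) \<and> map card Cs = lens}"

lemma tableau_lists_subset: "tableau_lists \<subseteq> tabloid_lists"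
  by (auto simp: tableau_lists_def tabloid_lists_def tab_def)

lemma columns_tabloids: "columns ` tabloids n lam = tabloid_lists"
proof (intro equalityI subsetI)
  fix Cs assume "Cs \<in> columns ` tabloids n lam"
  then show "Cs \<in> tabloid_lists" using columns_sub columns_card by (auto simp: tabloid_lists_def)
next
  fix Cs assume "Cs \<in> tabloid_lists"
  then have s: "\<forall>C\<in>set Cs. C \<subseteq> {1..n}" "map card Cs = lens" by (auto simp: tabloid_lists_def)
  show "Cs \<in> columns ` tabloids n lam" using filling_props[OF s] by (metis imageI)
qed

lemma finite_tableau_lists: "finite tableau_lists"
proof (rule finite_subset)
  show "tableau_lists \<subseteq> {Cs. set Cs \<subseteq> Pow {1..n} \<and> length Cs = m}"
  proof
    fix Cs assume Cs: "Cs \<in> tableau_lists"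
    then have "map card Cs = lens" by (simp add: tableau_lists_def)
    then have "length Cs = m" by (metis length_map length_lens)
    then show "Cs \<in> {Cs. set Cs \<subseteq> Pow {1..n} \<and> length Cs = m}"
      using Cs by (auto simp: tableau_lists_def tab_def)
  qed
  show "finite {Cs. set Cs \<subseteq> Pow {1..n} \<and> length Cs = m}" by (intro finite_lists_length_eq) simp
qed

lemma straighten_tabloid: "Cs \<in> tabloid_lists \<Longrightarrow> poly_product Cs \<in> cpoly.span (poly_product ` tableau_lists)"
  using straightening[OF sorted_lens, of Cs n] by (simp add: tableau_lists_def tabloid_lists_def)

lemma tableau_list_standard:
  assumes "Cs \<in> tableau_lists"
  shows "tab n Cs \<and> map card Cs = lens"
  using assms by (simp add: tableau_lists_def)

end

section \<open>Comparison with the key\<close>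

locale key_shape = partition_shape +
  fixes Q :: "nat set" and P :: "nat set list"
  assumes Q_sub: "Q \<subseteq> {1..n - 1}" and short: "short_col_lens n lam \<subseteq> Q" and chain: "Q_chain n Q P"
begin

definition key_set :: "nat \<Rightarrow> nat set" where
  "key_set q = (if q = n then {1..n} else P ! (THE j. j < card Q \<and> sorted_list_of_set Q ! j = q))"

lemma key_set:
  assumes c: "c \<in> {1..m}"
  shows "key_set (\<zeta> c) \<subseteq> {1..n}" "card (key_set (\<zeta> c)) = \<zeta> c"
proof -
  have "key_set (\<zeta> c) \<subseteq> {1..n} \<and> card (key_set (\<zeta> c)) = \<zeta> c"
  proof (cases "\<zeta> c = n")
    case False
    have "\<zeta> c < n" using col_len_le[of c] c False by simp
    then have "\<zeta> c \<in> short_col_lens n lam" using c unfolding short_col_lens_def by blast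
    then have zQ: "\<zeta> c \<in> Q" using short by blast
    have fQ: "finite Q" using Q_sub finite_subset by blast
    have sl: "distinct (sorted_list_of_set Q)" "length (sorted_list_of_set Q) = card Q" "set (sorted_list_of_set Q) = Q"
      using fQ by auto
    let ?R = "\<lambda>j. j < card Q \<and> sorted_list_of_set Q ! j = \<zeta> c"
    obtain j where j: "?R j" using zQ sl by (metis in_set_conv_nth)
    have "(THE j. ?R j) = j"
      by (rule the_equality[where P = ?R, OF j]) (use j sl nth_eq_iff_index_eq in metis)
    then have "key_set (\<zeta> c) = P ! j" using False by (simp add: key_set_def)
    moreover have "P ! j \<subseteq> {1..n}" "card (P ! j) = sorted_list_of_set Q ! j"
      using chain j unfolding Q_chain_def by blast+
    ultimately show ?thesis using j by simp
  qed (simp add: key_set_def)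
  then show "key_set (\<zeta> c) \<subseteq> {1..n}" "card (key_set (\<zeta> c)) = \<zeta> c" by auto
qed

lemma lam_key_eq: "(r, c) \<in> shape lam \<Longrightarrow> lam_key n Q lam P r c = sorted_list_of_set (key_set (\<zeta> c)) ! (r - 1)"
  by (simp add: lam_key_def key_set_def key_column_def)

text \<open>Stated for any filling with sorted columns, since it is applied to tabloids and to
  scanning tableaux.\<close>

lemma filling_le_key_iff:
  assumes S: "\<And>c. c \<in> {1..m} \<Longrightarrow> finite (S c) \<and> card (S c) = \<zeta> c"
    and F: "\<And>r c. c \<in> {1..m} \<Longrightarrow> r \<in> {1..\<zeta> c} \<Longrightarrow> F r c = sorted_list_of_set (S c) ! (r - 1)"
  shows "filling_le lam F (lam_key n Q lam P) \<longleftrightarrow> (\<forall>c\<in>{1..m}. S c \<preceq> key_set (\<zeta> c))"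
proof -
  let ?K = "\<lambda>c. key_set (\<zeta> c)"
  have "filling_le lam F (lam_key n Q lam P) \<longleftrightarrow>
      (\<forall>c\<in>{1..m}. \<forall>r\<in>{1..\<zeta> c}. sorted_list_of_set (S c) ! (r - 1) \<le> sorted_list_of_set (?K c) ! (r - 1))"
  proof
    assume a: "filling_le lam F (lam_key n Q lam P)"
    show "\<forall>c\<in>{1..m}. \<forall>r\<in>{1..\<zeta> c}. sorted_list_of_set (S c) ! (r - 1) \<le> sorted_list_of_set (?K c) ! (r - 1)"
    proof (intro ballI)
      fix c r assume cr: "c \<in> {1..m}" "r \<in> {1..\<zeta> c}"
      then have s: "(r, c) \<in> shape lam" using shape_cases by blast
      then have "F r c \<le> lam_key n Q lam P r c" using a unfolding filling_le_def by blast
      then show "sorted_list_of_set (S c) ! (r - 1) \<le> sorted_list_of_set (?K c) ! (r - 1)"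
        using F[OF cr] lam_key_eq[OF s] by simp
    qed
  next
    assume a: "\<forall>c\<in>{1..m}. \<forall>r\<in>{1..\<zeta> c}. sorted_list_of_set (S c) ! (r - 1) \<le> sorted_list_of_set (?K c) ! (r - 1)"
    have "F r c \<le> lam_key n Q lam P r c" if s: "(r, c) \<in> shape lam" for r c
    proof -
      have cr: "c \<in> {1..m}" "r \<in> {1..\<zeta> c}" using s shape_cases by blast+
      show ?thesis using a[rule_format, OF cr] F[OF cr] lam_key_eq[OF s] by simp
    qed
    then show "filling_le lam F (lam_key n Q lam P)" unfolding filling_le_def by blast
  qed
  also have "\<dots> \<longleftrightarrow> (\<forall>c\<in>{1..m}. S c \<preceq> ?K c)"
  proof (rule ball_cong[OF refl])
    fix c assume c: "c \<in> {1..m}"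
    have "S c \<preceq> ?K c \<longleftrightarrow> (\<forall>i<\<zeta> c. sorted_list_of_set (S c) ! i \<le> sorted_list_of_set (?K c) ! i)"
      using col_le_iff_nth[of "S c" "?K c"] S[OF c] key_set[OF c] col_finite by simp
    also have "\<dots> \<longleftrightarrow> (\<forall>r\<in>{1..\<zeta> c}. sorted_list_of_set (S c) ! (r - 1) \<le> sorted_list_of_set (?K c) ! (r - 1))"
    proof
      assume a: "\<forall>i<\<zeta> c. sorted_list_of_set (S c) ! i \<le> sorted_list_of_set (?K c) ! i"
      show "\<forall>r\<in>{1..\<zeta> c}. sorted_list_of_set (S c) ! (r - 1) \<le> sorted_list_of_set (?K c) ! (r - 1)"
      proof
        fix r assume "r \<in> {1..\<zeta> c}"
        then have "r - 1 < \<zeta> c" by auto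
        then show "sorted_list_of_set (S c) ! (r - 1) \<le> sorted_list_of_set (?K c) ! (r - 1)" using a by blast
      qed
    next
      assume a: "\<forall>r\<in>{1..\<zeta> c}. sorted_list_of_set (S c) ! (r - 1) \<le> sorted_list_of_set (?K c) ! (r - 1)"
      show "\<forall>i<\<zeta> c. sorted_list_of_set (S c) ! i \<le> sorted_list_of_set (?K c) ! i"
      proof (intro allI impI)
        fix i assume "i < \<zeta> c"
        then show "sorted_list_of_set (S c) ! i \<le> sorted_list_of_set (?K c) ! i" using a[rule_format, of "Suc i"] by simp
      qed
    qed
    finally show "(\<forall>r\<in>{1..\<zeta> c}. sorted_list_of_set (S c) ! (r - 1) \<le> sorted_list_of_set (?K c) ! (r - 1)) \<longleftrightarrow> S c \<preceq> ?K c" ..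
  qed
  finally show ?thesis .
qed

lemma ball_columns:
  assumes "length Xs = m"
  shows "(\<forall>c\<in>{1..m}. R (Xs ! (c - 1)) c) \<longleftrightarrow> (\<forall>i<m. R (Xs ! i) (Suc i))"
proof (intro iffI allI impI ballI)
  fix i assume a: "\<forall>c\<in>{1..m}. R (Xs ! (c - 1)) c" and "i < m"
  then show "R (Xs ! i) (Suc i)" using a[rule_format, of "Suc i"] by simp
next
  fix c assume a: "\<forall>i<m. R (Xs ! i) (Suc i)" and c: "c \<in> {1..m}"
  then have "c - 1 < m" "Suc (c - 1) = c" by auto
  then show "R (Xs ! (c - 1)) c" using a by metis
qed

lemma tabloid_le_key_iff:
  assumes T: "T \<in> tabloids n lam"
  shows "filling_le lam T (lam_key n Q lam P) \<longleftrightarrow> (\<forall>C\<in>set (columns T). C \<preceq> key_set (card C))"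
proof -
  have "filling_le lam T (lam_key n Q lam P) \<longleftrightarrow> (\<forall>c\<in>{1..m}. column T c \<preceq> key_set (\<zeta> c))"
    by (rule filling_le_key_iff) (use column_card[OF T] column_finite column_nth[OF T] in auto)
  also have "\<dots> \<longleftrightarrow> (\<forall>C\<in>set (columns T). C \<preceq> key_set (card C))"
    using column_card[OF T] by (simp add: columns_def atLeastLessThanSuc_atLeastAtMost del: upt_Suc)
  finally show ?thesis .
qed

lemma demazure_iff:
  assumes T: "T \<in> tableaux n lam"
  shows "T \<in> demazure_tableaux n Q lam P \<longleftrightarrow> key_bounded key_set (columns T)"
proof -
  have T': "T \<in> tabloids n lam" using T by (simp add: tableaux_def)
  have tab: "tab n (columns T)" using T tableaux_iff[OF T'] by simp
  let ?S = "right_keys (columns T)"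
  have cards: "card (?S ! i) = \<zeta> (Suc i)" if "i < m" for i
  proof -
    have "map card ?S = lens" using right_keys_card[OF tab] columns_card[OF T'] by simp
    then show ?thesis using nth_map[of i ?S card] that lens_nth by simp
  qed
  have fin: "finite (?S ! i)" if "i < m" for i
    using right_keys_cols[OF tab, of "?S ! i"] that col_finite by simp
  have "filling_le lam (scanning_tableau lam T) (lam_key n Q lam P) \<longleftrightarrow> (\<forall>c\<in>{1..m}. ?S ! (c - 1) \<preceq> key_set (\<zeta> c))"
  proof (rule filling_le_key_iff)
    fix c assume "c \<in> {1..m}"
    then have "c - 1 < m" "Suc (c - 1) = c" by auto
    then show "finite (?S ! (c - 1)) \<and> card (?S ! (c - 1)) = \<zeta> c" using cards[of "c - 1"] fin[of "c - 1"] by simp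
  qed (rule scanning_tableau_eq[OF T])
  also have "\<dots> \<longleftrightarrow> (\<forall>i<m. ?S ! i \<preceq> key_set (\<zeta> (Suc i)))"
    by (rule ball_columns) simp
  also have "\<dots> \<longleftrightarrow> key_bounded key_set (columns T)"
    using cards by (simp add: key_bounded_def all_set_conv_all_nth)
  finally show ?thesis using T by (simp add: demazure_tableaux_def)
qed

definition outside_lists :: "nat set list set" where
  "outside_lists = {Cs \<in> tabloid_lists. \<exists>C\<in>set Cs. \<not> C \<preceq> key_set (card C)}"

definition demazure_lists :: "nat set list set" where
  "demazure_lists = {Cs \<in> tableau_lists. key_bounded key_set Cs}"

abbreviation \<Gamma> :: "cpoly set" where "\<Gamma> \<equiv> cpoly.span (poly_product ` tabloid_lists)"
abbreviation Z :: "cpoly set" where "Z \<equiv> cpoly.span (poly_product ` outside_lists)"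

lemma columns_outside:
  "columns ` {T \<in> tabloids n lam. \<not> filling_le lam T (lam_key n Q lam P)} = outside_lists"
  unfolding outside_lists_def columns_tabloids[symmetric] using tabloid_le_key_iff by auto

lemma columns_demazure: "columns ` demazure_tableaux n Q lam P = demazure_lists"
proof -
  have "demazure_tableaux n Q lam P = {T \<in> tableaux n lam. key_bounded key_set (columns T)}"
    using demazure_iff by (auto simp: demazure_tableaux_def)
  then show ?thesis unfolding demazure_lists_def tableau_lists_def columns_tableaux[symmetric] by auto
qed

lemma Z_subset: "Z \<subseteq> \<Gamma>"
  by (rule cpoly.span_mono) (auto simp: outside_lists_def)

lemma adapted_tabloid:
  assumes Cs: "Cs \<in> tableau_lists"
  shows "poly_product (adapted key_set Cs) \<in> \<Gamma>"
    and "\<not> key_bounded key_set Cs \<Longrightarrow> poly_product (adapted key_set Cs) \<in> Z"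
proof -
  have t: "tab n Cs" "map card Cs = lens" using Cs by (auto simp: tableau_lists_def)
  have out: "poly_product (adapted key_set Cs) \<in> Z" if nb: "\<not> key_bounded key_set Cs"
  proof -
    define e where "e = first_failure key_set Cs"
    define S Ms where "S = foldl lift (Cs ! e) (drop (Suc e) Cs)" and "Ms = moved (Cs ! e) (drop (Suc e) Cs)"
    have e: "e < length Cs" "\<not> S \<preceq> key_set (card S)"
      using first_failure[OF nb] right_keys_nth[of e Cs] by (auto simp: failing_def e_def S_def)
    have dec: "Cs = take e Cs @ Cs ! e # drop (Suc e) Cs" using e(1) by (rule id_take_nth_drop)
    have t1: "tab n (take e Cs)" "tab n (Cs ! e # drop (Suc e) Cs)" using t(1) dec by (metis tab_append)+
    \<comment> \<open>Factors commute, so the rotated key may be put back into position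
      \<open>e\<close>; this restores the shape.\<close>
    let ?Ds = "take e Cs @ S # Ms"
    have "map card ?Ds = map card (take e Cs) @ card (Cs ! e) # map card (drop (Suc e) Cs)"
      using foldl_lift[OF t1(2)] tab_moved[OF t1(2)] by (simp add: S_def Ms_def)
    also have "\<dots> = lens" using arg_cong[OF dec, of "map card"] t(2) by simp
    finally have "map card ?Ds = lens" .
    moreover have "\<forall>C\<in>set ?Ds. C \<subseteq> {1..n}"
      using t1(1) foldl_lift[OF t1(2)] tab_moved[OF t1(2)] by (auto simp: S_def Ms_def tab_def)
    ultimately have "?Ds \<in> outside_lists" using e(2) by (auto simp: outside_lists_def tabloid_lists_def)
    moreover have "poly_product (adapted key_set Cs) = poly_product ?Ds"
      using nb by (simp add: adapted_def rotated_def e_def[symmetric] S_def Ms_def poly_product_def ac_simps)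
    ultimately show ?thesis by (simp add: cpoly.span_base)
  qed
  show "\<not> key_bounded key_set Cs \<Longrightarrow> poly_product (adapted key_set Cs) \<in> Z" by (rule out)
  show "poly_product (adapted key_set Cs) \<in> \<Gamma>"
  proof (cases "key_bounded key_set Cs")
    case True
    then show ?thesis using Cs tableau_lists_subset by (auto simp: adapted_def intro: cpoly.span_base)
  next
    case False
    then show ?thesis using out Z_subset by blast
  qed
qed

section \<open>The dimension count\<close>

abbreviation adapted_poly :: "nat set list \<Rightarrow> cpoly" where
  "adapted_poly Cs \<equiv> poly_product (adapted key_set Cs)"

lemma adapted_poly_independent:
  assumes "F \<subseteq> tableau_lists" "(\<Sum>Cs\<in>F. Poly_Mapping.single 0 (a Cs) * adapted_poly Cs) = 0"
  shows "\<forall>Cs\<in>F. a Cs = 0"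
proof (rule adapted_independent)
  show "finite F" using assms(1) finite_tableau_lists finite_subset by blast
  show "\<And>T. T \<in> F \<Longrightarrow> tab n T \<and> map card T = lens" using assms(1) tableau_list_standard by blast
  fix A
  have "eval_cpoly A (\<Sum>Cs\<in>F. Poly_Mapping.single 0 (a Cs) * adapted_poly Cs) = 0" using assms(2) by simp
  then show "(\<Sum>Cs\<in>F. a Cs * col_product (adapted key_set Cs) A) = 0"
    by (simp add: eval_cpoly_sum eval_cpoly_scale eval_poly_product)
qed

text \<open>The dimension count needs the number of distinct polynomials; independence as a family
  rules out coincidences.\<close>

lemma adapted_poly_inj: "inj_on adapted_poly tableau_lists"
proof (rule inj_onI, rule ccontr)
  fix x y assume xy: "x \<in> tableau_lists" "y \<in> tableau_lists" "adapted_poly x = adapted_poly y" "x \<noteq> y"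
  define a where "a C = (if C = x then 1 else - 1 :: complex)" for C
  have "Poly_Mapping.single 0 (- 1 :: complex) = (- 1 :: cpoly)"
    by (metis single_one single_uminus)
  then have "(\<Sum>Cs\<in>{x, y}. Poly_Mapping.single 0 (a Cs) * adapted_poly Cs) = 0"
    using xy(3,4) by (simp add: a_def)
  then have "a x = 0" using adapted_poly_independent[of "{x, y}" a] xy(1,2) by blast
  then show False by (simp add: a_def)
qed

text \<open>By straightening, \<Gamma> is spanned by the monomials of tableaux. There are as many
  independent adapted monomials, so a tableau monomial outside their span would give an independent
  set larger than a spanning one.\<close>

lemma span_adapted: "\<Gamma> = cpoly.span (adapted_poly ` tableau_lists)"
proof
  let ?G = "adapted_poly ` tableau_lists" and ?S = "poly_product ` tableau_lists"
  have fin: "finite ?G" "finite ?S" using finite_tableau_lists by auto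
  have \<Gamma>S: "\<Gamma> \<subseteq> cpoly.span ?S"
    using straighten_tabloid by (intro cpoly.span_minimal) auto
  have indep: "cpoly.independent ?G"
  proof (rule cpoly.independent_if_scalars_zero[OF fin(1)])
    fix f x assume s: "(\<Sum>x\<in>?G. Poly_Mapping.single 0 (f x) * x) = 0" and x: "x \<in> ?G"
    then have "(\<Sum>Cs\<in>tableau_lists. Poly_Mapping.single 0 (f (adapted_poly Cs)) * adapted_poly Cs) = 0"
      using sum.reindex[OF adapted_poly_inj, of "\<lambda>x. Poly_Mapping.single 0 (f x) * x"] by (simp only: comp_def)
    then have "\<forall>Cs\<in>tableau_lists. f (adapted_poly Cs) = 0"
      using adapted_poly_independent[of tableau_lists "\<lambda>Cs. f (adapted_poly Cs)"] by blast
    then show "f x = 0" using x by blast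
  qed
  have G\<Gamma>: "?G \<subseteq> \<Gamma>" using adapted_tabloid(1) by blast
  have "?S \<subseteq> cpoly.span ?G"
  proof (rule ccontr)
    assume "\<not> ?S \<subseteq> cpoly.span ?G"
    then obtain x where x: "x \<in> ?S" "x \<notin> cpoly.span ?G" by blast
    have "cpoly.independent (insert x ?G)" using indep x(2) by (rule cpoly.independent_insertI[rotated])
    moreover have "insert x ?G \<subseteq> cpoly.span ?S" using x(1) G\<Gamma> \<Gamma>S by (auto intro: cpoly.span_base)
    ultimately have "card (insert x ?G) \<le> card ?S" using cpoly.independent_span_bound[OF fin(2)] by blast
    moreover have "x \<notin> ?G" using cpoly.span_base[of x ?G] x(2) by argo
    ultimately have "Suc (card ?G) \<le> card ?S" using fin by simp
    moreover have "card ?G = card tableau_lists" by (rule card_image[OF adapted_poly_inj])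
    moreover have "card ?S \<le> card tableau_lists" by (rule card_image_le[OF finite_tableau_lists])
    ultimately show False by simp
  qed
  then have "cpoly.span ?S \<subseteq> cpoly.span ?G" by (rule cpoly.span_minimal) (rule cpoly.subspace_span)
  then show "\<Gamma> \<subseteq> cpoly.span ?G" using \<Gamma>S by blast
  show "cpoly.span ?G \<subseteq> \<Gamma>" by (rule cpoly.span_minimal[OF G\<Gamma> cpoly.subspace_span])
qed

section \<open>Independence modulo \<open>Z\<close>\<close>

definition below_key :: "(nat \<Rightarrow> nat) set" where
  "below_key = {v. v permutes {1..n} \<and> (\<forall>q\<in>set lens. flag v q \<preceq> key_set q)}"

lemma lens_le: "q \<in> set lens \<Longrightarrow> q \<le> n"
  using col_len_le by (auto simp: lens_def simp del: upt_Suc)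

lemma below_key_closed: "down_closed n below_key"
  unfolding down_closed_def
proof (intro conjI ballI allI impI)
  fix v u assume v: "v \<in> below_key" and u: "u permutes {1..n} \<and> bruhat_le n u v"
  have "flag u q \<preceq> key_set q" if q: "q \<in> set lens" for q
  proof -
    have "flag u q \<preceq> flag v q" using u lens_le[OF q] unfolding bruhat_le_def by blast
    moreover have "flag v q \<preceq> key_set q" using v q unfolding below_key_def by blast
    ultimately show ?thesis by (rule col_le_trans)
  qed
  then show "u \<in> below_key" using u unfolding below_key_def by blast
qed (simp add: below_key_def)

text \<open>Each generator has a column that is not below the key; by transitivity it is not below
  the flag of \<open>v\<close> either, so its minor vanishes.\<close>

lemma Z_vanishes:
  assumes p: "p \<in> Z" and v: "v \<in> below_key" and A: "supported n v A"
  shows "eval_cpoly A p = 0"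
  using p
proof (induction rule: cpoly.span_induct_alt)
  case base
  then show ?case by simp
next
  case (step c x y)
  have "x \<in> poly_product ` outside_lists" by (rule step)
  then obtain Cs where Cs: "x = poly_product Cs" "Cs \<in> outside_lists" by (rule imageE)
  have l: "\<forall>C\<in>set Cs. C \<subseteq> {1..n}" "map card Cs = lens" "\<exists>C\<in>set Cs. \<not> C \<preceq> key_set (card C)"
    using Cs(2) by (simp_all add: outside_lists_def tabloid_lists_def)
  have sl: "card ` set Cs = set lens" using arg_cong[OF l(2), of set] by simp
  from l(3) obtain C where C: "C \<in> set Cs" "\<not> C \<preceq> key_set (card C)" by blast
  then have C': "C \<subseteq> {1..n}" "card C \<in> set lens" using l(1) sl by blast+
  have "\<not> C \<preceq> flag v (card C)"
  proof
    assume "C \<preceq> flag v (card C)"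
    moreover have "flag v (card C) \<preceq> key_set (card C)" using v C'(2) unfolding below_key_def by blast
    ultimately show False using C(2) col_le_trans by blast
  qed
  moreover have "v permutes {1..n}" using v unfolding below_key_def by blast
  ultimately have "vanishes n v (col_minor C)"
    using col_minor_vanishes[of C n v] col_finite[OF C'(1)] lens_le[OF C'(2)] by blast
  then have "col_minor C A = 0" using A by (simp add: vanishes_def)
  then have "0 \<in> (\<lambda>C. col_minor C A) ` set Cs" using C(1) by (metis imageI)
  then have "eval_cpoly A x = 0" by (simp add: Cs(1) eval_poly_product col_product_def prod_list_zero_iff)
  moreover have "eval_cpoly A y = 0" by (rule step)
  ultimately show ?case by (simp add: eval_cpoly_add eval_cpoly_scale)
qed

text \<open>A relation modulo \<open>Z\<close> is a genuine relation on the matrices of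
  \<open>below_key\<close>. Demazure tableaux are standard there, because the permutation realising
  their right keys lies in this ideal.\<close>

lemma demazure_independent:
  assumes F: "F \<subseteq> demazure_lists" and Zsum: "(\<Sum>Cs\<in>F. Poly_Mapping.single 0 (a Cs) * poly_product Cs) \<in> Z"
  shows "\<forall>Cs\<in>F. a Cs = 0"
proof -
  have "F \<subseteq> tableau_lists" using F by (auto simp: demazure_lists_def)
  then have fin: "finite F" by (rule finite_subset[OF _ finite_tableau_lists])
  have st: "standard_on n below_key lens Cs" if "Cs \<in> F" for Cs
  proof -
    have "Cs \<in> demazure_lists" using F that by (rule subsetD)
    then have t: "tab n Cs" "map card Cs = lens" "key_bounded key_set Cs"
      by (simp_all add: demazure_lists_def tableau_lists_def)
    obtain v where v: "v permutes {1..n}" "\<forall>S\<in>set (right_keys Cs). flag v (card S) = S"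
      using key_permutation[OF t(1)] by metis
    have "flag v q \<preceq> key_set q" if q: "q \<in> set lens" for q
    proof -
      have "lens = map card (right_keys Cs)" using right_keys_card[OF t(1)] t(2) by simp
      then obtain S where S: "S \<in> set (right_keys Cs)" "q = card S" using q by auto
      then have "S \<preceq> key_set (card S)" using t(3) unfolding key_bounded_def by blast
      moreover have "flag v (card S) = S" using v(2) S(1) by blast
      ultimately show ?thesis using S(2) by simp
    qed
    then have "v \<in> below_key" using v(1) unfolding below_key_def by blast
    then show ?thesis using t key_bounded_flag[OF v(2)] unfolding standard_on_def by blast
  qed
  have "vanishes n v (\<lambda>A. \<Sum>Cs\<in>F. a Cs * col_product Cs A)" if v: "v \<in> below_key" for v
    unfolding vanishes_def
  proof (intro allI impI)
    fix A assume "supported n v A"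
    from Z_vanishes[OF Zsum v this] show "(\<Sum>Cs\<in>F. a Cs * col_product Cs A) = 0"
      by (simp add: eval_cpoly_sum eval_cpoly_scale eval_poly_product)
  qed
  then show ?thesis
    using standard_independence[of n lens] below_key_closed fin st unfolding standard_independent_def by blast
qed

end

section \<open>The quotient space and its basis\<close>

context key_shape
begin

lemma product_carrier: "poly_product ` tabloid_lists \<subseteq> carrier (poly_space n)"
  using poly_product_carrier by (auto simp: tabloid_lists_def)

lemma \<Gamma>_carrier: "\<Gamma> \<subseteq> carrier (poly_space n)"
  by (rule cpoly.span_minimal[OF product_carrier poly_space_subspace])

lemma monomial_image:
  assumes "X \<subseteq> tabloids n lam"
  shows "tabloid_monomial lam ` X = poly_product ` columns ` X"
  unfolding image_image by (rule image_cong[OF refl]) (use assms tabloid_monomial_columns in blast)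

lemma Gamma_space_simps:
  "carrier (Gamma_space n lam) = \<Gamma>" "add (Gamma_space n lam) = (+)" "zero (Gamma_space n lam) = 0"
  "module.smult (Gamma_space n lam) = (\<lambda>a p. Poly_Mapping.single 0 a * p)"
proof -
  have "tabloid_monomial lam ` tabloids n lam = poly_product ` tabloid_lists"
    using monomial_image[OF subset_refl] by (simp only: columns_tabloids)
  then show "carrier (Gamma_space n lam) = \<Gamma>"
    using poly_space_span[OF product_carrier] by (simp add: Gamma_space_def)
qed (simp_all add: Gamma_space_def poly_space_simps(2-4))

lemma Z_space_eq: "Z_space n Q lam P = Z"
proof -
  let ?X = "{T \<in> tabloids n lam. \<not> filling_le lam T (lam_key n Q lam P)}"
  have "tabloid_monomial lam ` ?X = poly_product ` columns ` ?X" by (rule monomial_image) auto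
  then have "tabloid_monomial lam ` ?X = poly_product ` outside_lists" by (simp only: columns_outside)
  moreover have "poly_product ` outside_lists \<subseteq> carrier (poly_space n)"
    using product_carrier unfolding outside_lists_def by blast
  ultimately show ?thesis using poly_space_span[of "poly_product ` outside_lists" n] by (simp add: Z_space_def)
qed

lemma vectorspace_Gamma: "vectorspace (class_ring :: complex ring) (Gamma_space n lam)"
proof -
  interpret P: vectorspace "class_ring :: complex ring" "poly_space n" by (rule vectorspace_poly_space)
  have "tabloid_monomial lam ` tabloids n lam = poly_product ` tabloid_lists"
    using monomial_image[OF subset_refl] by (simp only: columns_tabloids)
  then have "tabloid_monomial lam ` tabloids n lam \<subseteq> carrier (poly_space n)" using product_carrier by simp
  then have "submodule class_ring (P.span (tabloid_monomial lam ` tabloids n lam)) (poly_space n)"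
    by (rule P.span_is_submodule)
  then have "subspace class_ring (P.span (tabloid_monomial lam ` tabloids n lam)) (poly_space n)"
    by (simp add: subspace_def P.vectorspace_axioms)
  then show ?thesis unfolding Gamma_space_def by (rule P.subspace_is_vs)
qed

lemma subspace_Z: "subspace (class_ring :: complex ring) Z (Gamma_space n lam)"
proof -
  interpret V: vectorspace "class_ring :: complex ring" "Gamma_space n lam" by (rule vectorspace_Gamma)
  have mod: "Module.module (class_ring :: complex ring) (Gamma_space n lam)" by (rule V.module_axioms)
  have "submodule (class_ring :: complex ring) Z (Gamma_space n lam)"
    by (rule submodule.intro[OF mod])
      (use Z_subset in \<open>auto simp: Gamma_space_simps intro: cpoly.span_add cpoly.span_zero cpoly.span_scale\<close>)
  then show ?thesis by (simp add: subspace_def V.vectorspace_axioms)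
qed

abbreviation Quot :: "(complex, cpoly set) module" where "Quot \<equiv> Gamma_quot n Q lam P"
abbreviation cls :: "cpoly \<Rightarrow> cpoly set" where "cls \<equiv> residue_class n Q lam P"

lemma cls_eq: "cls p = (\<lambda>z. z + p) ` Z"
  unfolding residue_class_def Z_space_eq a_r_coset_def r_coset_def
  by (auto simp: Gamma_space_simps)

lemma cls_zero_iff: "cls p = Z \<longleftrightarrow> p \<in> Z"
proof
  assume "cls p = Z"
  moreover have "0 + p \<in> cls p" unfolding cls_eq using cpoly.span_zero by (rule imageI)
  ultimately show "p \<in> Z" by simp
next
  assume p: "p \<in> Z"
  show "cls p = Z"
  proof
    show "cls p \<subseteq> Z" unfolding cls_eq using cpoly.span_add[OF _ p] by auto
    show "Z \<subseteq> cls p"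
    proof
      fix z assume "z \<in> Z"
      then have "z - p \<in> Z" using p by (rule cpoly.span_diff)
      then have "(z - p) + p \<in> cls p" unfolding cls_eq by (rule imageI)
      then show "z \<in> cls p" by simp
    qed
  qed
qed

lemma Quot_simps: "carrier Quot = cls ` \<Gamma>" "zero Quot = Z"
proof -
  show "carrier Quot = cls ` \<Gamma>"
    unfolding Gamma_quot_def quot_space_def residue_class_def
    by (auto simp: A_RCOSETS_def RCOSETS_def a_r_coset_def Gamma_space_simps)
  show "zero Quot = Z" by (simp add: Gamma_quot_def quot_space_def Z_space_eq)
qed

lemma Quot_add: "cls p \<oplus>\<^bsub>Quot\<^esub> cls q = cls (p + q)"
proof -
  have "cls p \<oplus>\<^bsub>Quot\<^esub> cls q = {a + b | a b. a \<in> cls p \<and> b \<in> cls q}"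
    by (auto simp: Gamma_quot_def quot_space_def set_add_def set_mult_def Gamma_space_simps)
  also have "\<dots> = cls (p + q)"
  proof (intro equalityI subsetI)
    fix x assume "x \<in> {a + b | a b. a \<in> cls p \<and> b \<in> cls q}"
    then obtain y z where yz: "y \<in> Z" "z \<in> Z" "x = (y + p) + (z + q)" by (auto simp: cls_eq)
    have "x = (y + z) + (p + q)" using yz(3) by (simp add: algebra_simps)
    moreover have "y + z \<in> Z" using yz(1,2) by (rule cpoly.span_add)
    ultimately show "x \<in> cls (p + q)" unfolding cls_eq by blast
  next
    fix x assume "x \<in> cls (p + q)"
    then obtain z where z: "z \<in> Z" "x = z + (p + q)" by (auto simp: cls_eq)
    have "x = (z + p) + (0 + q)" using z by (simp add: algebra_simps)
    moreover have "z + p \<in> cls p" "0 + q \<in> cls q" unfolding cls_eq using z(1) cpoly.span_zero by blast+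
    ultimately show "x \<in> {a + b | a b. a \<in> cls p \<and> b \<in> cls q}" by blast
  qed
  finally show ?thesis .
qed

lemma Quot_smult: "a \<odot>\<^bsub>Quot\<^esub> cls p = cls (Poly_Mapping.single 0 a * p)"
proof -
  let ?s = "\<lambda>x. Poly_Mapping.single 0 a * x"
  have eq: "cls (?s x) = cls (?s p)" if x: "x \<in> cls p" for x
  proof -
    obtain z where z: "z \<in> Z" "x = z + p" using x by (auto simp: cls_eq)
    have "cls (?s x) = cls (?s z) \<oplus>\<^bsub>Quot\<^esub> cls (?s p)" by (simp add: Quot_add z(2) distrib_left)
    also have "cls (?s z) = cls 0"
      using cls_zero_iff[of "?s z"] cls_zero_iff[of 0] cpoly.span_scale[OF z(1)] cpoly.span_zero by simp
    finally show ?thesis by (simp add: Quot_add)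
  qed
  have "a \<odot>\<^bsub>Quot\<^esub> cls p = (\<Union>x\<in>cls p. cls (?s x))"
    by (simp add: Gamma_quot_def quot_space_def Gamma_space_simps residue_class_def)
  also have "\<dots> = cls (?s p)"
  proof (rule UN_constant_eq)
    have "0 + p \<in> cls p" unfolding cls_eq using cpoly.span_zero by (rule imageI)
    then show "p \<in> cls p" by simp
  qed (use eq in blast)
  finally show ?thesis .
qed

lemma demazure_basis:
  "basis_family (class_ring :: complex ring) Quot (\<lambda>T. cls (tabloid_monomial lam T)) (demazure_tableaux n Q lam P)"
proof -
  let ?D = "demazure_tableaux n Q lam P" and ?mon = "tabloid_monomial lam"
  let ?v = "\<lambda>T. cls (?mon T)"
  interpret V: vectorspace "class_ring :: complex ring" Quot
    unfolding Gamma_quot_def Z_space_eq by (rule vectorspace_quot_space[OF subspace_Z])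
  have D: "?D \<subseteq> tabloids n lam" by (auto simp: demazure_tableaux_def tableaux_def)
  have mon: "?mon T = poly_product (columns T)" "columns T \<in> demazure_lists" if "T \<in> ?D" for T
    using tabloid_monomial_columns[of T] D that columns_demazure by auto
  have dem\<Gamma>: "poly_product Cs \<in> \<Gamma>" if "Cs \<in> demazure_lists" for Cs
    using that tableau_lists_subset by (auto simp: demazure_lists_def intro: cpoly.span_base)
  have mon\<Gamma>: "?mon T \<in> \<Gamma>" if "T \<in> ?D" for T using mon[OF that] dem\<Gamma> by simp
  have car: "?v \<in> ?D \<rightarrow> carrier Quot" using mon\<Gamma> by (auto simp: Quot_simps)
  have fsum: "(\<Oplus>\<^bsub>Quot\<^esub>T\<in>J. a T \<odot>\<^bsub>Quot\<^esub> ?v T) = cls (\<Sum>T\<in>J. Poly_Mapping.single 0 (a T) * ?mon T)"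
    if "finite J" "J \<subseteq> ?D" for J and a :: "(nat \<Rightarrow> nat \<Rightarrow> nat) \<Rightarrow> complex"
    using that
  proof (induction J rule: finite_induct)
    case empty
    have "cls 0 = Z" using cls_zero_iff cpoly.span_zero by blast
    then show ?case by (simp add: Quot_simps)
  next
    case (insert T J)
    have in_car: "a T \<odot>\<^bsub>Quot\<^esub> ?v T \<in> carrier Quot" if "T \<in> ?D" for T
      unfolding Quot_smult Quot_simps using cpoly.span_scale[OF mon\<Gamma>[OF that]] by (rule imageI)
    have "(\<Oplus>\<^bsub>Quot\<^esub>T\<in>insert T J. a T \<odot>\<^bsub>Quot\<^esub> ?v T) = (a T \<odot>\<^bsub>Quot\<^esub> ?v T) \<oplus>\<^bsub>Quot\<^esub> (\<Oplus>\<^bsub>Quot\<^esub>T\<in>J. a T \<odot>\<^bsub>Quot\<^esub> ?v T)"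
      by (rule V.finsum_insert) (use insert in_car in auto)
    then show ?case using insert by (simp add: Quot_smult Quot_add)
  qed
  have "lin_indpt_family (class_ring :: complex ring) Quot ?v ?D"
    unfolding lin_indpt_family_def
  proof (intro conjI allI impI)
    fix J and a :: "(nat \<Rightarrow> nat \<Rightarrow> nat) \<Rightarrow> complex"
    assume "finite J \<and> J \<subseteq> ?D \<and> a \<in> J \<rightarrow> carrier class_ring \<and> (\<Oplus>\<^bsub>Quot\<^esub>T\<in>J. a T \<odot>\<^bsub>Quot\<^esub> ?v T) = \<zero>\<^bsub>Quot\<^esub>"
    then have J: "finite J" "J \<subseteq> ?D" and z: "(\<Oplus>\<^bsub>Quot\<^esub>T\<in>J. a T \<odot>\<^bsub>Quot\<^esub> ?v T) = \<zero>\<^bsub>Quot\<^esub>" by auto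
    have inj: "inj_on columns J" using columns_inj J(2) D inj_on_subset by blast
    \<comment> \<open>Coefficients are indexed by tableaux, while
      \<open>demazure_independent\<close> speaks of column lists; injectivity of
      \<open>columns\<close> translates.\<close>
    define b where "b Cs = a (the_inv_into J columns Cs)" for Cs
    have b: "b (columns T) = a T" if "T \<in> J" for T using the_inv_into_f_f[OF inj that] by (simp add: b_def)
    have "(\<Sum>T\<in>J. Poly_Mapping.single 0 (a T) * ?mon T) \<in> Z"
      using z cls_zero_iff unfolding fsum[OF J] Quot_simps by blast
    also have "(\<Sum>T\<in>J. Poly_Mapping.single 0 (a T) * ?mon T)
        = (\<Sum>T\<in>J. Poly_Mapping.single 0 (b (columns T)) * poly_product (columns T))"
      by (rule sum.cong[OF refl]) (use b mon J(2) in auto)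
    also have "\<dots> = (\<Sum>Cs\<in>columns ` J. Poly_Mapping.single 0 (b Cs) * poly_product Cs)"
      by (simp add: sum.reindex[OF inj])
    finally have "\<forall>Cs\<in>columns ` J. b Cs = 0"
      by (intro demazure_independent) (use mon(2) J(2) in auto)
    then show "\<forall>T\<in>J. a T = \<zero>\<^bsub>class_ring\<^esub>" using b by simp
  qed (rule car)
  moreover have "V.span (?v ` ?D) = carrier Quot"
  proof
    have sub: "?v ` ?D \<subseteq> carrier Quot" using car by auto
    show "V.span (?v ` ?D) \<subseteq> carrier Quot" by (rule V.span_is_subset2[OF sub])
    interpret S: submodule "class_ring :: complex ring" "V.span (?v ` ?D)" Quot by (rule V.span_is_submodule[OF sub])
    \<comment> \<open>With the adapted monomials as generators of \<Gamma>, the class of each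
      generator is either that of a Demazure monomial or zero.\<close>
    have "cls p \<in> V.span (?v ` ?D)" if "p \<in> \<Gamma>" for p
      using that unfolding span_adapted
    proof (induction rule: cpoly.span_induct_alt)
      case base
      have "cls 0 = Z" using cls_zero_iff cpoly.span_zero by blast
      then show ?case using S.zero_closed by (simp add: Quot_simps)
    next
      case (step c x y)
      obtain Cs where Cs: "x = adapted_poly Cs" "Cs \<in> tableau_lists" using step(1) by (rule imageE)
      have "cls x \<in> V.span (?v ` ?D)"
      proof (cases "key_bounded key_set Cs")
        case True
        then have "Cs \<in> demazure_lists" using Cs(2) by (simp add: demazure_lists_def)
        then obtain T where T: "T \<in> ?D" "Cs = columns T" using columns_demazure by blast
        have "cls x = ?v T" using True T mon(1)[OF T(1)] by (simp add: Cs(1) adapted_def)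
        then show ?thesis using V.in_own_span[OF sub] T(1) by blast
      next
        case False
        then have "cls x = \<zero>\<^bsub>Quot\<^esub>" using adapted_tabloid(2)[OF Cs(2)] cls_zero_iff by (simp add: Cs(1) Quot_simps)
        then show ?thesis using S.zero_closed by simp
      qed
      then have "c \<odot>\<^bsub>Quot\<^esub> cls x \<in> V.span (?v ` ?D)" by (intro S.smult_closed) simp_all
      then have "(c \<odot>\<^bsub>Quot\<^esub> cls x) \<oplus>\<^bsub>Quot\<^esub> cls y \<in> V.span (?v ` ?D)" using step(2) by (rule S.m_closed)
      then show ?case by (simp add: Quot_smult Quot_add)
    qed
    then show "carrier Quot \<subseteq> V.span (?v ` ?D)" by (auto simp: Quot_simps)
  qed
  ultimately show ?thesis unfolding basis_family_def by blast
qed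

end

theorem theorem3p8:
  fixes n :: nat and Q :: "nat set" and lam :: "nat \<Rightarrow> nat" and P :: "nat set list"
  assumes "n \<ge> 2"
    and "Q \<noteq> {}" and "Q \<subseteq> {1..n - 1}"
    and "n_partition n lam" and "short_col_lens n lam \<subseteq> Q"
    and "Q_chain n Q P"
  shows "basis_family (class_ring :: complex ring) (Gamma_quot n Q lam P)
           (\<lambda>T. residue_class n Q lam P (tabloid_monomial lam T)) (demazure_tableaux n Q lam P)"
proof -
  interpret key_shape n lam Q P
    by unfold_locales (use assms in auto)
  show ?thesis by (rule demazure_basis)
qed

end
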